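(* Let $A$ be a compact metric space, let $(I,\mathcal{I},\lambda)$ be an atomless probability space, and let $G\colon (I,\mathcal{I},\lambda)\to \mathcal{C}_A\times\mathcal{U}_A$ be any large game. Then the Nash equilibrium correspondence of $G$ has the strong closed graph property, that is, the following holds. Let $\{G^n\}_{n\in\mathbb{Z}_+}$ be any sequence of games $G^n\colon(I^n,\mathcal{I}^n,\lambda^n)\to\mathcal{C}_A\times\mathcal{U}_A$, each of which is either a finite-player game (with $|I^n|=n$) or a large game (with atomless player space), where $\sup_{i\in I^n}\lambda^n(i)\to0$ along those $n$ (if there are infinitely many) for which $G^n$ is a finite-player game. Suppose that: (i) $\{\lambda^n (G^n)^{-1}\}_{n\in\mathbb{Z}_+}$ converges weakly to $\lambda G^{-1}$ (as Borel probability measures on $\mathcal{C}_A\times\mathcal{U}_A$); (ii) for each $n$, $g^n$ is a (randomized strategy) Nash equilibrium of $G^n$, and the sequence of societal summaries $\{s(g^n)\}_{n\in\mathbb{Z}_+}$ converges weakly to some $\tau^*\in\mathcal{M}(A)$. Then there exists a (randomized strategy) Nash equilibrium $g$ of $G$ such that $s(g)=\tau^*$.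
   Context: Probability spaces are complete and countably additive. $A$ is a compact metric space (common action space) with Borel $\sigma$-algebra $\mathcal{B}(A)$. $\mathcal{M}(A)$ is the set of Borel probability measures on $A$ with the topology of weak convergence (and its Borel $\sigma$-algebra). $\mathcal{C}_A$ is the set of nonempty compact subsets of $A$ with the Hausdorff metric. $\mathcal{U}_A$ is the space of bounded continuous real functions on $A\times\mathcal{M}(A)$ with the sup norm. $\mathcal{C}_A\times\mathcal{U}_A$ has the product topology and its Borel $\sigma$-algebra. Large game: a measurable map $G\colon(I,\mathcal{I},\lambda)\to\mathcal{C}_A\times\mathcal{U}_A$, where $(I,\mathcal{I},\lambda)$ is an atomless probability space; write $G(i)=(A_i,u_i)$, where $A_i$ is player $i$'s feasible action set and $u_i$ her payoff function. A randomized strategy profile of $G$ is a measurable $g\colon I\to\mathcal{M}(A)$ with $g(i,A_i)=1$ for $\lambda$-almost all $i$ (where $g(i,B)=g(i)(B)$). Its societal summary is $s(g)=\int_I g(i)\,d\lambda(i)\in\mathcal{M}(A)$, i.e. $s(g)(B)=\int_I g(i,B)\,d\lambda(i)$ for all $B\in\mathcal{B}(A)$. It is a (randomized strategy) Nash equilibrium of $G$ if for $\lambda$-almost all $i\in I$, $\int_{A_i}u_i(a,s(g))\,g(i,da)\ge\int_{A_i}u_i(a,s(g))\,d\mu(a)$ for all $\mu\in\mathcal{M}(A_i)$. The same definitions apply to those $G^n$ that are large games. Finite-player game: a map $G^n\colon I^n\to\mathcal{C}_A\times\mathcal{U}_A$, $G^n(i)=(A_i^n,u_i^n)$, on a finite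 probability space $(I^n,\mathcal{I}^n,\lambda^n)$ with $|I^n|=n$ and $\mathcal{I}^n$ the power set. A randomized strategy profile of $G^n$ is a map $g^n\colon I^n\to\mathcal{M}(A)$ with $g^n(i,A_i^n)=1$ for all $i\in I^n$. Player $i$'s expected payoff is $$u_i^n(g^n)=\int_{\prod_{j\in I^n}A_j^n}u_i^n\Bigl(a_i,\sum_{j\in I^n}\lambda^n(j)\delta_{a_j}\Bigr)\bigotimes_{j\in I^n}g^n(j,da_j),$$ with $\delta_a$ the Dirac measure at $a$ and players randomizing independently (product measure). The societal summary is $s(g^n)=\sum_{i\in I^n}\lambda^n(i)g^n(i)$. $g^n$ is a (randomized strategy) Nash equilibrium of $G^n$ if for all $i\in I^n$, $u_i^n(g^n)\ge u_i^n(\mu,g^n_{-i})$ for all $\mu\in\mathcal{M}(A_i^n)$, where $(\mu,g^n_{-i})$ is the profile in which $i$ plays $\mu$ and each $j\ne i$ plays $g^n(j)$. *)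

theory Defs
  imports "HOL-Probability.Probability"
begin

section \<open>Borel probability measures with the topology of weak convergence\<close>

typedef (overloaded) ('a::topological_space) borel_prob =
  "{M :: 'a measure. sets M = sets borel \<and> prob_space M}"
  morphisms bp_measure Abs_borel_prob
proof
  show "return borel undefined \<in> {M :: 'a measure. sets M = sets borel \<and> prob_space M}"
    by (auto intro: prob_space_return)
qed

lemma sets_bp_measure [simp, measurable_cong]: "sets (bp_measure \<mu>) = sets borel"
  and prob_space_bp_measure [simp]: "prob_space (bp_measure \<mu>)"
  using bp_measure[of \<mu>] by auto

lemma space_bp_measure [simp]: "space (bp_measure \<mu>) = UNIV"
  using sets_eq_imp_space_eq[OF sets_bp_measure] by simp

text \<open>The coarsest topology making \<open>\<mu> \<mapsto> \<integral> f d\<mu>\<close> continuous for every bounded continuous real \<open>f\<close>.\<close>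

instantiation borel_prob :: (topological_space) topological_space
begin

definition open_borel_prob :: "'a borel_prob set \<Rightarrow> bool" where
  "open_borel_prob = generate_topology
     {{\<mu>. (LINT x|bp_measure \<mu>. apply_bcontfun f x) \<in> U} | (f :: 'a \<Rightarrow>\<^sub>C real) U. open U}"

instance
proof
  show "open (UNIV :: 'a borel_prob set)"
    unfolding open_borel_prob_def by (rule generate_topology.UNIV)
  show "open (S \<inter> T)" if "open S" "open T" for S T :: "'a borel_prob set"
    using that unfolding open_borel_prob_def by (rule generate_topology.Int)
  show "open (\<Union>K)" if "\<forall>S\<in>K. open S" for K :: "'a borel_prob set set"
    using that unfolding open_borel_prob_def by (intro generate_topology.UN) auto
qed

end

lemma open_borel_prob_basic:
  fixes f :: "'a::topological_space \<Rightarrow>\<^sub>C real"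
  assumes "open U"
  shows "open {\<mu>. (LINT x|bp_measure \<mu>. apply_bcontfun f x) \<in> U}"
  unfolding open_borel_prob_def by (rule generate_topology.Basis) (use assms in blast)

lemma continuous_on_integral_borel_prob:
  fixes f :: "'a::topological_space \<Rightarrow>\<^sub>C real"
  shows "continuous_on UNIV (\<lambda>\<mu>. LINT x|bp_measure \<mu>. apply_bcontfun f x)"
  unfolding continuous_on_open_vimage[OF open_UNIV]
  using open_borel_prob_basic[of _ f] by (auto simp: vimage_def)

lemma tendsto_borel_prob_iff:
  fixes X :: "'b \<Rightarrow> 'a::topological_space borel_prob"
  shows "(X \<longlongrightarrow> \<mu>) F \<longleftrightarrow>
    (\<forall>f :: 'a \<Rightarrow>\<^sub>C real. ((\<lambda>n. LINT x|bp_measure (X n). apply_bcontfun f x) \<longlongrightarrow>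
      (LINT x|bp_measure \<mu>. apply_bcontfun f x)) F)"
proof
  assume "(X \<longlongrightarrow> \<mu>) F"
  then show "\<forall>f :: 'a \<Rightarrow>\<^sub>C real. ((\<lambda>n. LINT x|bp_measure (X n). apply_bcontfun f x) \<longlongrightarrow>
      (LINT x|bp_measure \<mu>. apply_bcontfun f x)) F"
    using continuous_on_tendsto_compose[OF continuous_on_integral_borel_prob] by auto
next
  assume lim: "\<forall>f :: 'a \<Rightarrow>\<^sub>C real. ((\<lambda>n. LINT x|bp_measure (X n). apply_bcontfun f x) \<longlongrightarrow>
      (LINT x|bp_measure \<mu>. apply_bcontfun f x)) F"
  have "\<mu> \<in> S \<longrightarrow> eventually (\<lambda>n. X n \<in> S) F"
    if "generate_topology
     {{\<mu>. (LINT x|bp_measure \<mu>. apply_bcontfun f x) \<in> U} | (f :: 'a \<Rightarrow>\<^sub>C real) U. open U} S" for S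
    using that
  proof induction
    case UNIV
    show ?case by simp
  next
    case (Int a b)
    then show ?case by (auto intro: eventually_conj)
  next
    case (UN K)
    show ?case
    proof
      assume "\<mu> \<in> \<Union>K"
      then obtain k where "k \<in> K" "\<mu> \<in> k"
        by blast
      then have "eventually (\<lambda>n. X n \<in> k) F"
        using UN by blast
      then show "eventually (\<lambda>n. X n \<in> \<Union>K) F"
        by (rule eventually_mono) (use \<open>k \<in> K\<close> in blast)
    qed
  next
    case (Basis s)
    then obtain f :: "'a \<Rightarrow>\<^sub>C real" and U where
      s: "s = {\<mu>. (LINT x|bp_measure \<mu>. apply_bcontfun f x) \<in> U}" and "open U"
      by auto
    then show ?case
      using lim topological_tendstoD[of _ _ F U] by auto
  qed
  then show "(X \<longlongrightarrow> \<mu>) F"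
    unfolding tendsto_def open_borel_prob_def by blast
qed

definition dirac :: "'a::topological_space \<Rightarrow> 'a borel_prob" where
  "dirac a = Abs_borel_prob (return borel a)"

lemma bp_measure_dirac [simp]: "bp_measure (dirac a) = return borel a"
  unfolding dirac_def by (rule Abs_borel_prob_inverse) (auto intro: prob_space_return)

definition law :: "'i measure \<Rightarrow> ('i \<Rightarrow> 'b::topological_space) \<Rightarrow> 'b borel_prob" where
  "law M X = Abs_borel_prob (distr M borel X)"

lemma bp_measure_law:
  assumes "prob_space M" "X \<in> borel_measurable M"
  shows "bp_measure (law M X) = distr M borel X"
  unfolding law_def by (rule Abs_borel_prob_inverse) (auto intro: prob_space.prob_space_distr assms)


section \<open>Nonempty compact sets with the Hausdorff metric\<close>

typedef (overloaded) ('a::metric_space) compact_ne = "{K :: 'a set. compact K \<and> K \<noteq> {}}"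
  morphisms cset Abs_compact_ne
  by (rule exI[of _ "{undefined}"]) auto

lemma compact_cset [simp]: "compact (cset K)" and cset_nonempty [simp]: "cset K \<noteq> {}"
  using cset[of K] by auto

lemma bdd_above_infdist_cset: "bdd_above ((\<lambda>x. infdist x L) ` cset K)"
  by (intro bounded_imp_bdd_above compact_imp_bounded compact_continuous_image
        continuous_intros compact_cset)

instantiation compact_ne :: (metric_space) metric_space
begin

definition dist_compact_ne :: "'a compact_ne \<Rightarrow> 'a compact_ne \<Rightarrow> real" where
  "dist_compact_ne K L =
     max (SUP x\<in>cset K. infdist x (cset L)) (SUP y\<in>cset L. infdist y (cset K))"

definition uniformity_compact_ne :: "('a compact_ne \<times> 'a compact_ne) filter" where
  "uniformity_compact_ne = (INF e\<in>{0 <..}. principal {(x, y). dist x y < e})"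

definition open_compact_ne :: "'a compact_ne set \<Rightarrow> bool" where
  "open_compact_ne S = (\<forall>x\<in>S. \<forall>\<^sub>F (x', y) in uniformity. x' = x \<longrightarrow> y \<in> S)"

instance
proof
  have le1: "infdist x (cset L) \<le> dist K L" if "x \<in> cset K" for x and K L :: "'a compact_ne"
    unfolding dist_compact_ne_def
    by (rule max.coboundedI1, rule cSUP_upper[OF that bdd_above_infdist_cset])
  have sym: "dist K L = dist L K" for K L :: "'a compact_ne"
    by (simp add: dist_compact_ne_def max.commute)
  have nonneg: "0 \<le> dist K L" for K L :: "'a compact_ne"
  proof -
    obtain x where "x \<in> cset K"
      using cset_nonempty[of K] by blast
    then show ?thesis
      using le1[of x K L] infdist_nonneg[of x "cset L"] by linarith
  qed
  have sub: "cset K \<subseteq> cset L" if "dist K L = 0" for K L :: "'a compact_ne"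
  proof
    fix x assume "x \<in> cset K"
    then have "infdist x (cset L) = 0"
      using le1[of x K L] that infdist_nonneg[of x "cset L"] by simp
    then show "x \<in> cset L"
      by (simp add: in_closed_iff_infdist_zero compact_imp_closed)
  qed
  fix K L N :: "'a compact_ne"
  show "dist K L = 0 \<longleftrightarrow> K = L"
  proof
    assume "dist K L = 0"
    moreover from this have "dist L K = 0"
      by (subst sym)
    ultimately have "cset K = cset L"
      by (intro subset_antisym sub)
    then show "K = L"
      by (simp only: cset_inject)
  next
    assume "K = L"
    then show "dist K L = 0"
      by (simp add: dist_compact_ne_def)
  qed
  have tri: "infdist x (cset L) \<le> dist K N + dist L N" if "x \<in> cset K"
    for x and K L N :: "'a compact_ne"
  proof -
    obtain z where z: "z \<in> cset N" "\<And>y. y \<in> cset N \<Longrightarrow> dist x z \<le> dist x y"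
      using continuous_attains_inf[of "cset N" "dist x"] continuous_on_dist[OF continuous_on_const continuous_on_id]
      by (metis compact_cset cset_nonempty)
    then have "dist x z \<le> infdist x (cset N)"
      by (auto simp: infdist_notempty intro: cINF_greatest)
    have "infdist x (cset L) \<le> infdist z (cset L) + dist x z"
      by (rule infdist_triangle)
    also have "\<dots> \<le> dist N L + dist K N"
      using le1[OF z(1), of L] le1[OF that, of N] \<open>dist x z \<le> infdist x (cset N)\<close> by linarith
    finally show ?thesis
      by (simp add: sym[of N L])
  qed
  show "dist K L \<le> dist K N + dist L N"
    unfolding dist_compact_ne_def[of K L]
    by (intro max.boundedI cSUP_least cset_nonempty)
      (use tri[of _ K L N] tri[of _ L K N] in \<open>simp_all add: add.commute\<close>)
qed (rule uniformity_compact_ne_def, rule open_compact_ne_def)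

end


section \<open>Games\<close>

text \<open>A pair \<open>(A\<^sub>i, u\<^sub>i)\<close>. The type \<open>'a\<close> is the common action space; \<open>\<Rightarrow>\<^sub>C\<close> is the type of bounded
  continuous functions with the sup metric, and the product carries the product topology.\<close>

type_synonym 'a characteristics =
  "'a compact_ne \<times> (('a \<times> 'a borel_prob) \<Rightarrow>\<^sub>C real)"

definition feasible :: "('i \<Rightarrow> 'a::metric_space characteristics) \<Rightarrow> 'i \<Rightarrow> 'a set" where
  "feasible G i = cset (fst (G i))"

definition payoff ::
  "('i \<Rightarrow> 'a::metric_space characteristics) \<Rightarrow> 'i \<Rightarrow> 'a \<Rightarrow> 'a borel_prob \<Rightarrow> real" where
  "payoff G i a \<tau> = apply_bcontfun (snd (G i)) (a, \<tau>)"

definition atomless :: "'i measure \<Rightarrow> bool" where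
  "atomless M \<longleftrightarrow> (\<forall>B\<in>sets M. emeasure M B > 0 \<longrightarrow>
     (\<exists>C\<in>sets M. C \<subseteq> B \<and> 0 < emeasure M C \<and> emeasure M C < emeasure M B))"

definition large_game :: "'i measure \<Rightarrow> ('i \<Rightarrow> 'a::metric_space characteristics) \<Rightarrow> bool" where
  "large_game M G \<longleftrightarrow>
     prob_space M \<and> complete_measure M \<and> atomless M \<and> G \<in> borel_measurable M"

text \<open>Any map on a finite player space with the power set as \<open>\<sigma>\<close>-algebra is a finite-player game,
  so the condition concerns the player space only.\<close>

definition finite_player_space :: "nat \<Rightarrow> 'i measure \<Rightarrow> bool" where
  "finite_player_space n M \<longleftrightarrow>
     prob_space M \<and> finite (space M) \<and> card (space M) = n \<and> sets M = Pow (space M)"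

text \<open>\<open>s(g) = \<integral> g(i) d\<lambda>(i)\<close>; the monadic bind of the Giry monad is integration of kernels. On a finite
  player space this is the weighted sum \<open>\<Sum>i. \<lambda>(i) g(i)\<close>; see \<open>measure_societal_summary\<close> and
  \<open>measure_societal_summary_finite\<close> below.\<close>

definition societal_summary ::
  "'i measure \<Rightarrow> ('i \<Rightarrow> 'a::metric_space borel_prob) \<Rightarrow> 'a borel_prob" where
  "societal_summary M g = Abs_borel_prob (bind M (\<lambda>i. bp_measure (g i)))"

definition large_profile ::
  "'i measure \<Rightarrow> ('i \<Rightarrow> 'a::metric_space characteristics) \<Rightarrow> ('i \<Rightarrow> 'a borel_prob) \<Rightarrow> bool" where
  "large_profile M G g \<longleftrightarrow> g \<in> borel_measurable M \<and>
     (AE i in M. measure (bp_measure (g i)) (feasible G i) = 1)"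

text \<open>Probability measures on \<open>A\<^sub>i\<close> are identified with those on \<open>A\<close> giving mass one to \<open>A\<^sub>i\<close>.\<close>

definition large_nash ::
  "'i measure \<Rightarrow> ('i \<Rightarrow> 'a::metric_space characteristics) \<Rightarrow> ('i \<Rightarrow> 'a borel_prob) \<Rightarrow> bool" where
  "large_nash M G g \<longleftrightarrow> large_profile M G g \<and>
     (AE i in M. \<forall>\<mu>. measure (bp_measure \<mu>) (feasible G i) = 1 \<longrightarrow>
        (LINT a:feasible G i|bp_measure (g i). payoff G i a (societal_summary M g)) \<ge>
        (LINT a:feasible G i|bp_measure \<mu>. payoff G i a (societal_summary M g)))"

definition finite_profile ::
  "'i measure \<Rightarrow> ('i \<Rightarrow> 'a::metric_space characteristics) \<Rightarrow> ('i \<Rightarrow> 'a borel_prob) \<Rightarrow> bool" where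
  "finite_profile M G g \<longleftrightarrow> (\<forall>i\<in>space M. measure (bp_measure (g i)) (feasible G i) = 1)"

text \<open>The summary of the profile of Dirac measures is the realized action distribution
  \<open>\<Sum>j. \<lambda>(j) \<delta>\<^bsub>a j\<^esub>\<close>.\<close>

definition expected_payoff ::
  "'i measure \<Rightarrow> ('i \<Rightarrow> 'a::metric_space characteristics) \<Rightarrow> ('i \<Rightarrow> 'a borel_prob) \<Rightarrow> 'i \<Rightarrow> real" where
  "expected_payoff M G g i =
     (LINT a:(\<Pi>\<^sub>E j\<in>space M. feasible G j)|(\<Pi>\<^sub>M j\<in>space M. bp_measure (g j)).
        payoff G i (a i) (societal_summary M (\<lambda>j. dirac (a j))))"

definition finite_nash ::
  "'i measure \<Rightarrow> ('i \<Rightarrow> 'a::metric_space characteristics) \<Rightarrow> ('i \<Rightarrow> 'a borel_prob) \<Rightarrow> bool" where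
  "finite_nash M G g \<longleftrightarrow> finite_profile M G g \<and>
     (\<forall>i\<in>space M. \<forall>\<mu>. measure (bp_measure \<mu>) (feasible G i) = 1 \<longrightarrow>
        expected_payoff M G g i \<ge> expected_payoff M G (g(i := \<mu>)) i)"


subsection \<open>The societal summary is well defined\<close>

lemma measurable_emeasure_closed:
  fixes C :: "'a::metric_space set"
  assumes "closed C"
  shows "(\<lambda>\<mu>. emeasure (bp_measure \<mu>) C) \<in> borel_measurable borel"
proof (cases "C = {}")
  case False
  define h where "h k x = max 0 (1 - real k * infdist x C)" for k :: nat and x
  have h01: "0 \<le> h k x" "h k x \<le> 1" for k x
    using infdist_nonneg[of x C] by (auto simp: h_def)
  have hc: "continuous_on UNIV (h k)" for k
    unfolding h_def by (intro continuous_intros)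
  have hb: "h k \<in> bcontfun" for k
    using hc[of k] h01[of k] by (auto simp: bcontfun_def intro!: boundedI[of _ 1])
  have lim: "(\<lambda>k. h k x) \<longlonglongrightarrow> indicator C x" for x
  proof (cases "x \<in> C")
    case True
    then show ?thesis by (simp add: h_def)
  next
    case notin: False
    then have pos: "infdist x C > 0"
      using assms False by (simp add: infdist_pos_not_in_closed)
    obtain N where N: "1 < real N * infdist x C"
      using reals_Archimedean3[OF pos] by blast
    have "h k x = 0" if "k \<ge> N" for k
    proof -
      have "real N * infdist x C \<le> real k * infdist x C"
        using that pos by (intro mult_right_mono) auto
      then show ?thesis using N by (simp add: h_def)
    qed
    then have "eventually (\<lambda>k. h k x = 0) sequentially"
      by (auto simp: eventually_sequentially)
    then show ?thesis using notin by (simp add: tendsto_eventually)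
  qed
  have conv: "(\<lambda>k. LINT x|bp_measure \<mu>. h k x) \<longlonglongrightarrow> measure (bp_measure \<mu>) C" for \<mu>
  proof -
    interpret prob_space "bp_measure \<mu>" by simp
    have [measurable]: "h k \<in> borel_measurable borel" for k
      by (rule borel_measurable_continuous_onI[OF hc])
    have [measurable]: "C \<in> sets borel" using assms by simp
    have "(\<lambda>k. LINT x|bp_measure \<mu>. h k x) \<longlonglongrightarrow> (LINT x|bp_measure \<mu>. indicator C x)"
      by (rule integral_dominated_convergence[where w = "\<lambda>_. 1"])
        (use h01 lim in auto)
    then show ?thesis by simp
  qed
  have "(\<lambda>\<mu>. LINT x|bp_measure \<mu>. h k x) \<in> borel_measurable borel" for k
    using borel_measurable_continuous_onI[OF continuous_on_integral_borel_prob[of "Bcontfun (h k)"]]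
    by (simp add: Bcontfun_inverse[OF hb])
  then have "(\<lambda>\<mu>. measure (bp_measure \<mu>) C) \<in> borel_measurable borel"
    by (rule borel_measurable_LIMSEQ_real[OF conv])
  moreover have "emeasure (bp_measure \<mu>) C = ennreal (measure (bp_measure \<mu>) C)" for \<mu>
    by (intro finite_measure.emeasure_eq_measure prob_space.finite_measure prob_space_bp_measure)
  ultimately show ?thesis by simp
qed simp

lemma measurable_bp_measure:
  "(bp_measure :: 'a::metric_space borel_prob \<Rightarrow> _) \<in> borel \<rightarrow>\<^sub>M subprob_algebra borel"
proof (rule measurable_subprob_algebra_generated[where \<Omega> = UNIV and G = "Collect closed"])
  show "sets (borel :: 'a measure) = sigma_sets UNIV (Collect closed)"
    by (simp add: borel_eq_closed)
  show "(\<lambda>\<mu>. emeasure (bp_measure \<mu>) UNIV) \<in> borel_measurable (borel :: 'a borel_prob measure)"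
    by (rule measurable_emeasure_closed) simp
qed (auto simp: Int_stable_def measurable_emeasure_closed intro: prob_space_imp_subprob_space)

lemma bp_measure_societal_summary:
  fixes g :: "'i \<Rightarrow> 'a::metric_space borel_prob"
  assumes "prob_space M" "g \<in> borel_measurable M"
  shows "bp_measure (societal_summary M g) = bind M (\<lambda>i. bp_measure (g i))"
proof -
  interpret prob_space M by fact
  have k: "(\<lambda>i. bp_measure (g i)) \<in> M \<rightarrow>\<^sub>M subprob_algebra borel"
    using measurable_compose[OF assms(2) measurable_bp_measure] .
  show ?thesis
    unfolding societal_summary_def
  proof (rule Abs_borel_prob_inverse, intro CollectI conjI)
    show "sets (M \<bind> (\<lambda>i. bp_measure (g i))) = sets borel"
      by (rule sets_bind) (auto simp: not_empty)
    show "prob_space (M \<bind> (\<lambda>i. bp_measure (g i)))"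
      by (rule prob_space_bind[OF _ k]) simp
  qed
qed

lemma measure_societal_summary:
  fixes g :: "'i \<Rightarrow> 'a::metric_space borel_prob"
  assumes "prob_space M" "g \<in> borel_measurable M" "B \<in> sets borel"
  shows "measure (bp_measure (societal_summary M g)) B = (LINT i|M. measure (bp_measure (g i)) B)"
proof -
  interpret prob_space M by fact
  show ?thesis
    unfolding bp_measure_societal_summary[OF assms(1,2)]
    by (rule measure_bind[OF measurable_compose[OF assms(2) measurable_bp_measure] assms(3)])
qed

lemma measure_societal_summary_finite:
  fixes g :: "'i \<Rightarrow> 'a::metric_space borel_prob"
  assumes "finite_player_space n M" "B \<in> sets borel"
  shows "measure (bp_measure (societal_summary M g)) B =
    (\<Sum>i\<in>space M. measure M {i} * measure (bp_measure (g i)) B)"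
proof -
  have M: "prob_space M" "finite (space M)" "sets M = Pow (space M)"
    using assms(1) by (auto simp: finite_player_space_def)
  interpret prob_space M by fact
  have "g \<in> borel_measurable M"
    using M(3) by (auto simp: measurable_def)
  then have "measure (bp_measure (societal_summary M g)) B = (LINT i|M. measure (bp_measure (g i)) B)"
    by (rule measure_societal_summary[OF M(1) _ assms(2)])
  also have "\<dots> = (LINT i|M. (\<Sum>j\<in>space M. measure (bp_measure (g j)) B * indicator {j} i))"
    by (intro Bochner_Integration.integral_cong)
      (auto simp: indicator_def sum.delta' M(2) if_distrib cong: if_cong)
  also have "\<dots> = (\<Sum>j\<in>space M. measure (bp_measure (g j)) B * measure M {j})"
    by (subst Bochner_Integration.integral_sum) (auto simp: M(3) integrable_indicator_iff emeasure_eq_measure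
        intro!: sum.cong integrable_mult_right)
  finally show ?thesis by (simp add: mult.commute)
qed

end

theory Submission
  imports Defs
begin

text \<open>Only the integrals of \<open>[0,1]\<close>-valued regret functions \<open>w\<^sub>i \<in> C(A)\<close> against the strategies matter: the
  strategies of \<open>G\<^sup>n\<close> have asymptotically vanishing regret with respect to the limit summary \<open>\<tau>\<close> (in a
  finite-player game by Hoeffding's inequality), and a kernel with summary \<open>\<tau>\<close> and zero regret is an
  equilibrium. Tightness of the laws of the characteristics and disintegration over them are avoided. A finite
  partition of unity on \<open>C(A)\<close> transfers the profiles of \<open>G\<^sup>n\<close> to kernels on \<open>I\<close> that are approximately
  correct. The approximately correct kernels form decreasing convex sets, so near-minimizers of a
  strictly convex quadratic functional are Cauchy by the parallelogram law, and a subsequence converges weakly almost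
  everywhere. Its limit is the equilibrium.\<close>

section \<open>Integrals of bounded continuous functions\<close>

text \<open>Freezing the summary at \<tau> is what makes the problem linear: the regret functions
  then do not depend on the kernel sought, so prescribing its summary and its average regret imposes
  linear conditions. The player spaces of the games G^n bear no relation to \<open>I\<close>, and
  only distributions of characteristics can be compared. Strategies are therefore averaged over
  groups of players with similar regret functions and handed to the players of \<open>I\<close> in
  proportion to their membership in the groups. In C(A) finitely many groups cannot in general make
  similarity uniform; the interpolation error of a regret function measures the defect, and as a
  bounded continuous function on C(A) it has integrals controlled by weak convergence. In G^n itself
  the payoffs are evaluated at summaries other than \<tau>, random ones in the finite-player case.
  The resulting errors depend on a player only through the payoff function, with a Lipschitz
  constant common to all n, which upgrades their pointwise convergence to convergence of the
  integrals.\<close>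

definition bp_int :: "'a::topological_space borel_prob \<Rightarrow> ('a \<Rightarrow>\<^sub>C real) \<Rightarrow> real" where
  "bp_int \<nu> f = (LINT x|bp_measure \<nu>. apply_bcontfun f x)"

lemma borel_measurable_bcontfun [measurable]:
  fixes f :: "'a::topological_space \<Rightarrow>\<^sub>C real"
  shows "apply_bcontfun f \<in> borel_measurable borel"
  by (rule borel_measurable_continuous_onI) simp

lemma abs_bcontfun_le: "\<bar>apply_bcontfun f x\<bar> \<le> norm (f :: _ \<Rightarrow>\<^sub>C real)"
  using norm_bounded[of f x] by simp

lemma integrable_bcontfun [simp]:
  fixes f :: "'a::topological_space \<Rightarrow>\<^sub>C real"
  shows "integrable (bp_measure \<nu>) (apply_bcontfun f)"
proof -
  interpret prob_space "bp_measure \<nu>" by simp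
  show ?thesis
    by (rule integrable_const_bound[where B="norm f"]) (auto simp: abs_bcontfun_le)
qed

lemma bp_int_const [simp]: "bp_int \<nu> (const_bcontfun c) = c"
  using prob_space.prob_space[OF prob_space_bp_measure[of \<nu>]] by (simp add: bp_int_def)

lemma bp_int_add: "bp_int \<nu> (f + g) = bp_int \<nu> f + bp_int \<nu> g"
  by (simp add: bp_int_def)

lemma bp_int_diff: "bp_int \<nu> (f - g) = bp_int \<nu> f - bp_int \<nu> g"
  by (simp add: bp_int_def)

lemma bp_int_scaleR: "bp_int \<nu> (c *\<^sub>R f) = c * bp_int \<nu> f"
  by (simp add: bp_int_def)

lemma bp_int_0 [simp]: "bp_int \<nu> 0 = 0"
  by (simp add: bp_int_def)

lemma bp_int_sum: "bp_int \<nu> (\<Sum>k\<in>F. f k) = (\<Sum>k\<in>F. bp_int \<nu> (f k))"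
  by (induction F rule: infinite_finite_induct) (simp_all add: bp_int_add)

lemma bp_int_mono: "(\<And>x. apply_bcontfun f x \<le> apply_bcontfun g x) \<Longrightarrow> bp_int \<nu> f \<le> bp_int \<nu> g"
  unfolding bp_int_def by (rule integral_mono) auto

lemma bp_int_nonneg: "(\<And>x. 0 \<le> apply_bcontfun f x) \<Longrightarrow> 0 \<le> bp_int \<nu> f"
  unfolding bp_int_def by simp

lemma abs_bp_int_le: "\<bar>bp_int \<nu> f\<bar> \<le> norm f"
proof -
  have "bp_int \<nu> f \<le> bp_int \<nu> (const_bcontfun (norm f))"
    "bp_int \<nu> (const_bcontfun (- norm f)) \<le> bp_int \<nu> f"
    using abs_bcontfun_le[of f] by (auto intro!: bp_int_mono simp: abs_le_iff minus_le_iff simp del: bp_int_const)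
  then show ?thesis by simp
qed

lemma abs_bp_int_diff_le: "\<bar>bp_int \<nu> f - bp_int \<nu> g\<bar> \<le> norm (f - g)"
  using abs_bp_int_le[of \<nu> "f - g"] by (simp add: bp_int_diff)

lemma bp_int_dirac [simp]: "bp_int (dirac a) f = f a"
  by (simp add: bp_int_def integral_return)

lemma continuous_on_bp_int: "continuous_on S (\<lambda>\<nu>. bp_int \<nu> f)"
  unfolding bp_int_def using continuous_on_integral_borel_prob continuous_on_subset by blast

lemma measurable_bp_int [measurable]:
  "g \<in> borel_measurable M \<Longrightarrow> (\<lambda>i. bp_int (g i) f) \<in> borel_measurable M"
  by (rule measurable_compose[OF _ borel_measurable_continuous_onI[OF continuous_on_bp_int]])

lemma tendsto_borel_prob: "(X \<longlongrightarrow> \<nu>) F \<longleftrightarrow> (\<forall>f. ((\<lambda>n. bp_int (X n) f) \<longlongrightarrow> bp_int \<nu> f) F)"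
  unfolding bp_int_def by (rule tendsto_borel_prob_iff)

text \<open>Closed sets form an intersection-stable generator, and the indicator of a nonempty
  closed set is the pointwise limit of the bounded continuous functions \<open>h k\<close>.\<close>

lemma bp_eqI:
  fixes \<nu> \<rho> :: "'a::metric_space borel_prob"
  assumes eq: "\<And>f. bp_int \<nu> f = bp_int \<rho> f"
  shows "\<nu> = \<rho>"
proof -
  have closed_eq: "emeasure (bp_measure \<nu>) C = emeasure (bp_measure \<rho>) C" if C: "closed C" for C :: "'a set"
  \<comment> \<open>The empty set is separate because \<open>infdist x {}\<close> is 0, so that
    every \<open>h k\<close> would be constantly 1.\<close>
  proof (cases "C = {}")
    case False
    define h where "h k x = max 0 (1 - real k * infdist x C)" for k :: nat and x
    have h01: "0 \<le> h k x" "h k x \<le> 1" for k x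
      using infdist_nonneg[of x C] by (auto simp: h_def)
    have hc: "continuous_on UNIV (h k)" for k
      unfolding h_def by (intro continuous_intros)
    have hb: "h k \<in> bcontfun" for k
      using h01 by (intro bcontfun_normI[where b=1] hc) auto
    have lim: "(\<lambda>k. h k x) \<longlonglongrightarrow> indicator C x" for x
    proof (cases "x \<in> C")
      case True
      then show ?thesis by (simp add: h_def)
    next
      case notin: False
      then have "infdist x C > 0"
        using C False by (simp add: infdist_pos_not_in_closed)
      then obtain N where N: "1 < real N * infdist x C"
        using reals_Archimedean3 by blast
      have "h k x = 0" if "k \<ge> N" for k
        using mult_right_mono[of "real N" "real k" "infdist x C"] that N infdist_nonneg[of x C]
        by (simp add: h_def)
      then have "eventually (\<lambda>k. h k x = 0) sequentially"
        by (auto simp: eventually_sequentially)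
      then show ?thesis using notin by (simp add: tendsto_eventually)
    qed
    have [measurable]: "C \<in> sets borel" "\<And>k. h k \<in> borel_measurable borel"
      using C by (auto intro: borel_measurable_continuous_onI[OF hc])
    have conv: "(\<lambda>k. bp_int \<mu> (Bcontfun (h k))) \<longlonglongrightarrow> measure (bp_measure \<mu>) C" for \<mu>
    proof -
      interpret prob_space "bp_measure \<mu>" by simp
      have "(\<lambda>k. LINT x|bp_measure \<mu>. h k x) \<longlonglongrightarrow> (LINT x|bp_measure \<mu>. indicator C x)"
        by (rule integral_dominated_convergence[where w = "\<lambda>_. 1"]) (use h01 lim in auto)
      then show ?thesis by (simp add: bp_int_def Bcontfun_inverse[OF hb])
    qed
    have "measure (bp_measure \<nu>) C = measure (bp_measure \<rho>) C"
      using LIMSEQ_unique[OF conv[of \<nu>]] conv[of \<rho>] by (simp add: eq)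
    then show ?thesis
      by (simp add: finite_measure.emeasure_eq_measure prob_space.finite_measure)
  qed simp
  have "bp_measure \<nu> = bp_measure \<rho>"
  proof (rule measure_eqI_generator_eq[where E="Collect closed" and \<Omega>=UNIV and A="\<lambda>_. UNIV"])
    show "sets (bp_measure \<nu>) = sigma_sets UNIV (Collect closed)"
      "sets (bp_measure \<rho>) = sigma_sets UNIV (Collect closed)"
      by (simp_all add: borel_eq_closed)
    show "emeasure (bp_measure \<nu>) UNIV \<noteq> \<infinity>"
      using prob_space.emeasure_space_1[OF prob_space_bp_measure[of \<nu>]] by simp
  qed (auto simp: Int_stable_def closed_eq)
  then show ?thesis by (simp add: bp_measure_inject)
qed

lemma bp_int_societal_summary:
  assumes "prob_space M" and [measurable]: "g \<in> borel_measurable M"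
  shows "bp_int (societal_summary M g) f = (LINT i|M. bp_int (g i) f)"
  unfolding bp_int_def bp_measure_societal_summary[OF assms]
proof (rule integral_bind[where K=borel and B="norm f" and B'=1])
  show "(\<lambda>i. bp_measure (g i)) \<in> M \<rightarrow>\<^sub>M subprob_algebra borel"
    using measurable_compose[OF assms(2) measurable_bp_measure] .
  show "finite_measure M" by (rule prob_space.finite_measure) fact
  show "AE i in M. emeasure (bp_measure (g i)) (space (bp_measure (g i))) \<le> ennreal 1"
    by (intro AE_I2) (simp only: prob_space.emeasure_space_1[OF prob_space_bp_measure] ennreal_1)
qed (auto simp: abs_bcontfun_le)

lemma integrable_bp_int:
  assumes "finite_measure M" and [measurable]: "g \<in> borel_measurable M"
  shows "integrable M (\<lambda>i. bp_int (g i) f)"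
  by (rule finite_measure.integrable_const_bound[OF assms(1), where B="norm f"])
    (auto simp: abs_bp_int_le)

text \<open>The measure \<nu> is the average strategy when players are weighted by \<phi>, that is,
  the summary of \<open>g\<close> under the normalized density. Multiplying by the total weight
  instead of dividing covers total weight zero, where any \<nu> will do.\<close>

lemma ex_density_average:
  fixes g :: "'i \<Rightarrow> 'a::metric_space borel_prob"
  assumes "prob_space M" and [measurable]: "g \<in> borel_measurable M" "\<phi> \<in> borel_measurable M"
    and \<phi>: "\<And>i. 0 \<le> \<phi> i" "\<And>i. \<phi> i \<le> B"
  shows "\<exists>\<nu>. \<forall>f. (LINT i|M. \<phi> i) * bp_int \<nu> f = (LINT i|M. \<phi> i * bp_int (g i) f)"
proof (cases "(LINT i|M. \<phi> i) = 0")
  interpret prob_space M by fact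
  have int: "integrable M \<phi>"
    using \<phi> by (intro integrable_const_bound[where B=B]) auto
  {
    case True
    then have "AE i in M. \<phi> i = 0"
      using integral_nonneg_eq_0_iff_AE[OF int] \<phi>(1) by auto
    then have "(LINT i|M. \<phi> i * bp_int (g i) f) = 0" for f
      by (intro integral_eq_zero_AE) auto
    then show ?thesis using True by simp
  next
    case False
    define c where "c = (LINT i|M. \<phi> i)"
    have c: "c > 0"
      using False \<phi>(1) unfolding c_def by (simp add: order_less_le)
    define D where "D = density M (\<lambda>i. \<phi> i / c)"
    have "prob_space D"
    proof (rule prob_spaceI)
      have "emeasure D (space D) = (\<integral>\<^sup>+ i. ennreal (\<phi> i / c) \<partial>M)"
        by (auto simp: D_def emeasure_density intro!: nn_integral_cong)
      also have "\<dots> = ennreal (LINT i|M. \<phi> i / c)"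
        using c \<phi>(1) int by (intro nn_integral_eq_integral) auto
      also have "(LINT i|M. \<phi> i / c) = 1"
        using c by (simp add: c_def)
      finally show "emeasure D (space D) = 1" by simp
    qed
    have [measurable]: "g \<in> borel_measurable D" by (simp add: D_def)
    have "bp_int (societal_summary D g) f = (LINT i|M. (\<phi> i / c) * bp_int (g i) f)" for f
      unfolding bp_int_societal_summary[OF \<open>prob_space D\<close> \<open>g \<in> borel_measurable D\<close>]
      using c \<phi>(1) unfolding D_def by (subst integral_density) auto
    then have "c * bp_int (societal_summary D g) f = (LINT i|M. \<phi> i * bp_int (g i) f)" for f
      using c by simp
    then show ?thesis unfolding c_def by blast
  }
qed

text \<open>A finite mixture is the summary of a profile on the finite player space \<open>R\<close>
  with weights \<open>q\<close>.\<close>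

lemma ex_mixture:
  fixes \<nu> :: "'r \<Rightarrow> 'a::metric_space borel_prob"
  assumes fin: "finite R" and q: "\<And>r. r \<in> R \<Longrightarrow> 0 \<le> q r" "(\<Sum>r\<in>R. q r) = 1"
  shows "\<exists>\<rho>. \<forall>f. bp_int \<rho> f = (\<Sum>r\<in>R. q r * bp_int (\<nu> r) f)"
proof -
  let ?M = "point_measure R q"
  have "prob_space ?M"
    by (rule prob_space_point_measure) (use assms in auto)
  have m: "\<nu> \<in> borel_measurable ?M"
    by (auto simp: measurable_def sets_point_measure space_point_measure)
  have "bp_int (societal_summary ?M \<nu>) f = (\<Sum>r\<in>R. q r * bp_int (\<nu> r) f)" for f
    unfolding bp_int_societal_summary[OF \<open>prob_space ?M\<close> m]
    using assms by (subst lebesgue_integral_point_measure_finite) auto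
  then show ?thesis by blast
qed

section \<open>Partitions of unity on a compact metric space\<close>

lemma continuous_on_bcontfun_eval: "continuous_on S (\<lambda>f. apply_bcontfun f x)"
proof (rule continuous_on_subset[OF _ subset_UNIV])
  show "continuous_on UNIV (\<lambda>f. apply_bcontfun f x)"
    unfolding continuous_on_iff using dist_fun_lt_imp_dist_val_lt by blast
qed

definition net :: "nat \<Rightarrow> 'a::metric_space set" where
  "net m = (SOME F. finite F \<and> (\<Union>k\<in>F. ball k (1 / real (Suc m))) = UNIV)"

definition pu :: "nat \<Rightarrow> 'a::metric_space \<Rightarrow> 'a \<Rightarrow>\<^sub>C real" where
  "pu m k = Bcontfun (\<lambda>x. max 0 (1 / real (Suc m) - dist x k) /
     (\<Sum>l\<in>net m. max 0 (1 / real (Suc m) - dist x l)))"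

text \<open>Integrals of \<open>interp m f\<close> see a measure only through the finitely many
  numbers \<open>bp_int \<nu> (pu m k)\<close>. Questions of measurability and convergence thereby
  reduce to countably many test functions.\<close>

definition interp :: "nat \<Rightarrow> ('a::metric_space \<Rightarrow>\<^sub>C real) \<Rightarrow> 'a \<Rightarrow>\<^sub>C real" where
  "interp m f = (\<Sum>k\<in>net m. f k *\<^sub>R pu m k)"

lemma apply_bcontfun_sum: "apply_bcontfun (\<Sum>k\<in>F. f k) x = (\<Sum>k\<in>F. apply_bcontfun (f k) x)"
  for f :: "'b \<Rightarrow> 'a::topological_space \<Rightarrow>\<^sub>C real"
  by (induction F rule: infinite_finite_induct) simp_all

lemma interp_apply: "interp m f x = (\<Sum>k\<in>net m. f k * pu m k x)"
  by (simp add: interp_def apply_bcontfun_sum)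

lemma bp_int_interp: "bp_int \<nu> (interp m f) = (\<Sum>k\<in>net m. f k * bp_int \<nu> (pu m k))"
  by (simp add: interp_def bp_int_sum bp_int_scaleR)

lemma continuous_on_interp: "continuous_on S (interp m)"
  unfolding interp_def by (intro continuous_intros continuous_on_bcontfun_eval)

context
  assumes compact_UNIV: "compact (UNIV :: 'a::metric_space set)"
begin

lemma net: "finite (net m :: 'a set)" "(\<Union>k\<in>net m. ball (k::'a) (1 / real (Suc m))) = UNIV"
proof -
  obtain F where "F \<subseteq> (UNIV::'a set)" "finite F" "UNIV \<subseteq> (\<Union>k\<in>F. ball k (1 / real (Suc m)))"
    using compactE_image[OF compact_UNIV, of UNIV "\<lambda>k. ball k (1 / real (Suc m))"]
    by (metis UNIV_I UN_I centre_in_ball of_nat_0_less_iff open_ball subsetI zero_less_Suc zero_less_divide_1_iff)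
  then have "\<exists>F. finite F \<and> (\<Union>k\<in>F. ball (k::'a) (1 / real (Suc m))) = UNIV" by blast
  from someI_ex[OF this]
  show "finite (net m :: 'a set)" "(\<Union>k\<in>net m. ball (k::'a) (1 / real (Suc m))) = UNIV"
    unfolding net_def by auto
qed

lemma pu_denominator_pos: "0 < (\<Sum>l\<in>net m. max 0 (1 / real (Suc m) - dist (x::'a) l))"
proof -
  obtain k where "k \<in> net m" "dist k x < 1 / real (Suc m)"
    using net(2)[of m] by (metis UNIV_I UN_E mem_ball)
  then show ?thesis
    by (intro sum_pos2[OF net(1), of k]) (auto simp: dist_commute)
qed

lemma pu_apply:
  assumes "k \<in> net m"
  shows "pu m k (x::'a) = max 0 (1 / real (Suc m) - dist x k) /
     (\<Sum>l\<in>net m. max 0 (1 / real (Suc m) - dist x l))"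
proof -
  have quot: "norm (max 0 s / t) \<le> 1" if "max 0 s \<le> t" "0 < t" for s t :: real
    using that by (simp add: abs_of_nonneg)
  have "(\<lambda>x. max 0 (1 / real (Suc m) - dist x k) /
     (\<Sum>l\<in>net m. max 0 (1 / real (Suc m) - dist x l))) \<in> bcontfun"
  proof (rule bcontfun_normI[where b=1])
    show "continuous_on UNIV (\<lambda>x. max 0 (1 / real (Suc m) - dist x k) /
     (\<Sum>l\<in>net m. max 0 (1 / real (Suc m) - dist x l)))"
      by (intro continuous_intros ballI less_imp_neq[symmetric, OF pu_denominator_pos])
    fix x :: 'a
    have "max 0 (1 / real (Suc m) - dist x k) \<le> (\<Sum>l\<in>net m. max 0 (1 / real (Suc m) - dist x l))"
      using assms net(1) by (intro member_le_sum) auto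
    then show "norm (max 0 (1 / real (Suc m) - dist x k) /
     (\<Sum>l\<in>net m. max 0 (1 / real (Suc m) - dist x l))) \<le> 1"
      using pu_denominator_pos[of m x] quot by blast
  qed
  then show ?thesis unfolding pu_def by (simp add: Bcontfun_inverse)
qed

lemma pu_nonneg: "k \<in> net m \<Longrightarrow> 0 \<le> pu m k (x::'a)"
  using pu_denominator_pos[of m x] by (simp add: pu_apply)

lemma sum_pu: "(\<Sum>k\<in>net m. pu m k (x::'a)) = 1"
proof -
  have "(\<Sum>k\<in>net m. pu m k x) = (\<Sum>k\<in>net m. max 0 (1 / real (Suc m) - dist x k)) /
     (\<Sum>l\<in>net m. max 0 (1 / real (Suc m) - dist x l))"
    unfolding sum_divide_distrib by (intro sum.cong refl pu_apply)
  then show ?thesis using pu_denominator_pos[of m x] by simp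
qed

lemma pu_support: "k \<in> net m \<Longrightarrow> pu m k (x::'a) \<noteq> 0 \<Longrightarrow> dist x k < 1 / real (Suc m)"
  by (cases "dist x k < 1 / real (Suc m)") (auto simp: pu_apply)

text \<open>At each point the \<open>pu m k\<close> are convex weights, so only the coefficients of
  nearby net points count. This one estimate serves interpolation errors and grid errors
  alike.\<close>

lemma pu_combination_le:
  assumes "\<And>k. k \<in> net m \<Longrightarrow> pu m k (x::'a) \<noteq> 0 \<Longrightarrow> \<bar>c k\<bar> \<le> e"
  shows "\<bar>\<Sum>k\<in>net m. c k * pu m k x\<bar> \<le> e"
proof -
  have "\<bar>\<Sum>k\<in>net m. c k * pu m k x\<bar> \<le> (\<Sum>k\<in>net m. \<bar>c k\<bar> * pu m k x)"
    by (rule order_trans[OF sum_abs]) (auto simp: abs_mult pu_nonneg intro!: sum_mono)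
  also have "\<dots> \<le> (\<Sum>k\<in>net m. e * pu m k x)"
    by (intro sum_mono) (metis assms mult_right_mono mult_zero_right pu_nonneg order_refl)
  also have "\<dots> = e" by (simp add: sum_distrib_left[symmetric] sum_pu)
  finally show ?thesis .
qed

text \<open>Uniform continuity of \<open>f\<close> controls its variation between \<open>x\<close>
  and the net points within 1/(m+1) of \<open>x\<close>, the only ones with nonzero weight
  there.\<close>

lemma interp_tendsto: "(\<lambda>m. interp m f) \<longlonglongrightarrow> (f :: 'a \<Rightarrow>\<^sub>C real)"
proof (rule metric_LIMSEQ_I)
  fix e :: real assume "e > 0"
  have "uniformly_continuous_on UNIV (apply_bcontfun f)"
    by (rule compact_uniformly_continuous[OF _ compact_UNIV]) simp
  then obtain d where d: "d > 0" "\<And>x y. dist x y < d \<Longrightarrow> dist (f x) (f y) < e / 2"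
    unfolding uniformly_continuous_on_def using \<open>e > 0\<close> by (metis UNIV_I half_gt_zero)
  obtain N where N: "1 / real (Suc N) < d"
    using d(1) nat_approx_posE by blast
  have "dist (interp m f) f < e" if "m \<ge> N" for m
  proof -
    have "dist (interp m f x) (f x) \<le> e / 2" for x
    proof -
      have "1 / real (Suc m) \<le> 1 / real (Suc N)" using that by (simp add: frac_le)
      then have "\<bar>f k - f x\<bar> \<le> e / 2" if "k \<in> net m" "pu m k x \<noteq> 0" for k
        using d(2)[of k x] pu_support[OF that] N by (simp add: dist_commute dist_real_def)
      then have "\<bar>\<Sum>k\<in>net m. (f k - f x) * pu m k x\<bar> \<le> e / 2"
        by (rule pu_combination_le)
      also have "(\<Sum>k\<in>net m. (f k - f x) * pu m k x) = interp m f x - f x"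
        by (simp add: interp_apply left_diff_distrib sum_subtractf sum_distrib_left[symmetric] sum_pu)
      finally show ?thesis by (simp add: dist_real_def)
    qed
    then have "dist (interp m f) f \<le> e / 2" by (rule dist_bound)
    then show ?thesis using \<open>e > 0\<close> by simp
  qed
  then show "\<exists>N. \<forall>m\<ge>N. dist (interp m f) f < e" by blast
qed

lemma bp_int_interp_tendsto: "(\<lambda>m. bp_int \<nu> (interp m f)) \<longlonglongrightarrow> bp_int \<nu> (f :: 'a \<Rightarrow>\<^sub>C real)"
proof (rule LIM_zero_cancel, rule Lim_null_comparison)
  show "(\<lambda>m. norm (interp m f - f)) \<longlonglongrightarrow> 0"
    using interp_tendsto[of f] by (simp add: LIM_zero tendsto_norm_zero)
qed (simp add: abs_bp_int_diff_le)

text \<open>Integrals are 1-Lipschitz in the function, uniformly over all measures, so the Cauchy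
  property passes from \<open>interp m f\<close> to \<open>f\<close>.\<close>

lemma Cauchy_bp_intI:
  fixes X :: "nat \<Rightarrow> 'a borel_prob"
  assumes "\<And>m k. k \<in> net m \<Longrightarrow> Cauchy (\<lambda>n. bp_int (X n) (pu m k))"
  shows "Cauchy (\<lambda>n. bp_int (X n) f)"
proof (rule metric_CauchyI)
  fix e :: real assume "e > 0"
  then have "\<forall>\<^sub>F m in sequentially. dist (interp m f) f < e / 4"
    using tendstoD[OF interp_tendsto, of "e/4"] by simp
  then obtain m where m: "norm (interp m f - f) < e / 4"
    by (auto simp: eventually_sequentially dist_norm)
  have "convergent (\<lambda>n. \<Sum>k\<in>net m. f k * bp_int (X n) (pu m k))"
    by (intro convergent_sum convergent_mult convergent_const) (use assms Cauchy_convergent in blast)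
  then have "Cauchy (\<lambda>n. bp_int (X n) (interp m f))"
    unfolding bp_int_interp by (rule convergent_Cauchy)
  then obtain N where N: "\<And>i j. i \<ge> N \<Longrightarrow> j \<ge> N \<Longrightarrow>
      dist (bp_int (X i) (interp m f)) (bp_int (X j) (interp m f)) < e / 2"
    using \<open>e > 0\<close> metric_CauchyD[of _ "e/2"] by (metis half_gt_zero)
  have "dist (bp_int (X i) f) (bp_int (X j) f) < e" if "i \<ge> N" "j \<ge> N" for i j
    using N[OF that] abs_bp_int_diff_le[of "X i" "interp m f" f]
      abs_bp_int_diff_le[of "X j" "interp m f" f] m unfolding dist_real_def by linarith
  then show "\<exists>N. \<forall>i\<ge>N. \<forall>j\<ge>N. dist (bp_int (X i) f) (bp_int (X j) f) < e" by blast
qed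

text \<open>The functionals \<open>a n\<close> will be the averages of
  \<open>bp_int (g n i) f\<close> over the players \<open>i\<close>. Additivity, homogeneity and the
  norm bound suffice to replace \<open>f\<close> by \<open>interp m f\<close>.\<close>

lemma bp_int_tendstoI:
  fixes \<tau> :: "'a borel_prob"
  assumes pu: "\<And>m k. k \<in> net m \<Longrightarrow> (\<lambda>n. (a n (pu m k))) \<longlonglongrightarrow> bp_int \<tau> (pu m k)"
    and a: "\<And>n f g c. a n (f + g) = a n f + a n g" "\<And>n f c. a n (c *\<^sub>R f) = c * a n f"
      "\<And>n f. \<bar>a n f\<bar> \<le> norm (f :: 'a \<Rightarrow>\<^sub>C real)"
  shows "(\<lambda>n. a n f) \<longlonglongrightarrow> bp_int \<tau> f"
proof (rule metric_LIMSEQ_I)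
  fix e :: real assume "e > 0"
  then have "\<forall>\<^sub>F m in sequentially. dist (interp m f) f < e / 4"
    using tendstoD[OF interp_tendsto, of "e/4"] by simp
  then obtain m where m: "norm (interp m f - f) < e / 4"
    by (auto simp: eventually_sequentially dist_norm)
  have a0: "a n 0 = 0" for n using a(2)[of n 0 0] by simp
  have asum: "a n (\<Sum>k\<in>F. h k) = (\<Sum>k\<in>F. a n (h k))" for n F and h :: "'a \<Rightarrow> 'a \<Rightarrow>\<^sub>C real"
    by (induction F rule: infinite_finite_induct) (auto simp: a0 a(1))
  have "a n (interp m f) = (\<Sum>k\<in>net m. f k * a n (pu m k))" for n
    unfolding interp_def by (simp add: asum a(2))
  then have "(\<lambda>n. a n (interp m f)) \<longlonglongrightarrow> bp_int \<tau> (interp m f)"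
    unfolding bp_int_interp by (simp, intro tendsto_intros pu)
  then obtain N where N: "\<And>n. n \<ge> N \<Longrightarrow> dist (a n (interp m f)) (bp_int \<tau> (interp m f)) < e / 2"
    using \<open>e > 0\<close> metric_LIMSEQ_D[of _ _ "e/2"] by (metis half_gt_zero)
  have "dist (a n f) (bp_int \<tau> f) < e" if "n \<ge> N" for n
  proof -
    have "a n (interp m f) = a n (interp m f - f) + a n f" using a(1)[of n "interp m f - f" f] by simp
    then show ?thesis
      using N[OF that] a(3)[of n "interp m f - f"] abs_bp_int_diff_le[of \<tau> "interp m f" f] m
      unfolding dist_real_def by linarith
  qed
  then show "\<exists>N. \<forall>n\<ge>N. dist (a n f) (bp_int \<tau> f) < e" by blast
qed

section \<open>Measurability of maps into the space of probability measures\<close>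

text \<open>The weak topology has a countable base: finite intersections of the sets
  \<open>sub m k p q\<close> with rational \<open>p\<close>, \<open>q\<close>. Every open set is
  thus a countable union of sets described by finitely many integrals.\<close>

lemma measurable_borel_probI:
  fixes g :: "'i \<Rightarrow> 'a borel_prob"
  assumes g: "\<And>f. (\<lambda>i. bp_int (g i) f) \<in> borel_measurable M"
  shows "g \<in> borel_measurable M"
proof (rule borel_measurableI)
  define sub :: "nat \<Rightarrow> 'a \<Rightarrow> real \<Rightarrow> real \<Rightarrow> 'a borel_prob set"
    where "sub m k p q = {\<nu>. p < bp_int \<nu> (pu m k) \<and> bp_int \<nu> (pu m k) < q}" for m k p q
  define \<S> where "\<S> = (\<Union>m. \<Union>k\<in>net m. \<Union>p\<in>\<rat>. \<Union>q\<in>\<rat>. {sub m k p q})"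
  define \<B> where "\<B> = Inter ` {T. finite T \<and> T \<subseteq> \<S>}"
  have "countable \<S>"
    unfolding \<S>_def using net(1) by (intro countable_UN countable_rat) (auto intro: countable_finite)
  then have cB: "countable \<B>"
    unfolding \<B>_def by (intro countable_image countable_Collect_finite_subset)
  have mB: "g -` B \<inter> space M \<in> sets M" if "B \<in> \<B>" for B
  proof -
    have "g -` S \<inter> space M \<in> sets M" if S: "S \<in> \<S>" for S
    proof -
      obtain m k p q where S: "S = sub m k p q" using S unfolding \<S>_def by blast
      note g[of "pu m k", measurable]
      have "g -` S \<inter> space M = {i\<in>space M. p < bp_int (g i) (pu m k) \<and> bp_int (g i) (pu m k) < q}"
        by (auto simp: S sub_def)
      also have "\<dots> \<in> sets M" by measurable
      finally show ?thesis .
    qed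
    then have INT: "(\<Inter>S\<in>T. g -` S \<inter> space M) \<in> sets M" if "finite T" "T \<subseteq> \<S>" "T \<noteq> {}" for T
      using that by (intro sets.finite_INT) auto
    obtain T where T: "finite T" "T \<subseteq> \<S>" "B = \<Inter>T" using \<open>B \<in> \<B>\<close> by (auto simp: \<B>_def)
    show ?thesis
    proof (cases "T = {}")
      case False
      then have "g -` B \<inter> space M = (\<Inter>S\<in>T. g -` S \<inter> space M)" using T(3) by auto
      then show ?thesis using INT[OF T(1,2) False] by simp
    qed (simp add: T(3))
  qed
  have basis: "\<forall>\<nu>\<in>S. \<exists>B\<in>\<B>. \<nu> \<in> B \<and> B \<subseteq> S"
    if "generate_topology {{\<mu>. (LINT x|bp_measure \<mu>. apply_bcontfun f x) \<in> U} |
      (f :: 'a \<Rightarrow>\<^sub>C real) U. open U} S" for S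
    using that
  proof induction
    case UNIV
    have "UNIV \<in> \<B>" unfolding \<B>_def by (auto intro!: image_eqI[of _ _ "{}"])
    then show ?case by blast
  next
    case (Int a b)
    have inter: "A \<inter> B \<in> \<B>" if AB: "A \<in> \<B>" "B \<in> \<B>" for A B
    proof -
      obtain S T where "finite S" "S \<subseteq> \<S>" "A = \<Inter>S" "finite T" "T \<subseteq> \<S>" "B = \<Inter>T"
        using AB unfolding \<B>_def by blast
      then show ?thesis unfolding \<B>_def by (auto intro!: image_eqI[of _ _ "S \<union> T"])
    qed
    with Int show ?case by (meson Int_iff le_inf_iff order_trans inf_le1 inf_le2 Int_mono)
  next
    case (UN K)
    then show ?case by (meson Union_iff Union_upper order_trans)
  next
    case (Basis s)
    then obtain f :: "'a \<Rightarrow>\<^sub>C real" and U where s: "s = {\<mu>. bp_int \<mu> f \<in> U}" and U: "open U"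
      unfolding bp_int_def by auto
    show ?case
    proof
      fix \<nu> assume "\<nu> \<in> s"
      then obtain e where e: "e > 0" "ball (bp_int \<nu> f) e \<subseteq> U"
        using U s openE by blast
      then have "\<forall>\<^sub>F m in sequentially. dist (interp m f) f < e / 4"
        using tendstoD[OF interp_tendsto, of "e/4"] by simp
      then obtain m where m: "norm (interp m f - f) < e / 4"
        by (auto simp: eventually_sequentially dist_norm)
      \<comment> \<open>The sum bounds the effect on \<open>interp m f\<close> of errors in the
        integrals of the \<open>pu m k\<close>; adding 1 keeps \<open>C\<close> positive. Errors of
        at most \<open>h\<close> cost at most e/8, and replacing \<open>f\<close> by
        \<open>interp m f\<close> under both measures costs less than e/2.\<close>
      define C where "C = (\<Sum>k\<in>net m. \<bar>f k\<bar>) + 1"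
      have C: "C > 0" unfolding C_def by (simp add: add_nonneg_pos sum_nonneg)
      define h where "h = e / (8 * C)"
      have h: "h > 0" using e C by (simp add: h_def)
      have "\<exists>p q. p \<in> \<rat> \<and> q \<in> \<rat> \<and> t - h < p \<and> p < t \<and> t < q \<and> q < t + h" for t
      proof -
        obtain p where "p \<in> \<rat>" "t - h < p" "p < t" using Rats_dense_in_real[of "t - h" t] h by auto
        moreover obtain q where "q \<in> \<rat>" "t < q" "q < t + h" using Rats_dense_in_real[of t "t + h"] h by auto
        ultimately show ?thesis by blast
      qed
      then obtain p q where pq: "p t \<in> \<rat>" "q t \<in> \<rat>" "t - h < p t" "p t < t" "t < q t" "q t < t + h" for t
        by metis
      define a where "a k = bp_int \<nu> (pu m k)" for k
      define T where "T = (\<lambda>k. sub m k (p (a k)) (q (a k))) ` net m"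
      have "sub m k (p (a k)) (q (a k)) \<in> \<S>" if "k \<in> net m" for k
        unfolding \<S>_def
        by (rule UN_I[of m, OF UNIV_I], rule UN_I[OF that], rule UN_I[OF pq(1)], rule UN_I[OF pq(2)], rule singletonI)
      then have "finite T" "T \<subseteq> \<S>"
        unfolding T_def using net(1)[of m] by auto
      then have "\<Inter>T \<in> \<B>" unfolding \<B>_def by blast
      moreover have "\<nu> \<in> \<Inter>T" using pq by (auto simp: T_def sub_def a_def)
      moreover have "\<Inter>T \<subseteq> s"
      proof
        fix \<rho> assume \<rho>: "\<rho> \<in> \<Inter>T"
        have k: "\<bar>bp_int \<rho> (pu m k) - a k\<bar> \<le> h" if "k \<in> net m" for k
        proof -
          have "p (a k) < bp_int \<rho> (pu m k)" "bp_int \<rho> (pu m k) < q (a k)"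
            using \<rho> that by (auto simp: T_def sub_def)
          then show ?thesis using pq(3,6)[of "a k"] by linarith
        qed
        have "\<bar>bp_int \<rho> (interp m f) - bp_int \<nu> (interp m f)\<bar> = \<bar>\<Sum>k\<in>net m. f k * (bp_int \<rho> (pu m k) - a k)\<bar>"
          by (simp add: bp_int_interp a_def sum_subtractf right_diff_distrib)
        also have "\<dots> \<le> (\<Sum>k\<in>net m. \<bar>f k\<bar> * h)"
          by (rule order_trans[OF sum_abs]) (auto simp: abs_mult k intro!: sum_mono mult_left_mono)
        also have "\<dots> \<le> C * h"
          using h by (simp add: C_def sum_distrib_right[symmetric])
        also have "\<dots> = e / 8" using C by (simp add: h_def)
        finally have "\<bar>bp_int \<rho> f - bp_int \<nu> f\<bar> < e"
          using m abs_bp_int_diff_le[of \<rho> "interp m f" f] abs_bp_int_diff_le[of \<nu> "interp m f" f] e(1)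
          by linarith
        then have "bp_int \<rho> f \<in> ball (bp_int \<nu> f) e" by (simp add: dist_real_def)
        then show "\<rho> \<in> s" using e s by auto
      qed
      ultimately show "\<exists>B\<in>\<B>. \<nu> \<in> B \<and> B \<subseteq> s" by blast
    qed
  qed
  fix S :: "'a borel_prob set" assume "open S"
  then have "S = \<Union>{B\<in>\<B>. B \<subseteq> S}"
    using basis unfolding open_borel_prob_def by blast
  then have "g -` S \<inter> space M = (\<Union>B\<in>{B\<in>\<B>. B \<subseteq> S}. g -` B \<inter> space M)" by blast
  also have "\<dots> \<in> sets M"
    by (intro sets.countable_UN' countable_subset[OF _ cB]) (auto simp: mB)
  finally show "g -` S \<inter> space M \<in> sets M" .
qed

text \<open>Measure and integrand both vary with \<open>i\<close>. Interpolating the integrand turns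
  the integral into a finite sum of products of measurable functions.\<close>

lemma measurable_bp_int_param:
  fixes g :: "'i \<Rightarrow> 'a borel_prob"
  assumes [measurable]: "g \<in> borel_measurable M" "\<And>k. (\<lambda>i. apply_bcontfun (w i) k) \<in> borel_measurable M"
  shows "(\<lambda>i. bp_int (g i) (w i)) \<in> borel_measurable M"
proof (rule borel_measurable_LIMSEQ_real)
  show "(\<lambda>m. bp_int (g i) (interp m (w i))) \<longlonglongrightarrow> bp_int (g i) (w i)" for i
    by (rule bp_int_interp_tendsto)
  show "(\<lambda>i. bp_int (g i) (interp m (w i))) \<in> borel_measurable M" for m
    unfolding bp_int_interp by measurable
qed

end

section \<open>Sequential compactness\<close>

text \<open>The points of \<open>A\<close> are coded by ternary expansions without the digit 1, so that nearby codes
  have equal initial digits.\<close>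

lemma ternary_digits_eq:
  fixes d e :: "nat \<Rightarrow> real"
  assumes d: "\<And>k. d k \<in> {0, 2}" and e: "\<And>k. e k \<in> {0, 2}"
    and close: "\<bar>(\<Sum>k. d k / 3 ^ Suc k) - (\<Sum>k. e k / 3 ^ Suc k)\<bar> < 1 / 3 ^ N" and "k < N"
  shows "d k = e k"
proof (rule ccontr)
  assume "d k \<noteq> e k"
  \<comment> \<open>At the first index \<open>l\<close> where the digits differ the terms differ by
    2/3^(l+1), while all later terms together amount to at most 1/3^(l+1). The sums are therefore at
    least 1/3^(l+1) apart, which is at least 1/3^N.\<close>
  define l where "l = (LEAST k. d k \<noteq> e k)"
  have l: "d l \<noteq> e l"
    using LeastI[of "\<lambda>k. d k \<noteq> e k" k] \<open>d k \<noteq> e k\<close> unfolding l_def by blast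
  have less: "d j = e j" if "j < l" for j
    using not_less_Least[of j "\<lambda>k. d k \<noteq> e k"] that unfolding l_def by blast
  have "l < N" using Least_le[of "\<lambda>k. d k \<noteq> e k" k] \<open>d k \<noteq> e k\<close> \<open>k < N\<close> unfolding l_def by linarith
  have geo: "(\<lambda>k. 2 / 3 ^ Suc (k + j)) sums (1 / 3 ^ j :: real)" for j
  proof -
    have "(\<lambda>k. 2 / 3 ^ Suc j * (1 / 3) ^ k) sums (2 / 3 ^ Suc j * (1 / (1 - 1 / 3)) :: real)"
      by (intro sums_mult geometric_sums) simp
    then show ?thesis by (simp add: power_add power_divide field_simps)
  qed
  have sm: "summable (\<lambda>k. c k / 3 ^ Suc k)" if "\<And>k. c k \<in> {0, 2 :: real}" for c
  proof (rule summable_comparison_test'[OF sums_summable[OF geo[of 0]]])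
    show "norm (c n / 3 ^ Suc n) \<le> 2 / 3 ^ Suc (n + 0)" for n
      using that[of n] by auto
  qed
  define c where "c k = d k / 3 ^ Suc k - e k / 3 ^ Suc k" for k
  have c: "summable c" unfolding c_def by (intro summable_diff sm d e)
  have abs_c: "\<bar>c k\<bar> \<le> 2 / 3 ^ Suc k" for k
    using d[of k] e[of k] by (auto simp: c_def)
  have abs_cl: "\<bar>c l\<bar> = 2 * (1 / 3 ^ Suc l)"
    using d[of l] e[of l] l(1) by (auto simp: c_def)
  have "suminf c = (\<Sum>k. d k / 3 ^ Suc k) - (\<Sum>k. e k / 3 ^ Suc k)"
    unfolding c_def by (rule suminf_diff[symmetric]) (intro sm d e)+
  moreover have "suminf c = (\<Sum>k. c (k + Suc l)) + (\<Sum>k<Suc l. c k)"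
    by (rule suminf_split_initial_segment[OF c])
  moreover have "(\<Sum>k<Suc l. c k) = c l"
    using less by (simp add: c_def)
  moreover have "\<bar>\<Sum>k. c (k + Suc l)\<bar> \<le> 1 / 3 ^ Suc l"
  proof -
    have "summable (\<lambda>k. \<bar>c (k + Suc l)\<bar>)"
    proof (rule summable_comparison_test'[OF sums_summable[OF geo[of "Suc l"]]])
      show "norm \<bar>c (k + Suc l)\<bar> \<le> 2 / 3 ^ Suc (k + Suc l)" for k
        using abs_c[of "k + Suc l"] by (simp only: real_norm_def abs_idempotent)
    qed
    then have "\<bar>\<Sum>k. c (k + Suc l)\<bar> \<le> (\<Sum>k. \<bar>c (k + Suc l)\<bar>)" by (rule summable_rabs)
    also have "\<dots> \<le> (\<Sum>k. 2 / 3 ^ Suc (k + Suc l))"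
      by (rule suminf_le[OF abs_c \<open>summable (\<lambda>k. \<bar>c (k + Suc l)\<bar>)\<close> sums_summable[OF geo[of "Suc l"]]])
    also have "\<dots> = 1 / 3 ^ Suc l" using geo[of "Suc l"] by (rule sums_unique[symmetric])
    finally show ?thesis .
  qed
  ultimately have "1 / 3 ^ Suc l \<le> \<bar>(\<Sum>k. d k / 3 ^ Suc k) - (\<Sum>k. e k / 3 ^ Suc k)\<bar>"
    using abs_cl by linarith
  moreover have "(1::real) / 3 ^ N \<le> 1 / 3 ^ Suc l"
    using \<open>l < N\<close> by (intro divide_left_mono power_increasing) auto
  ultimately show False using close by linarith
qed

context
  assumes compact_UNIV: "compact (UNIV :: 'a::metric_space set)"
begin

text \<open>Digit \<open>k\<close> records membership in the k-th ball of the nets. The code need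
  not be continuous, only Borel, but the map back from codes to points is uniformly
  continuous.\<close>

lemma ex_borel_code:
  obtains code :: "'a \<Rightarrow> real" where "code \<in> borel_measurable borel"
    "\<And>x. 0 \<le> code x" "\<And>x. code x \<le> 1"
    "\<And>e. 0 < e \<Longrightarrow> \<exists>d>0. \<forall>x y. \<bar>code x - code y\<bar> < d \<longrightarrow> dist x y < e"
proof
  define \<C> where "\<C> = (\<Union>m. (\<lambda>k::'a. ball k (1 / real (Suc m))) ` net m)"
  have "countable \<C>"
    unfolding \<C>_def using net(1)[OF compact_UNIV] by (intro countable_UN countable_image) (auto intro: countable_finite)
  moreover have "\<C> \<noteq> {}"
    using net(2)[OF compact_UNIV, of 0] unfolding \<C>_def by blast
  ultimately have range: "range (from_nat_into \<C>) = \<C>"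
    by (simp add: range_from_nat_into)
  define digit :: "'a \<Rightarrow> nat \<Rightarrow> real" where "digit x k = 2 * indicator (from_nat_into \<C> k) x" for x k
  define code where "code x = (\<Sum>k. digit x k / 3 ^ Suc k)" for x
  have digit: "digit x k \<in> {0, 2}" for x k by (auto simp: digit_def indicator_def)
  have geo: "(\<lambda>k. 2 / 3 ^ Suc k) sums (1 :: real)"
  proof -
    have "(\<lambda>k. 2 / 3 * (1 / 3) ^ k) sums (2 / 3 * (1 / (1 - 1 / 3)) :: real)"
      by (intro sums_mult geometric_sums) simp
    then show ?thesis by (simp add: power_divide field_simps)
  qed
  have le: "0 \<le> digit x k / 3 ^ Suc k" "digit x k / 3 ^ Suc k \<le> 2 / 3 ^ Suc k" for x k
    using digit[of x k] by auto
  have sm: "summable (\<lambda>k. digit x k / 3 ^ Suc k)" for x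
  proof (rule summable_comparison_test'[OF sums_summable[OF geo]])
    show "norm (digit x k / 3 ^ Suc k) \<le> 2 / 3 ^ Suc k" for k
      using le by (simp only: real_norm_def abs_of_nonneg)
  qed
  show "0 \<le> code x" for x
    unfolding code_def by (rule suminf_nonneg[OF sm le(1)])
  show "code x \<le> 1" for x
    unfolding code_def sums_unique[OF geo] by (rule suminf_le[OF le(2) sm sums_summable[OF geo]])
  have [measurable]: "from_nat_into \<C> k \<in> sets borel" for k
  proof -
    have "from_nat_into \<C> k \<in> \<C>" using range by blast
    then show ?thesis by (auto simp: \<C>_def)
  qed
  have dm: "(\<lambda>x. digit x k / 3 ^ Suc k) \<in> borel_measurable borel" for k
    unfolding digit_def by measurable
  show "code \<in> borel_measurable borel"
    unfolding code_def by (rule borel_measurable_suminf[OF dm])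
  fix e :: real assume "e > 0"
  then obtain m where m: "1 / real (Suc m) < e / 2" using nat_approx_posE[of "e/2"] by auto
  have "\<exists>j. from_nat_into \<C> j = ball k (1 / real (Suc m))" if "k \<in> net m" for k :: 'a
  proof -
    have "ball k (1 / real (Suc m)) \<in> \<C>" unfolding \<C>_def using that by blast
    then have "ball k (1 / real (Suc m)) \<in> range (from_nat_into \<C>)" by (simp only: range)
    then show ?thesis by (metis rangeE)
  qed
  then obtain j where j: "\<And>k::'a. k \<in> net m \<Longrightarrow> from_nat_into \<C> (j k) = ball k (1 / real (Suc m))"
    by metis
  \<comment> \<open>\<open>N\<close> exceeds the positions of all balls of \<open>net m\<close>.
    These cover the space, so two points with codes closer than 1/3^N lie in a common ball of radius
    below e/2.\<close>
  obtain N where N: "\<And>k::'a. k \<in> net m \<Longrightarrow> j k < N"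
    using finite_nat_bounded[OF finite_imageI[OF net(1)[OF compact_UNIV, of m], of j]] by (auto simp: image_subset_iff)
  have "dist x y < e" if "\<bar>code x - code y\<bar> < 1 / 3 ^ N" for x y
  proof -
    obtain k where k: "k \<in> net m" "x \<in> ball k (1 / real (Suc m))"
      using net(2)[OF compact_UNIV, of m] by (metis UNIV_I UN_E)
    have "digit x (j k) = digit y (j k)"
      using ternary_digits_eq[of "digit x" "digit y" N "j k"] digit that N[OF k(1)] unfolding code_def by blast
    then have "y \<in> ball k (1 / real (Suc m))"
      using k j[OF k(1)] by (auto simp: digit_def indicator_def split: if_splits)
    then show ?thesis using k(2) m dist_triangle2[of x y k] by (auto simp: dist_commute)
  qed
  then show "\<exists>d>0. \<forall>x y. \<bar>code x - code y\<bar> < d \<longrightarrow> dist x y < e"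
    by (intro exI[of _ "1 / 3 ^ N"]) auto
qed

text \<open>The code transports the measures to the unit interval, where a weakly convergent
  subsequence is available by tightness. The limit law is carried by the closure \<open>S\<close> of
  the codes and is brought back by the continuous extension \<open>c\<close> of the inverse code to
  \<open>S\<close>.\<close>

lemma seq_compact_borel_prob:
  fixes X :: "nat \<Rightarrow> 'a borel_prob"
  obtains r \<nu> where "strict_mono (r :: nat \<Rightarrow> nat)" "\<And>f. (\<lambda>n. bp_int (X (r n)) f) \<longlonglongrightarrow> bp_int \<nu> f"
proof -
  obtain code :: "'a \<Rightarrow> real" where [measurable]: "code \<in> borel_measurable borel"
    and code01: "\<And>x. 0 \<le> code x" "\<And>x. code x \<le> 1"
    and inv: "\<And>e. 0 < e \<Longrightarrow> \<exists>d>0. \<forall>x y. \<bar>code x - code y\<bar> < d \<longrightarrow> dist x y < e"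
    by (rule ex_borel_code) blast
  define S where "S = closure (range code)"
  have [measurable]: "S \<in> sets borel" by (simp add: S_def)
  have closed: "closed S" and "S \<noteq> {}" and in_S: "code x \<in> S" for x
    using closure_subset[of "range code"] by (auto simp: S_def)
  \<comment> \<open>The point \<open>a\<close> is a limit, along a subsequence, of points whose
    codes tend to \<open>t\<close>. Uniform continuity of the inverse code then forces all points
    with codes near \<open>t\<close> to be near \<open>a\<close>.\<close>
  have "\<exists>a. \<forall>e>0. \<exists>d>0. \<forall>x. \<bar>code x - t\<bar> < d \<longrightarrow> dist x a < e" if t: "t \<in> S" for t
  proof -
    obtain b where b: "\<And>n. b n \<in> range code" "b \<longlonglongrightarrow> t"
      using t unfolding S_def closure_sequential by blast
    have "\<forall>n. \<exists>y. b n = code y" using b(1) by auto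
    then obtain x where x: "\<And>n. b n = code (x n)" by (auto dest: choice)
    obtain a s where s: "strict_mono (s :: nat \<Rightarrow> nat)" "(x \<circ> s) \<longlonglongrightarrow> a"
      using compact_UNIV unfolding compact_def by (metis UNIV_I)
    have "\<exists>d>0. \<forall>y. \<bar>code y - t\<bar> < d \<longrightarrow> dist y a < e" if "e > 0" for e
    proof -
      obtain d where d: "d > 0" "\<And>x y. \<bar>code x - code y\<bar> < d \<Longrightarrow> dist x y < e / 2"
        using inv[of "e / 2"] \<open>e > 0\<close> by auto
      have "dist y a < e" if "\<bar>code y - t\<bar> < d / 2" for y
      proof -
        have "(b \<circ> s) \<longlonglongrightarrow> t" using b(2) s(1) LIMSEQ_subseq_LIMSEQ by blast
        from tendstoD[OF this, of "d / 2"] have "\<forall>\<^sub>F n in sequentially. dist ((b \<circ> s) n) t < d / 2"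
          using d(1) by simp
        moreover have "\<forall>\<^sub>F n in sequentially. dist ((x \<circ> s) n) a < e / 2"
          by (rule tendstoD[OF s(2)]) (use \<open>e > 0\<close> in simp)
        ultimately have "\<forall>\<^sub>F n in sequentially. dist ((b \<circ> s) n) t < d / 2 \<and> dist ((x \<circ> s) n) a < e / 2"
          by eventually_elim simp
        then obtain n where n: "dist (b (s n)) t < d / 2" "dist (x (s n)) a < e / 2"
          by (auto simp: eventually_sequentially)
        then have "\<bar>code y - code (x (s n))\<bar> < d"
          using that x[of "s n"] unfolding dist_real_def by linarith
        then have "dist y (x (s n)) < e / 2" by (rule d(2))
        then show ?thesis using n(2) dist_triangle[of y a "x (s n)"] by linarith
      qed
      then show ?thesis using d(1) by (intro exI[of _ "d / 2"]) auto
    qed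
    then show ?thesis by blast
  qed
  then obtain c where c: "\<And>t e. t \<in> S \<Longrightarrow> e > 0 \<Longrightarrow> \<exists>d>0. \<forall>x. \<bar>code x - t\<bar> < d \<longrightarrow> dist x (c t) < e"
    by metis
  have c_code: "c (code x) = x" for x
  proof (rule ccontr)
    assume "c (code x) \<noteq> x"
    then obtain d where "d > 0" "\<And>y. \<bar>code y - code x\<bar> < d \<Longrightarrow> dist y (c (code x)) < dist x (c (code x))"
      using c[OF in_S[of x], of "dist x (c (code x))"] by (metis zero_less_dist_iff)
    from this(2)[of x] \<open>d > 0\<close> show False by simp
  qed
  have cont_c: "continuous_on S c"
    unfolding continuous_on_iff
  proof safe
    fix t e :: real assume t: "t \<in> S" and "e > 0"
    obtain d where d: "d > 0" "\<And>x. \<bar>code x - t\<bar> < d \<Longrightarrow> dist x (c t) < e / 2"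
      using c[OF t, of "e / 2"] \<open>e > 0\<close> by auto
    have "dist (c t') (c t) < e" if t': "t' \<in> S" "dist t' t < d / 2" for t'
    proof -
      obtain d' where d': "d' > 0" "\<And>x. \<bar>code x - t'\<bar> < d' \<Longrightarrow> dist x (c t') < e / 2"
        using c[OF t'(1), of "e / 2"] \<open>e > 0\<close> by auto
      obtain y where y: "y \<in> range code" "dist y t' < min d' (d / 2)"
        using t'(1) d'(1) d(1) unfolding S_def closure_approachable by (metis half_gt_zero min_less_iff_conj)
      then obtain x where x: "y = code x" by blast
      have "dist x (c t') < e / 2" using d'(2)[of x] y(2) x by (simp add: dist_real_def)
      moreover have "dist x (c t) < e / 2"
        using d(2)[of x] y(2) x t'(2) unfolding dist_real_def by linarith
      ultimately show ?thesis using dist_triangle3[of "c t'" "c t" x] by linarith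
    qed
    then show "\<exists>d>0. \<forall>t'\<in>S. dist t' t < d \<longrightarrow> dist (c t') (c t) < e"
      using d(1) by (intro exI[of _ "d / 2"]) auto
  qed
  \<comment> \<open>Only the values of \<open>c\<close> on \<open>S\<close> are controlled; making
    it constant off the closed set \<open>S\<close> gives a Borel map on the whole line.\<close>
  define c' where "c' t = (if t \<in> S then c t else undefined)" for t
  have [measurable]: "c' \<in> borel_measurable borel"
    unfolding c'_def by (intro borel_measurable_continuous_on_if cont_c) auto
  define \<rho> where "\<rho> n = distr (bp_measure (X n)) borel code" for n
  have prob_\<rho>: "prob_space (\<rho> n)" for n
    unfolding \<rho>_def by (rule prob_space.prob_space_distr) auto
  have real_\<rho>: "real_distribution (\<rho> n)" for n
    using prob_\<rho>[of n] by (simp add: real_distribution_def real_distribution_axioms_def \<rho>_def)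
  have "tight \<rho>"
    unfolding tight_def
  proof (safe intro!: real_\<rho>)
    fix e :: real assume "e > 0"
    \<comment> \<open>Tightness is phrased with intervals open on the left; the endpoint -1 keeps
      the code value 0 inside.\<close>
    have "measure (\<rho> n) {-1<..1} = 1" for n
    proof -
      have neg: "-1 < code x" for x using code01(1)[of x] by linarith
      have "measure (\<rho> n) {-1<..1} = measure (bp_measure (X n)) (code -` {-1<..1} \<inter> UNIV)"
        unfolding \<rho>_def by (subst measure_distr) auto
      also have "code -` {-1<..1} \<inter> UNIV = UNIV"
        using code01(2) neg by auto
      finally show ?thesis using prob_space.prob_space[OF prob_space_bp_measure[of "X n"]] by simp
    qed
    then show "\<exists>a b. a < b \<and> (\<forall>n. 1 - e < measure (\<rho> n) {a<..b})"
      using \<open>e > 0\<close> by (intro exI[of _ "-1"] exI[of _ 1]) auto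
  qed
  then obtain r R where r: "strict_mono r" and R: "real_distribution R" and wc: "weak_conv_m (\<rho> \<circ> id \<circ> r) R"
    using tight_imp_convergent_subsubsequence[of \<rho> id] by (auto simp: strict_mono_def)
  interpret R: real_distribution R by fact
  have conv: "(\<lambda>n. LINT x|bp_measure (X (r n)). h (code x)) \<longlonglongrightarrow> (LINT t|R. h t)"
    if h: "continuous_on UNIV h" "\<And>t. norm (h t) \<le> B" for h :: "real \<Rightarrow> real" and B
  proof -
    have [measurable]: "h \<in> borel_measurable borel" by (rule borel_measurable_continuous_onI[OF h(1)])
    have "(\<lambda>n. LINT t|(\<rho> \<circ> id \<circ> r) n. h t) \<longlonglongrightarrow> (LINT t|R. h t)"
      using h by (intro weak_conv_imp_integral_bdd_continuous_conv[OF _ R wc, of h B] )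
        (auto simp: real_\<rho> continuous_on_eq_continuous_at)
    then show ?thesis by (simp add: \<rho>_def integral_distr)
  qed
  have AE_S: "AE t in R. t \<in> S"
  proof -
    \<comment> \<open>This bounded continuous function vanishes exactly on the closed set
      \<open>S\<close>. Its integrals under the transported measures are all 0, and so is the
      integral under the limit law.\<close>
    define h where "h t = min 1 (infdist t S)" for t
    have h: "continuous_on UNIV h" "norm (h t) \<le> 1" "0 \<le> h t" for t
      unfolding h_def using infdist_nonneg[of t S] by (auto intro!: continuous_intros)
    have [measurable]: "h \<in> borel_measurable borel" by (rule borel_measurable_continuous_onI[OF h(1)])
    have "(\<lambda>n. LINT x|bp_measure (X (r n)). h (code x)) = (\<lambda>n. 0)"
      by (simp add: h_def in_S)
    then have "(LINT t|R. h t) = 0"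
      using conv[OF h(1,2)] by (simp add: LIMSEQ_const_iff)
    moreover have "integrable R h"
      using h(2) by (intro R.integrable_const_bound[where B=1]) auto
    ultimately have "AE t in R. h t = 0"
      using integral_nonneg_eq_0_iff_AE[of R h] h(3) by auto
    then show ?thesis
      by eventually_elim (use closed \<open>S \<noteq> {}\<close> in \<open>auto simp: h_def in_closed_iff_infdist_zero min_def split: if_splits\<close>)
  qed
  define \<nu> where "\<nu> = law R c'"
  have \<nu>: "bp_measure \<nu> = distr R borel c'"
    unfolding \<nu>_def by (rule bp_measure_law) (auto simp: R.prob_space_axioms)
  have "(\<lambda>n. bp_int (X (r n)) f) \<longlonglongrightarrow> bp_int \<nu> f" for f
  proof -
    have "continuous_on S (\<lambda>t. f (c t))"
      by (intro continuous_on_compose2[OF continuous_on_apply_bcontfun cont_c]) auto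
    \<comment> \<open>Weak convergence on the line needs a bounded continuous function defined
      everywhere, whereas f(c t) is continuous only on \<open>S\<close>; hence the Tietze
      extension.\<close>
    then obtain h where h: "continuous_on UNIV h" "\<And>t. t \<in> S \<Longrightarrow> h t = f (c t)" "\<And>t. norm (h t) \<le> norm f"
      using Tietze[of S "\<lambda>t. f (c t)" UNIV "norm f"] closed
      by (metis UNIV_I closed_closedin norm_bounded norm_ge_zero subtopology_UNIV)
    have [measurable]: "h \<in> borel_measurable borel" by (rule borel_measurable_continuous_onI[OF h(1)])
    have "bp_int \<nu> f = (LINT t|R. f (c' t))"
      by (simp add: bp_int_def \<nu> integral_distr)
    also have "\<dots> = (LINT t|R. h t)"
    proof (rule integral_cong_AE)
      show "AE t in R. f (c' t) = h t"
        using AE_S by eventually_elim (simp add: c'_def h(2))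
    qed measurable
    finally show ?thesis
      using conv[OF h(1,3)] by (simp add: h(2) in_S c_code bp_int_def)
  qed
  then show ?thesis using r that by blast
qed

text \<open>A convergent subsequence supplies the measure, and the Cauchy property identifies its
  integrals with the limits along the whole sequence.\<close>

lemma complete_borel_prob:
  fixes X :: "nat \<Rightarrow> 'a borel_prob"
  assumes "\<And>f. Cauchy (\<lambda>n. bp_int (X n) f)"
  obtains \<nu> where "\<And>f. (\<lambda>n. bp_int (X n) f) \<longlonglongrightarrow> bp_int \<nu> f"
proof -
  obtain r \<nu> where r: "strict_mono (r :: nat \<Rightarrow> nat)" "\<And>f. (\<lambda>n. bp_int (X (r n)) f) \<longlonglongrightarrow> bp_int \<nu> f"
    using seq_compact_borel_prob by blast
  have "(\<lambda>n. bp_int (X n) f) \<longlonglongrightarrow> bp_int \<nu> f" for f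
  proof -
    obtain l where l: "(\<lambda>n. bp_int (X n) f) \<longlonglongrightarrow> l"
      using assms[of f] by (auto simp: Cauchy_convergent_iff convergent_def)
    then have "(\<lambda>n. bp_int (X (r n)) f) \<longlonglongrightarrow> l"
      using LIMSEQ_subseq_LIMSEQ[OF l r(1)] by (simp add: o_def)
    with r(2)[of f] l show ?thesis using LIMSEQ_unique by blast
  qed
  then show ?thesis using that by blast
qed

end

section \<open>Convex families of kernels\<close>

text \<open>The infima of \<open>Q\<close> over the shrinking sets increase to a finite limit
  \<open>a\<close>. Two near-minimizers from late sets have a midpoint in the same set, whose value
  of \<open>Q\<close> is nearly at least \<open>a\<close>; assumption \<open>mid\<close> then leaves
  little room for \<open>D\<close>.\<close>

lemma ex_Cauchy_near_minimizers:
  fixes K :: "nat \<Rightarrow> 'g set" and Q :: "'g \<Rightarrow> real" and D :: "'g \<Rightarrow> 'g \<Rightarrow> real"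
  assumes ne: "\<And>n. K n \<noteq> {}" and dec: "\<And>m n. m \<le> n \<Longrightarrow> K n \<subseteq> K m"
    and Q: "\<And>g. 0 \<le> Q g" "\<And>n g. g \<in> K n \<Longrightarrow> Q g \<le> B"
    and mid: "\<And>n g h. g \<in> K n \<Longrightarrow> h \<in> K n \<Longrightarrow> \<exists>m\<in>K n. Q m + D g h / 4 \<le> (Q g + Q h) / 2"
  shows "\<exists>g. \<forall>k. g k \<in> K k \<and> D (g k) (g (Suc k)) \<le> (1 / 8) ^ k"
proof -
  define \<alpha> where "\<alpha> n = (INF g\<in>K n. Q g)" for n
  have bdd: "bdd_below (Q ` K n)" for n using Q(1) by (auto intro: bdd_belowI[of _ 0])
  have \<alpha>_le: "\<alpha> n \<le> Q g" if "g \<in> K n" for n g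
    unfolding \<alpha>_def by (rule cINF_lower[OF bdd that])
  have "incseq \<alpha>"
    unfolding \<alpha>_def by (intro monoI cINF_superset_mono ne bdd dec) auto
  moreover have "\<alpha> n \<le> B" for n
    using ne[of n] \<alpha>_le Q(2) order_trans by blast
  ultimately obtain a where a: "\<alpha> \<longlonglongrightarrow> a" "\<And>n. \<alpha> n \<le> a"
    using incseq_convergent by blast
  \<comment> \<open>Near-minimality up to \<open>\<eta> k\<close> yields D/4 at most 2
    \<open>\<eta> k\<close>, hence D at most 8 \<open>\<eta> k\<close>, which is (1/8)^k. This rate
    still beats the factor 2^k applied to it later.\<close>
  define \<eta> :: "nat \<Rightarrow> real" where "\<eta> k = (1 / 8) ^ k / 8" for k
  have \<eta>: "\<eta> k > 0" "\<eta> (Suc k) \<le> \<eta> k" for k by (auto simp: \<eta>_def)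
  have "\<exists>n. a - \<eta> k \<le> \<alpha> n" for k
  proof -
    have "\<forall>\<^sub>F n in sequentially. a - \<eta> k < \<alpha> n"
      using a(1) by (rule order_tendstoD) (use \<eta>(1) in simp)
    then show ?thesis by (auto simp: eventually_sequentially intro: less_imp_le)
  qed
  then obtain n0 where n0: "\<And>k. a - \<eta> k \<le> \<alpha> (n0 k)" by metis
  \<comment> \<open>The summand \<open>k\<close> ensures that \<open>g k\<close> lies in
    \<open>K k\<close>; the sum makes \<open>N\<close> increasing and at least \<open>n0 k\<close>,
    where the infimum is within \<open>\<eta> k\<close> of \<open>a\<close>.\<close>
  define N where "N k = k + (\<Sum>j\<le>k. n0 j)" for k
  have N: "k \<le> N k" "N k \<le> N (Suc k)" "n0 k \<le> N k" for k
    by (auto simp: N_def intro: trans_le_add2 member_le_sum)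
  have aN: "a - \<eta> k \<le> \<alpha> (N k)" for k
    using n0[of k] monoD[OF \<open>incseq \<alpha>\<close> N(3)[of k]] by linarith
  have "\<exists>g\<in>K (N k). Q g < \<alpha> (N k) + \<eta> k" for k
    using cINF_less_iff[OF ne bdd, of "N k" "\<alpha> (N k) + \<eta> k"] \<eta>(1) unfolding \<alpha>_def by simp
  then obtain g where g: "\<And>k. g k \<in> K (N k)" "\<And>k. Q (g k) < \<alpha> (N k) + \<eta> k" by metis
  have "D (g k) (g (Suc k)) \<le> (1 / 8) ^ k" for k
  proof -
    have "g (Suc k) \<in> K (N k)" using g(1) dec N(2) by blast
    then obtain m where m: "m \<in> K (N k)" "Q m + D (g k) (g (Suc k)) / 4 \<le> (Q (g k) + Q (g (Suc k))) / 2"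
      using mid g(1) by blast
    have "Q (g k) \<le> a + \<eta> k" "Q (g (Suc k)) \<le> a + \<eta> k" "a - \<eta> k \<le> Q m"
      using g(2)[of k] g(2)[of "Suc k"] a(2) \<eta>(2)[of k] aN[of k] \<alpha>_le[OF m(1)] by (smt (verit))+
    then have "D (g k) (g (Suc k)) / 4 \<le> 2 * \<eta> k" using m(2) by argo
    then show ?thesis by (simp add: \<eta>_def)
  qed
  moreover have "g k \<in> K k" for k using g(1) dec N(1) by blast
  ultimately show ?thesis by blast
qed

section \<open>A weighted quadratic distance between measures\<close>

definition test :: "nat \<Rightarrow> 'a::metric_space \<Rightarrow>\<^sub>C real" where
  "test = from_nat_into (\<Union>m. pu m ` net m)"

text \<open>This is the squared distance after embedding measures into a weighted l2 space by their
  integrals of the \<open>test\<close> functions, and \<open>sqnorm\<close> is the squared norm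
  there. Squares are kept because the parallelogram law is about squares.\<close>

definition sqdist :: "'a::metric_space borel_prob \<Rightarrow> 'a borel_prob \<Rightarrow> real" where
  "sqdist \<nu> \<rho> = (\<Sum>j. (1 / 2) ^ Suc j * (bp_int \<nu> (test j) - bp_int \<rho> (test j))\<^sup>2)"

definition sqnorm :: "'a::metric_space borel_prob \<Rightarrow> real" where
  "sqnorm \<nu> = (\<Sum>j. (1 / 2) ^ Suc j * (bp_int \<nu> (test j))\<^sup>2)"

lemma weights_sums: "(\<lambda>j. (1 / 2) ^ Suc j) sums (1 :: real)"
  using sums_mult[OF geometric_sums[of "1 / 2 :: real"], of "1 / 2"] by simp

context
  assumes compact_UNIV: "compact (UNIV :: 'a::metric_space set)"
begin

lemma pu_le_1: "k \<in> net m \<Longrightarrow> pu m k (x::'a) \<le> 1"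
  using member_le_sum[of k "net m" "\<lambda>k. pu m k x"] net(1)[OF compact_UNIV] pu_nonneg[OF compact_UNIV]
  by (auto simp: sum_pu[OF compact_UNIV])

lemma countable_pus: "countable (\<Union>m. pu m ` net m :: ('a \<Rightarrow>\<^sub>C real) set)"
  using net(1)[OF compact_UNIV] by (intro countable_UN countable_image) (auto intro: countable_finite)

lemma pus_nonempty: "(\<Union>m. pu m ` net m :: ('a \<Rightarrow>\<^sub>C real) set) \<noteq> {}"
  using net(2)[OF compact_UNIV, of 0] by blast

lemma ex_test: "k \<in> net m \<Longrightarrow> \<exists>j. test j = pu m (k::'a)"
proof -
  assume "k \<in> net m"
  then have "pu m k \<in> (\<Union>m. pu m ` net m)" by blast
  then show ?thesis
    using from_nat_into_surj[OF countable_pus] unfolding test_def by blast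
qed

lemma bp_int_test: "0 \<le> bp_int \<nu> (test j :: 'a \<Rightarrow>\<^sub>C real)" "bp_int \<nu> (test j :: 'a \<Rightarrow>\<^sub>C real) \<le> 1"
proof -
  have "test j \<in> (\<Union>m. pu m ` net m :: ('a \<Rightarrow>\<^sub>C real) set)"
    unfolding test_def by (rule from_nat_into[OF pus_nonempty])
  then obtain m k where k: "k \<in> net m" "(test j :: 'a \<Rightarrow>\<^sub>C real) = pu m k" by blast
  show "0 \<le> bp_int \<nu> (test j :: 'a \<Rightarrow>\<^sub>C real)"
    unfolding k(2) by (rule bp_int_nonneg) (rule pu_nonneg[OF compact_UNIV k(1)])
  have "bp_int \<nu> (test j) \<le> bp_int \<nu> (const_bcontfun 1)"
    unfolding k(2) by (rule bp_int_mono) (simp add: pu_le_1[OF k(1)])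
  then show "bp_int \<nu> (test j :: 'a \<Rightarrow>\<^sub>C real) \<le> 1" by simp
qed

lemma summable_weighted:
  fixes x :: "nat \<Rightarrow> real"
  assumes "\<And>j. 0 \<le> x j" "\<And>j. x j \<le> 1"
  shows "summable (\<lambda>j. (1 / 2) ^ Suc j * x j)" "0 \<le> (\<Sum>j. (1 / 2) ^ Suc j * x j)"
    "(\<Sum>j. (1 / 2) ^ Suc j * x j) \<le> 1"
proof -
  have le: "(1 / 2) ^ Suc j * x j \<le> (1 / 2) ^ Suc j" for j
    using assms(2)[of j] by (intro mult_left_le) auto
  have nonneg: "0 \<le> (1 / 2) ^ Suc j * x j" for j
    by (intro mult_nonneg_nonneg assms(1)) auto
  show s: "summable (\<lambda>j. (1 / 2) ^ Suc j * x j)"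
  proof (rule summable_comparison_test'[OF sums_summable[OF weights_sums]])
    show "norm ((1 / 2) ^ Suc j * x j) \<le> (1 / 2) ^ Suc j" for j
      using le nonneg by (simp only: real_norm_def abs_of_nonneg)
  qed
  show "0 \<le> (\<Sum>j. (1 / 2) ^ Suc j * x j)" by (rule suminf_nonneg[OF s nonneg])
  show "(\<Sum>j. (1 / 2) ^ Suc j * x j) \<le> 1"
    using suminf_le[OF le s sums_summable[OF weights_sums]] sums_unique[OF weights_sums] by simp
qed

lemma test_diff_sq: "(bp_int \<nu> (test j :: 'a \<Rightarrow>\<^sub>C real) - bp_int \<rho> (test j :: 'a \<Rightarrow>\<^sub>C real))\<^sup>2 \<le> 1"
proof -
  have "\<bar>bp_int \<nu> (test j :: 'a \<Rightarrow>\<^sub>C real) - bp_int \<rho> (test j :: 'a \<Rightarrow>\<^sub>C real)\<bar> \<le> 1"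
    using bp_int_test[of \<nu> j] bp_int_test[of \<rho> j] by linarith
  then show ?thesis by (simp add: abs_square_le_1)
qed

lemma test_sq: "(bp_int \<nu> (test j :: 'a \<Rightarrow>\<^sub>C real))\<^sup>2 \<le> 1"
  using bp_int_test[of \<nu> j] by (simp add: power_le_one)

lemma sqdist_bounds: "0 \<le> sqdist \<nu> (\<rho> :: 'a borel_prob)" "sqdist \<nu> (\<rho> :: 'a borel_prob) \<le> 1"
  unfolding sqdist_def by (rule summable_weighted(2,3)[OF zero_le_power2 test_diff_sq])+

lemma sqnorm_bounds: "0 \<le> sqnorm (\<nu> :: 'a borel_prob)" "sqnorm (\<nu> :: 'a borel_prob) \<le> 1"
  unfolding sqnorm_def by (rule summable_weighted(2,3)[OF zero_le_power2 test_sq])+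

lemma test_diff_le_sqdist:
  "\<bar>bp_int \<nu> (test j) - bp_int \<rho> (test j)\<bar> \<le> sqrt (2 ^ Suc j * sqdist \<nu> (\<rho> :: 'a borel_prob))"
proof -
  have "(1 / 2) ^ Suc j * (bp_int \<nu> (test j) - bp_int \<rho> (test j))\<^sup>2 \<le> sqdist \<nu> \<rho>"
    unfolding sqdist_def
    using sum_le_suminf[OF summable_weighted(1)[OF zero_le_power2 test_diff_sq[of \<nu> _ \<rho>]], of "{j}"]
    by (simp del: power_Suc)
  then have "(bp_int \<nu> (test j) - bp_int \<rho> (test j))\<^sup>2 \<le> 2 ^ Suc j * sqdist \<nu> \<rho>"
    by (simp add: power_divide field_simps)
  then show ?thesis by (rule real_le_rsqrt[of "\<bar>_\<bar>", simplified])
qed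

text \<open>The parallelogram law ((x+y)/2)^2 + (x-y)^2/4 = (x^2+y^2)/2 holds term by term, \<mu>
  being the midpoint on every test function.\<close>

lemma sqnorm_midpoint:
  fixes \<nu> \<rho> \<mu> :: "'a borel_prob"
  assumes "\<And>f. bp_int \<mu> f = (bp_int \<nu> f + bp_int \<rho> f) / 2"
  shows "sqnorm \<mu> + sqdist \<nu> \<rho> / 4 = (sqnorm \<nu> + sqnorm \<rho>) / 2"
proof -
  have s: "(\<lambda>j. (1 / 2) ^ Suc j * (bp_int \<nu> (test j))\<^sup>2) sums sqnorm \<nu>" for \<nu> :: "'a borel_prob"
    unfolding sqnorm_def by (rule summable_sums[OF summable_weighted(1)[OF zero_le_power2 test_sq]])
  have d: "(\<lambda>j. (1 / 2) ^ Suc j * (bp_int \<nu> (test j) - bp_int \<rho> (test j))\<^sup>2) sums sqdist \<nu> \<rho>"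
    unfolding sqdist_def by (rule summable_sums[OF summable_weighted(1)[OF zero_le_power2 test_diff_sq]])
  have "(\<lambda>j. (1 / 2) ^ Suc j * (bp_int \<mu> (test j))\<^sup>2
      + (1 / 2) ^ Suc j * (bp_int \<nu> (test j) - bp_int \<rho> (test j))\<^sup>2 / 4) sums (sqnorm \<mu> + sqdist \<nu> \<rho> / 4)"
    by (intro sums_add sums_divide s d)
  also have "(\<lambda>j. (1 / 2) ^ Suc j * (bp_int \<mu> (test j))\<^sup>2
      + (1 / 2) ^ Suc j * (bp_int \<nu> (test j) - bp_int \<rho> (test j))\<^sup>2 / 4) =
    (\<lambda>j. ((1 / 2) ^ Suc j * (bp_int \<nu> (test j))\<^sup>2 + (1 / 2) ^ Suc j * (bp_int \<rho> (test j))\<^sup>2) / 2)"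
    unfolding assms by (rule ext) (simp add: power2_eq_square field_simps)
  finally show ?thesis
    using sums_unique2 sums_divide[OF sums_add[OF s[of \<nu>] s[of \<rho>]], of 2] by blast
qed

lemma measurable_sqdist:
  fixes g h :: "'i \<Rightarrow> 'a borel_prob"
  assumes [measurable]: "g \<in> borel_measurable M" "h \<in> borel_measurable M"
  shows "(\<lambda>i. sqdist (g i) (h i)) \<in> borel_measurable M"
  unfolding sqdist_def by measurable

lemma measurable_sqnorm:
  fixes g :: "'i \<Rightarrow> 'a borel_prob"
  assumes [measurable]: "g \<in> borel_measurable M"
  shows "(\<lambda>i. sqnorm (g i)) \<in> borel_measurable M"
  unfolding sqnorm_def by measurable

text \<open>Midpoints are chosen separately for each player; the choice is measurable because
  measurability is tested by integrals, and those are determined.\<close>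

lemma ex_midpoint_kernel:
  fixes g h :: "'i \<Rightarrow> 'a borel_prob"
  assumes [measurable]: "g \<in> borel_measurable M" "h \<in> borel_measurable M"
  obtains m where "m \<in> borel_measurable M" "\<And>i f. bp_int (m i) f = (bp_int (g i) f + bp_int (h i) f) / 2"
proof -
  have "\<exists>\<rho>. \<forall>f. bp_int \<rho> f = (bp_int (g i) f + bp_int (h i) f) / 2" for i
    using ex_mixture[of "UNIV :: bool set" "\<lambda>_. 1 / 2" "\<lambda>b. if b then g i else h i"]
    by (simp add: UNIV_bool add_divide_distrib add.commute)
  then obtain m where m: "\<And>i f. bp_int (m i) f = (bp_int (g i) f + bp_int (h i) f) / 2" by metis
  moreover have "m \<in> borel_measurable M"
    by (rule measurable_borel_probI[OF compact_UNIV]) (simp add: m)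
  ultimately show ?thesis using that by blast
qed

text \<open>Closure under midpoints replaces convexity, and integrating the parallelogram law over
  the players makes it hold for whole kernels. The prescribed rate of the near-minimizers turns
  convergence in mean into convergence for almost every player.\<close>

lemma convergent_kernels:
  fixes K :: "nat \<Rightarrow> ('i \<Rightarrow> 'a borel_prob) set"
  assumes "prob_space M" and K: "\<And>n. K n \<subseteq> borel_measurable M" "\<And>n. K n \<noteq> {}" "\<And>m n. m \<le> n \<Longrightarrow> K n \<subseteq> K m"
    and mid: "\<And>n g h m. g \<in> K n \<Longrightarrow> h \<in> K n \<Longrightarrow> m \<in> borel_measurable M \<Longrightarrow>
      (\<And>i f. bp_int (m i) f = (bp_int (g i) f + bp_int (h i) f) / 2) \<Longrightarrow> m \<in> K n"
  shows "\<exists>g g\<^sub>0. (\<forall>k. g k \<in> K k) \<and> g\<^sub>0 \<in> borel_measurable M \<and>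
    (AE i in M. \<forall>f. (\<lambda>k. bp_int (g k i) f) \<longlonglongrightarrow> bp_int (g\<^sub>0 i) f)"
proof -
  interpret prob_space M by fact
  define Q where "Q g = (LINT i|M. sqnorm (g i))" for g :: "'i \<Rightarrow> 'a borel_prob"
  define D where "D g h = (LINT i|M. sqdist (g i) (h i))" for g h :: "'i \<Rightarrow> 'a borel_prob"
  have int_Q: "integrable M (\<lambda>i. sqnorm (g i))" if "g \<in> borel_measurable M" for g :: "'i \<Rightarrow> 'a borel_prob"
    using sqnorm_bounds by (intro integrable_const_bound[where B=1] measurable_sqnorm that) auto
  have int_D: "integrable M (\<lambda>i. sqdist (g i) (h i))"
    if "g \<in> borel_measurable M" "h \<in> borel_measurable M" for g h :: "'i \<Rightarrow> 'a borel_prob"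
    using sqdist_bounds by (intro integrable_const_bound[where B=1] measurable_sqdist that) auto
  have "\<exists>g. \<forall>k. g k \<in> K k \<and> D (g k) (g (Suc k)) \<le> (1 / 8) ^ k"
  proof (rule ex_Cauchy_near_minimizers[where Q=Q and B=1])
    show "0 \<le> Q g" for g unfolding Q_def by (intro integral_nonneg_AE) (simp add: sqnorm_bounds)
    show "Q g \<le> 1" if "g \<in> K n" for n g
      unfolding Q_def using that K(1) sqnorm_bounds by (intro integral_le_const int_Q) auto
    fix n g h assume gh: "g \<in> K n" "h \<in> K n"
    then have gh': "g \<in> borel_measurable M" "h \<in> borel_measurable M" using K(1) by auto
    obtain m where m: "m \<in> borel_measurable M" "\<And>i f. bp_int (m i) f = (bp_int (g i) f + bp_int (h i) f) / 2"
      using ex_midpoint_kernel[OF gh'] by blast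
    have "Q m + D g h / 4 = (LINT i|M. sqnorm (m i) + sqdist (g i) (h i) / 4)"
      unfolding Q_def D_def by (simp add: int_Q int_D m gh')
    also have "\<dots> = (LINT i|M. (sqnorm (g i) + sqnorm (h i)) / 2)"
      by (intro Bochner_Integration.integral_cong refl sqnorm_midpoint m)
    also have "\<dots> = (Q g + Q h) / 2"
      unfolding Q_def by (simp add: int_Q gh')
    finally show "\<exists>m\<in>K n. Q m + D g h / 4 \<le> (Q g + Q h) / 2"
      by (intro bexI[OF _ mid[OF gh m]]) simp_all
  qed (use K in auto)
  then obtain g where g: "\<And>k. g k \<in> K k" "\<And>k. D (g k) (g (Suc k)) \<le> (1 / 8) ^ k" by blast
  have [measurable]: "g k \<in> borel_measurable M" for k using g(1) K(1) by blast
  note measurable_sqdist[measurable]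
  \<comment> \<open>The integrals of \<open>x k\<close> are at most 4^-k, so almost everywhere the
    series converges and its terms are eventually below 1. Then \<open>sqdist\<close> is at most
    2^-k, and the increments of each test integral are dominated by a geometric series of ratio
    \<open>sqrt (1 / 2)\<close>.\<close>
  define x where "x k i = 2 ^ k * sqdist (g k i) (g (Suc k) i)" for k i
  have [measurable]: "x k \<in> borel_measurable M" for k unfolding x_def by measurable
  have x0: "0 \<le> x k i" for k i by (simp add: x_def sqdist_bounds)
  have "(\<integral>\<^sup>+ i. (\<Sum>k. ennreal (x k i)) \<partial>M) = (\<Sum>k. \<integral>\<^sup>+ i. ennreal (x k i) \<partial>M)"
    by (rule nn_integral_suminf) simp
  also have "\<dots> \<le> (\<Sum>k. ennreal ((1 / 4) ^ k))"
  proof (intro suminf_le summableI)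
    fix k
    have "(\<integral>\<^sup>+ i. ennreal (x k i) \<partial>M) = ennreal (LINT i|M. x k i)"
      using x0 by (intro nn_integral_eq_integral) (auto simp: x_def int_D)
    also have "(LINT i|M. x k i) = 2 ^ k * D (g k) (g (Suc k))" by (simp add: x_def D_def)
    also have "\<dots> \<le> 2 ^ k * (1 / 8) ^ k" by (intro mult_left_mono g) simp
    also have "\<dots> = (1 / 4) ^ k" by (simp add: power_mult_distrib[symmetric])
    finally show "(\<integral>\<^sup>+ i. ennreal (x k i) \<partial>M) \<le> ennreal ((1 / 4) ^ k)" by (simp add: ennreal_leI)
  qed
  also have "\<dots> < \<infinity>"
    by (subst suminf_ennreal2) (auto intro: summable_geometric)
  finally have "AE i in M. (\<Sum>k. ennreal (x k i)) \<noteq> \<infinity>"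
    by (intro nn_integral_PInf_AE) auto
  then have AE: "AE i in M. \<forall>f. Cauchy (\<lambda>k. bp_int (g k i) f)"
  proof eventually_elim
    fix i assume fin: "(\<Sum>k. ennreal (x k i)) \<noteq> \<infinity>"
    then have "summable (\<lambda>k. x k i)"
      using x0 by (intro summable_suminf_not_top) (auto simp: infinity_ennreal_def)
    then have "(\<lambda>k. x k i) \<longlonglongrightarrow> 0" by (rule summable_LIMSEQ_zero)
    then have "\<forall>\<^sub>F k in sequentially. x k i < 1" by (rule order_tendstoD) simp
    then obtain k0 where k0: "\<And>k. k \<ge> k0 \<Longrightarrow> x k i < 1" by (auto simp: eventually_sequentially)
    have "Cauchy (\<lambda>k. bp_int (g k i) (test j))" for j
    proof -
      have "summable (\<lambda>k. bp_int (g (Suc k) i) (test j) - bp_int (g k i) (test j))"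
      proof (rule summable_comparison_test')
        show "summable (\<lambda>k. sqrt (2 ^ Suc j) * sqrt (1 / 2) ^ k)"
          by (intro summable_mult summable_geometric) (simp add: real_sqrt_lt_1_iff)
        fix k assume "k \<ge> k0"
        then have "sqdist (g k i) (g (Suc k) i) \<le> (1 / 2) ^ k"
          using k0[of k] by (simp add: x_def field_simps power_divide)
        then have "sqrt (2 ^ Suc j * sqdist (g k i) (g (Suc k) i)) \<le> sqrt (2 ^ Suc j * (1 / 2) ^ k)"
          by (intro real_sqrt_le_mono mult_left_mono) auto
        also have "\<dots> = sqrt (2 ^ Suc j) * sqrt (1 / 2) ^ k"
          by (simp only: real_sqrt_mult real_sqrt_power)
        finally show "norm (bp_int (g (Suc k) i) (test j) - bp_int (g k i) (test j)) \<le> sqrt (2 ^ Suc j) * sqrt (1 / 2) ^ k"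
          using test_diff_le_sqdist[of "g k i" j "g (Suc k) i"] unfolding real_norm_def by linarith
      qed
      then have "convergent (\<lambda>n. \<Sum>k<n. bp_int (g (Suc k) i) (test j) - bp_int (g k i) (test j))"
        by (simp add: summable_iff_convergent)
      then have "convergent (\<lambda>n. bp_int (g n i) (test j) - bp_int (g 0 i) (test j))"
        by (simp only: sum_lessThan_telescope[of "\<lambda>n. bp_int (g n i) (test j)"])
      then show ?thesis
        using convergent_add[OF _ convergent_const[of "bp_int (g 0 i) (test j)"]]
        by (fastforce intro: convergent_Cauchy)
    qed
    then show "\<forall>f. Cauchy (\<lambda>k. bp_int (g k i) f)"
      using Cauchy_bp_intI[OF compact_UNIV] ex_test by metis
  qed
  then obtain N where N: "{i\<in>space M. \<not> (\<forall>f. Cauchy (\<lambda>k. bp_int (g k i) f))} \<subseteq> N" "N \<in> sets M" "emeasure M N = 0"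
    by (rule AE_E)
  have "\<exists>\<nu>. \<forall>f. (\<lambda>k. bp_int (g k i) f) \<longlonglongrightarrow> bp_int \<nu> f" if "i \<in> space M - N" for i
  proof -
    have "\<And>f. Cauchy (\<lambda>k. bp_int (g k i) f)" using that N(1) by blast
    then show ?thesis using complete_borel_prob[OF compact_UNIV, of "\<lambda>k. g k i"] by metis
  qed
  then obtain g1 where g1: "\<And>i f. i \<in> space M - N \<Longrightarrow> (\<lambda>k. bp_int (g k i) f) \<longlonglongrightarrow> bp_int (g1 i) f"
    by metis
  \<comment> \<open>On the measurable null set \<open>N\<close> an arbitrary Dirac measure is used,
    so that every integral of \<open>g0\<close> is a limit of measurable functions at all points and
    not just almost everywhere.\<close>
  define g0 where "g0 i = (if i \<in> N then dirac undefined else g1 i)" for i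
  have "g0 \<in> borel_measurable M"
  proof (rule measurable_borel_probI[OF compact_UNIV])
    fix f :: "'a \<Rightarrow>\<^sub>C real"
    note N(2)[measurable]
    show "(\<lambda>i. bp_int (g0 i) f) \<in> borel_measurable M"
    proof (rule borel_measurable_LIMSEQ_real)
      show "(\<lambda>k. if i \<in> N then f undefined else bp_int (g k i) f) \<longlonglongrightarrow> bp_int (g0 i) f" if "i \<in> space M" for i
        using g1[of i f] that by (auto simp: g0_def)
      show "(\<lambda>i. if i \<in> N then f undefined else bp_int (g k i) f) \<in> borel_measurable M" for k
        by measurable
    qed
  qed
  moreover have "AE i in M. \<forall>f. (\<lambda>k. bp_int (g k i) f) \<longlonglongrightarrow> bp_int (g0 i) f"
    using AE_not_in[of N M] N(2,3) AE_space
    by (auto simp: null_sets_def g0_def g1 elim!: eventually_elim2)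
  ultimately show ?thesis using g(1) by blast
qed

end

section \<open>Limits of kernels over converging base distributions\<close>

text \<open>The differences of consecutive clamps telescope, so the hats form a partition of unity on \<open>[0,1]\<close>;
  their products over a net are a finite one on the \<open>[0,1]\<close>-valued functions in \<open>C(A)\<close>.\<close>

definition hat :: "nat \<Rightarrow> nat \<Rightarrow> real \<Rightarrow> real" where
  "hat N m t = max 0 (min 1 (real N * t - real m + 1)) - max 0 (min 1 (real N * t - real m))"

lemma hat_bounds: "0 \<le> hat N m t" "hat N m t \<le> 1"
  by (auto simp: hat_def)

lemma continuous_on_hat: "continuous_on UNIV f \<Longrightarrow> continuous_on UNIV (\<lambda>x. hat N m (f x))"
  unfolding hat_def by (intro continuous_intros)

lemma sum_hat:
  assumes "0 \<le> t" "t \<le> 1"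
  shows "(\<Sum>m\<le>N. hat N m t) = 1"
proof -
  let ?c = "\<lambda>m. - max 0 (min 1 (real N * t - real m + 1))"
  have "(\<Sum>m\<le>N. hat N m t) = (\<Sum>m<Suc N. ?c (Suc m) - ?c m)"
    unfolding lessThan_Suc_atMost by (intro sum.cong) (auto simp: hat_def)
  also have "\<dots> = ?c (Suc N) - ?c 0" by (rule sum_lessThan_telescope)
  also have "\<dots> = 1" using assms mult_left_le[of t "real N"] by auto
  finally show ?thesis .
qed

text \<open>As a function of \<open>t\<close>, \<open>hat N m\<close> is the tent of height 1 and
  half-width 1/N centred at m/N.\<close>

lemma hat_support:
  assumes "hat N m t \<noteq> 0" "N > 0"
  shows "\<bar>t - real m / real N\<bar> \<le> 1 / real N"
proof -
  have "\<bar>real N * t - real m\<bar> \<le> 1"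
    using assms(1) by (auto simp: hat_def max_def min_def split: if_splits)
  also have "real N * t - real m = real N * (t - real m / real N)"
    using assms(2) by (simp add: right_diff_distrib)
  finally have "real N * \<bar>t - real m / real N\<bar> \<le> 1" by (simp add: abs_mult)
  then show ?thesis using assms(2) by (simp add: pos_le_divide_eq mult.commute)
qed

context
  assumes compact_UNIV: "compact (UNIV :: 'a::metric_space set)"
begin

definition cell :: "nat \<Rightarrow> nat \<Rightarrow> ('a \<Rightarrow> nat) \<Rightarrow> ('a \<Rightarrow>\<^sub>C real) \<Rightarrow> real" where
  "cell m N r w = (\<Prod>k\<in>net m. hat N (r k) (w k))"

lemma cell_bounds: "0 \<le> cell m N r w" "cell m N r w \<le> 1"
  unfolding cell_def by (auto intro!: prod_nonneg prod_le_1 simp: hat_bounds)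

lemma continuous_on_cell: "continuous_on UNIV (cell m N r)"
  unfolding cell_def by (intro continuous_intros continuous_on_hat continuous_on_bcontfun_eval)

lemma sum_cell:
  fixes w :: "'a \<Rightarrow>\<^sub>C real"
  assumes "\<And>k. 0 \<le> w k" "\<And>k. w k \<le> 1"
  shows "(\<Sum>r\<in>PiE (net m) (\<lambda>_. {..N}). cell m N r w) = 1"
proof -
  have "(\<Sum>r\<in>PiE (net m) (\<lambda>_. {..N}). cell m N r w) = (\<Prod>k\<in>net m. \<Sum>j\<le>N. hat N j (w k))"
    unfolding cell_def by (rule prod_sum_PiE[symmetric]) (auto simp: net(1)[OF compact_UNIV])
  also have "\<dots> = 1" by (simp add: sum_hat assms)
  finally show ?thesis .
qed

text \<open>The representative of cell \<open>r\<close>, interpolating the grid values r(k)/N. A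
  function with positive weight in the cell differs from it by at most its own interpolation error
  plus 1/N.\<close>

definition step :: "nat \<Rightarrow> nat \<Rightarrow> ('a \<Rightarrow> nat) \<Rightarrow> 'a \<Rightarrow>\<^sub>C real" where
  "step m N r = (\<Sum>k\<in>net m. (real (r k) / real N) *\<^sub>R pu m k)"

lemma step_apply: "step m N r x = (\<Sum>k\<in>net m. (real (r k) / real N) * pu m k x)"
  by (simp add: step_def apply_bcontfun_sum)

lemma norm_step_le:
  assumes "r \<in> PiE (net m) (\<lambda>_. {..N})"
  shows "norm (step m N r) \<le> 1"
proof (rule norm_bound)
  fix x
  show "norm (step m N r x) \<le> 1"
    unfolding step_apply real_norm_def
  proof (rule pu_combination_le[OF compact_UNIV])
    fix k :: 'a assume "k \<in> net m"
    then have "r k \<le> N" using assms by auto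
    then show "\<bar>real (r k) / real N\<bar> \<le> 1" by (simp add: divide_le_eq_1) linarith
  qed
qed

lemma dist_step_le:
  fixes w :: "'a \<Rightarrow>\<^sub>C real"
  assumes "cell m N r w \<noteq> 0" "N > 0"
  shows "\<bar>w x - step m N r x\<bar> \<le> norm (interp m w - w) + 1 / real N"
proof -
  have "\<bar>\<Sum>k\<in>net m. (w k - real (r k) / real N) * pu m k x\<bar> \<le> 1 / real N"
  proof (rule pu_combination_le[OF compact_UNIV])
    fix k :: 'a assume "k \<in> net m"
    then have "hat N (r k) (w k) \<noteq> 0"
      using assms(1) net(1)[OF compact_UNIV] by (auto simp: cell_def)
    then show "\<bar>w k - real (r k) / real N\<bar> \<le> 1 / real N"
      using hat_support assms(2) by blast
  qed
  also have "(\<Sum>k\<in>net m. (w k - real (r k) / real N) * pu m k x) = interp m w x - step m N r x"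
    by (simp add: interp_apply step_apply left_diff_distrib sum_subtractf)
  finally show ?thesis using abs_bcontfun_le[of "interp m w - w" x] by simp
qed

text \<open>The interpolation error as a bounded continuous function on all of C(A), so that weak
  convergence applies to it. The truncation has no effect on functions with values in [0,1].\<close>

definition modulus :: "nat \<Rightarrow> ('a \<Rightarrow>\<^sub>C real) \<Rightarrow> real" where
  "modulus m w = min 1 (norm (interp m w - w))"

lemma modulus_bounds: "0 \<le> modulus m w" "modulus m w \<le> 1"
  by (auto simp: modulus_def)

lemma modulus_eq:
  fixes w :: "'a \<Rightarrow>\<^sub>C real"
  assumes "\<And>k. 0 \<le> w k" "\<And>k. w k \<le> 1"
  shows "modulus m w = norm (interp m w - w)"
proof -
  have "norm (interp m w - w) \<le> 1"
  proof (rule norm_bound)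
    fix x
    have "0 \<le> interp m w x"
      unfolding interp_apply using assms pu_nonneg[OF compact_UNIV] by (intro sum_nonneg mult_nonneg_nonneg) auto
    moreover have "\<bar>interp m w x\<bar> \<le> 1"
      unfolding interp_apply by (rule pu_combination_le[OF compact_UNIV]) (use assms in \<open>simp add: abs_of_nonneg\<close>)
    ultimately show "norm ((interp m w - w) x) \<le> 1" using assms[of x] by (simp add: abs_le_iff)
  qed
  then show ?thesis by (simp add: modulus_def)
qed

lemma continuous_on_modulus: "continuous_on UNIV (modulus m)"
  unfolding modulus_def by (intro continuous_intros continuous_on_interp)

lemma modulus_tendsto: "(\<lambda>m. modulus m w) \<longlonglongrightarrow> 0"
proof (rule Lim_null_comparison)
  show "(\<lambda>m. norm (interp m w - w)) \<longlonglongrightarrow> 0"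
    using interp_tendsto[OF compact_UNIV, of w] by (simp add: LIM_zero tendsto_norm_zero)
qed (auto simp: modulus_def)

text \<open>Let \<open>\<nu> n r\<close> be the strategies of the n-th game averaged with the
  weights of cell \<open>r\<close>. Player \<open>i\<close> receives their mixture according to the
  cell weights of \<open>w i\<close>. The total weights of the cells agree in the limit, so the
  summary is nearly preserved. The regret is nearly preserved because within a cell all functions
  are close to \<open>step m N r\<close>, up to the error \<open>modulus\<close>.\<close>

lemma approximate_transfer:
  fixes w :: "'i \<Rightarrow> 'a \<Rightarrow>\<^sub>C real" and v :: "nat \<Rightarrow> 'j \<Rightarrow> 'a \<Rightarrow>\<^sub>C real" and h :: "nat \<Rightarrow> 'j \<Rightarrow> 'a borel_prob"
  assumes "prob_space M" and w_meas [measurable]: "w \<in> borel_measurable M"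
    and w: "\<And>i k. 0 \<le> w i k" "\<And>i k. w i k \<le> 1"
    and "\<And>n. prob_space (J n)" and v_meas [measurable]: "\<And>n. v n \<in> borel_measurable (J n)"
    and v: "\<And>n j k. 0 \<le> v n j k" "\<And>n j k. v n j k \<le> 1"
    and h_meas [measurable]: "\<And>n. h n \<in> borel_measurable (J n)"
    and conv: "\<And>\<Phi> :: ('a \<Rightarrow>\<^sub>C real) \<Rightarrow> real. continuous_on UNIV \<Phi> \<Longrightarrow> (\<And>x. 0 \<le> \<Phi> x) \<Longrightarrow> (\<And>x. \<Phi> x \<le> 1) \<Longrightarrow>
      (\<lambda>n. LINT j|J n. \<Phi> (v n j)) \<longlonglongrightarrow> (LINT i|M. \<Phi> (w i))"
    and summary: "\<And>f. (\<lambda>n. LINT j|J n. bp_int (h n j) f) \<longlonglongrightarrow> bp_int \<tau> f"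
    and zero: "(\<lambda>n. LINT j|J n. bp_int (h n j) (v n j)) \<longlonglongrightarrow> 0"
    and "finite T" "e > 0"
  shows "\<exists>g\<in>borel_measurable M. (\<forall>f\<in>T. \<bar>(LINT i|M. bp_int (g i) f) - bp_int \<tau> f\<bar> < e) \<and>
    (LINT i|M. bp_int (g i) (w i)) < e"
proof -
  interpret M: prob_space M by fact
  interpret J: prob_space "J n" for n by fact
  have comp_w [measurable]: "(\<lambda>i. \<Phi> (w i)) \<in> borel_measurable M"
    if "continuous_on UNIV \<Phi>" for \<Phi> :: "('a \<Rightarrow>\<^sub>C real) \<Rightarrow> real"
    using measurable_compose[OF w_meas borel_measurable_continuous_onI[OF that]] .
  have comp_v [measurable]: "(\<lambda>j. \<Phi> (v n j)) \<in> borel_measurable (J n)"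
    if "continuous_on UNIV \<Phi>" for \<Phi> :: "('a \<Rightarrow>\<^sub>C real) \<Rightarrow> real" and n
    using measurable_compose[OF v_meas borel_measurable_continuous_onI[OF that]] .
  have [measurable]: "(\<lambda>i. w i k) \<in> borel_measurable M" "(\<lambda>j. v n j k) \<in> borel_measurable (J n)"
    "(\<lambda>i. modulus m (w i)) \<in> borel_measurable M" "(\<lambda>j. modulus m (v n j)) \<in> borel_measurable (J n)"
    "(\<lambda>i. cell m N r (w i)) \<in> borel_measurable M" "(\<lambda>j. cell m N r (v n j)) \<in> borel_measurable (J n)"
    for k m N r n
    by (intro comp_w comp_v continuous_on_bcontfun_eval continuous_on_modulus continuous_on_cell)+
  have int_w [simp]: "integrable M (\<lambda>i. modulus m (w i))" "integrable M (\<lambda>i. cell m N r (w i))" for m N r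
    by (intro M.integrable_const_bound[where B=1]; simp add: modulus_bounds cell_bounds)+
  have int_v [simp]: "integrable (J n) (\<lambda>j. modulus m (v n j))" "integrable (J n) (\<lambda>j. cell m N r (v n j))" for m N r n
    by (intro J.integrable_const_bound[where B=1]; simp add: modulus_bounds cell_bounds)+
  have int_vh [simp]: "integrable (J n) (\<lambda>j. cell m N r (v n j) * bp_int (h n j) f)" for m N r n f
  proof (rule J.integrable_const_bound[where B="norm f"])
    show "AE j in J n. norm (cell m N r (v n j) * bp_int (h n j) f) \<le> norm f"
    proof (rule AE_I2)
      fix j
      have "\<bar>cell m N r (v n j)\<bar> * \<bar>bp_int (h n j) f\<bar> \<le> 1 * norm f"
        by (intro mult_mono abs_bp_int_le) (auto simp: cell_bounds)
      then show "norm (cell m N r (v n j) * bp_int (h n j) f) \<le> norm f" by (simp add: abs_mult)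
    qed
  qed simp
  have norm_w: "norm (w i) \<le> 1" for i using w by (intro norm_bound) (simp add: abs_of_nonneg)
  have norm_v: "norm (v n j) \<le> 1" for n j using v by (intro norm_bound) (simp add: abs_of_nonneg)
  have [measurable]: "(\<lambda>j. bp_int (h n j) (v n j)) \<in> borel_measurable (J n)" for n
    by (rule measurable_bp_int_param[OF compact_UNIV]) auto
  have [simp]: "integrable (J n) (\<lambda>j. bp_int (h n j) (v n j))" for n
    using order_trans[OF abs_bp_int_le norm_v] by (intro J.integrable_const_bound[where B=1]) auto

  \<comment> \<open>The resolution \<open>m\<close> is chosen in the limit population only; weak
    convergence carries the small average error over to the games. That error and the grid error 1/N
    each enter the final bound twice, so e/8 for either leaves e/2.\<close>
  have "(\<lambda>m. LINT i|M. modulus m (w i)) \<longlonglongrightarrow> (LINT i|M. 0)"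
    by (rule integral_dominated_convergence[where w="\<lambda>_. 1"]) (auto simp: modulus_bounds modulus_tendsto)
  then have "\<forall>\<^sub>F m in sequentially. (LINT i|M. modulus m (w i)) < e / 8"
    by (rule order_tendstoD) (use \<open>e > 0\<close> in simp)
  then obtain m where m: "(LINT i|M. modulus m (w i)) < e / 8" by (auto simp: eventually_sequentially)
  obtain N0 where "1 / real (Suc N0) < e / 8" using nat_approx_posE[of "e / 8"] \<open>e > 0\<close> by auto
  then obtain N where N: "N > 0" "1 / real N < e / 8" by blast
  define R where "R = PiE (net m :: 'a set) (\<lambda>_. {..N})"
  have [simp]: "finite R" unfolding R_def by (rule finite_PiE[OF net(1)[OF compact_UNIV]]) simp
  let ?c = "cell m N" and ?s = "step m N"
  define c where "c r = (LINT i|M. ?c r (w i))" for r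
  define d where "d n r = (LINT j|J n. ?c r (v n j))" for n r
  have "\<exists>\<nu>. \<forall>f. d n r * bp_int \<nu> f = (LINT j|J n. ?c r (v n j) * bp_int (h n j) f)" for n r
    unfolding d_def by (rule ex_density_average[where B=1]) (auto simp: cell_bounds J.prob_space_axioms)
  then obtain \<nu> where \<nu>: "d n r * bp_int (\<nu> n r) f = (LINT j|J n. ?c r (v n j) * bp_int (h n j) f)" for n r f
    by metis
  have ex: "\<exists>\<rho>. \<forall>f. bp_int \<rho> f = (\<Sum>r\<in>R. ?c r (w i) * bp_int (\<nu> n r) f)" for n i
  proof (rule ex_mixture)
    show "(\<Sum>r\<in>R. ?c r (w i)) = 1" for i unfolding R_def by (rule sum_cell[OF w])
  qed (auto simp: cell_bounds)
  define g where "g n i = (SOME \<rho>. \<forall>f. bp_int \<rho> f = (\<Sum>r\<in>R. ?c r (w i) * bp_int (\<nu> n r) f))" for n i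
  have g: "bp_int (g n i) f = (\<Sum>r\<in>R. ?c r (w i) * bp_int (\<nu> n r) f)" for n i f
    using someI_ex[OF ex[of i n]] unfolding g_def by blast
  have g_meas [measurable]: "g n \<in> borel_measurable M" for n
    by (rule measurable_borel_probI[OF compact_UNIV]) (unfold g, measurable)
  define \<delta> where "\<delta> n = (\<Sum>r\<in>R. \<bar>d n r - c r\<bar>)" for n
  have "(\<lambda>n. \<delta> n) \<longlonglongrightarrow> (\<Sum>r\<in>R. \<bar>c r - c r\<bar>)"
    unfolding \<delta>_def d_def
    by (intro tendsto_intros) (unfold c_def, intro conv continuous_on_cell cell_bounds)
  then have \<delta>: "\<delta> \<longlonglongrightarrow> 0" by simp
  \<comment> \<open>Exchanging the cell masses of the two populations costs \<delta> times the norm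
    bound. The integrand may vary with the cell: it is a fixed \<open>f\<close> for the summary and
    the cell representative for the regret.\<close>
  have near: "\<bar>(\<Sum>r\<in>R. c r * bp_int (\<nu> n r) (f r)) - (\<Sum>r\<in>R. d n r * bp_int (\<nu> n r) (f r))\<bar> \<le> \<delta> n * B"
    if "\<And>r. r \<in> R \<Longrightarrow> norm (f r) \<le> B" for n f B
  proof -
    have "\<bar>(\<Sum>r\<in>R. c r * bp_int (\<nu> n r) (f r)) - (\<Sum>r\<in>R. d n r * bp_int (\<nu> n r) (f r))\<bar>
        = \<bar>\<Sum>r\<in>R. (c r - d n r) * bp_int (\<nu> n r) (f r)\<bar>"
      by (simp add: sum_subtractf left_diff_distrib)
    also have "\<dots> \<le> (\<Sum>r\<in>R. \<bar>d n r - c r\<bar> * B)"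
    proof (rule order_trans[OF sum_abs], rule sum_mono)
      fix r assume "r \<in> R"
      then have "\<bar>bp_int (\<nu> n r) (f r)\<bar> \<le> B" using abs_bp_int_le order_trans that by blast
      then show "\<bar>(c r - d n r) * bp_int (\<nu> n r) (f r)\<bar> \<le> \<bar>d n r - c r\<bar> * B"
        unfolding abs_mult abs_minus_commute[of "c r"] by (intro mult_left_mono) auto
    qed
    finally show ?thesis by (simp add: \<delta>_def sum_distrib_right)
  qed
  have marginal: "\<bar>(LINT i|M. bp_int (g n i) f) - (LINT j|J n. bp_int (h n j) f)\<bar> \<le> \<delta> n * norm f" for n f
  proof -
    have "(LINT i|M. bp_int (g n i) f) = (\<Sum>r\<in>R. c r * bp_int (\<nu> n r) f)"
      unfolding g c_def by (simp add: Bochner_Integration.integral_sum)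
    moreover have "(LINT j|J n. bp_int (h n j) f) = (LINT j|J n. (\<Sum>r\<in>R. ?c r (v n j) * bp_int (h n j) f))"
      unfolding sum_distrib_right[symmetric] R_def by (simp add: sum_cell v)
    then have "(LINT j|J n. bp_int (h n j) f) = (\<Sum>r\<in>R. d n r * bp_int (\<nu> n r) f)"
      by (simp add: \<nu> Bochner_Integration.integral_sum)
    ultimately show ?thesis using near[of "\<lambda>_. f" "norm f" n] by simp
  qed
  have cost: "(LINT i|M. bp_int (g n i) (w i)) \<le> \<delta> n + (LINT j|J n. bp_int (h n j) (v n j)) +
      (LINT j|J n. modulus m (v n j)) + (LINT i|M. modulus m (w i)) + 2 / real N" for n
  proof -
    have [measurable]: "(\<lambda>i. bp_int (g n i) (w i)) \<in> borel_measurable M"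
      by (rule measurable_bp_int_param[OF compact_UNIV]) auto
    have [simp]: "integrable M (\<lambda>i. bp_int (g n i) (w i))"
      using order_trans[OF abs_bp_int_le norm_w] by (intro M.integrable_const_bound[where B=1]) auto
    \<comment> \<open>Keeping the factor \<open>?c r x\<close> disposes of the cells of weight zero;
      on the others \<open>dist_step_le\<close> applies. Summed over \<open>r\<close>, the factors
      of the error term add up to 1.\<close>
    have step_close: "?c r x * bp_int \<mu> x \<le> ?c r x * bp_int \<mu> (?s r) + ?c r x * (modulus m x + 1 / real N)"
      "?c r x * bp_int \<mu> (?s r) \<le> ?c r x * bp_int \<mu> x + ?c r x * (modulus m x + 1 / real N)"
      if "\<And>k. 0 \<le> x k" "\<And>k. x k \<le> 1" for r \<mu> and x :: "'a \<Rightarrow>\<^sub>C real"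
    proof -
      have "\<bar>bp_int \<mu> x - bp_int \<mu> (?s r)\<bar> \<le> modulus m x + 1 / real N" if "?c r x \<noteq> 0"
      proof (rule order_trans[OF abs_bp_int_diff_le norm_bound])
        fix k show "norm (apply_bcontfun (x - ?s r) k) \<le> modulus m x + 1 / real N"
          using dist_step_le[OF that N(1)] modulus_eq[of x m] \<open>\<And>k. 0 \<le> x k\<close> \<open>\<And>k. x k \<le> 1\<close> by simp
      qed
      then have "bp_int \<mu> x \<le> bp_int \<mu> (?s r) + (modulus m x + 1 / real N)"
        "bp_int \<mu> (?s r) \<le> bp_int \<mu> x + (modulus m x + 1 / real N)" if "?c r x \<noteq> 0"
        using that by (auto simp: abs_le_iff)
      then show "?c r x * bp_int \<mu> x \<le> ?c r x * bp_int \<mu> (?s r) + ?c r x * (modulus m x + 1 / real N)"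
        "?c r x * bp_int \<mu> (?s r) \<le> ?c r x * bp_int \<mu> x + ?c r x * (modulus m x + 1 / real N)"
        by (metis distrib_left mult_left_mono cell_bounds(1) mult_zero_left order_refl)+
    qed
    have "bp_int (g n i) (w i) \<le> (\<Sum>r\<in>R. ?c r (w i) * bp_int (\<nu> n r) (?s r)) + (modulus m (w i) + 1 / real N)" for i
    proof -
      have "bp_int (g n i) (w i) \<le> (\<Sum>r\<in>R. ?c r (w i) * bp_int (\<nu> n r) (?s r) + ?c r (w i) * (modulus m (w i) + 1 / real N))"
        unfolding g by (intro sum_mono step_close w)
      also have "\<dots> = (\<Sum>r\<in>R. ?c r (w i) * bp_int (\<nu> n r) (?s r)) + (modulus m (w i) + 1 / real N)"
        unfolding sum.distrib sum_distrib_right[symmetric] R_def by (simp add: sum_cell w)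
      finally show ?thesis .
    qed
    then have "(LINT i|M. bp_int (g n i) (w i)) \<le>
        (LINT i|M. (\<Sum>r\<in>R. ?c r (w i) * bp_int (\<nu> n r) (?s r)) + (modulus m (w i) + 1 / real N))"
      by (intro integral_mono) auto
    also have "\<dots> = (\<Sum>r\<in>R. c r * bp_int (\<nu> n r) (?s r)) + (LINT i|M. modulus m (w i)) + 1 / real N"
      by (simp add: c_def M.prob_space Bochner_Integration.integral_sum)
    finally have 1: "(LINT i|M. bp_int (g n i) (w i)) \<le>
      (\<Sum>r\<in>R. c r * bp_int (\<nu> n r) (?s r)) + (LINT i|M. modulus m (w i)) + 1 / real N" .
    have "(\<Sum>r\<in>R. ?c r (v n j) * bp_int (h n j) (?s r)) \<le> bp_int (h n j) (v n j) + (modulus m (v n j) + 1 / real N)" for j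
    proof -
      have "(\<Sum>r\<in>R. ?c r (v n j) * bp_int (h n j) (?s r)) \<le>
          (\<Sum>r\<in>R. ?c r (v n j) * bp_int (h n j) (v n j) + ?c r (v n j) * (modulus m (v n j) + 1 / real N))"
        by (intro sum_mono step_close v)
      also have "\<dots> = bp_int (h n j) (v n j) + (modulus m (v n j) + 1 / real N)"
        unfolding sum.distrib sum_distrib_right[symmetric] R_def by (simp add: sum_cell v)
      finally show ?thesis .
    qed
    then have "(LINT j|J n. (\<Sum>r\<in>R. ?c r (v n j) * bp_int (h n j) (?s r))) \<le>
        (LINT j|J n. bp_int (h n j) (v n j) + (modulus m (v n j) + 1 / real N))"
      by (intro integral_mono) auto
    also have "\<dots> = (LINT j|J n. bp_int (h n j) (v n j)) + (LINT j|J n. modulus m (v n j)) + 1 / real N"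
      by (simp add: J.prob_space)
    also have "(LINT j|J n. (\<Sum>r\<in>R. ?c r (v n j) * bp_int (h n j) (?s r))) = (\<Sum>r\<in>R. d n r * bp_int (\<nu> n r) (?s r))"
      by (simp add: \<nu> Bochner_Integration.integral_sum)
    finally have 2: "(\<Sum>r\<in>R. d n r * bp_int (\<nu> n r) (?s r)) \<le>
      (LINT j|J n. bp_int (h n j) (v n j)) + (LINT j|J n. modulus m (v n j)) + 1 / real N" .
    have "\<bar>(\<Sum>r\<in>R. c r * bp_int (\<nu> n r) (?s r)) - (\<Sum>r\<in>R. d n r * bp_int (\<nu> n r) (?s r))\<bar> \<le> \<delta> n * 1"
      by (rule near) (simp add: R_def norm_step_le)
    with 1 2 show ?thesis by (simp add: field_simps abs_le_iff)
  qed
  have "(\<lambda>n. \<delta> n + (LINT j|J n. bp_int (h n j) (v n j)) +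
      (LINT j|J n. modulus m (v n j)) + (LINT i|M. modulus m (w i)) + 2 / real N) \<longlonglongrightarrow>
      0 + 0 + (LINT i|M. modulus m (w i)) + (LINT i|M. modulus m (w i)) + 2 / real N"
    by (intro tendsto_intros \<delta> zero conv continuous_on_modulus modulus_bounds)
  moreover have "0 + 0 + (LINT i|M. modulus m (w i)) + (LINT i|M. modulus m (w i)) + 2 / real N < e"
    using m N(2) \<open>e > 0\<close> by (simp add: field_simps)
  ultimately have "\<forall>\<^sub>F n in sequentially. \<delta> n + (LINT j|J n. bp_int (h n j) (v n j)) +
      (LINT j|J n. modulus m (v n j)) + (LINT i|M. modulus m (w i)) + 2 / real N < e"
    by (rule order_tendstoD)
  moreover have "\<forall>\<^sub>F n in sequentially. \<forall>f\<in>T. \<bar>(LINT i|M. bp_int (g n i) f) - bp_int \<tau> f\<bar> < e"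
  proof (intro eventually_ball_finite \<open>finite T\<close> ballI)
    fix f
    have "(\<lambda>n. \<delta> n * norm f + \<bar>(LINT j|J n. bp_int (h n j) f) - bp_int \<tau> f\<bar>) \<longlonglongrightarrow>
        0 * norm f + \<bar>bp_int \<tau> f - bp_int \<tau> f\<bar>"
      by (intro tendsto_intros \<delta> summary)
    then have "\<forall>\<^sub>F n in sequentially. \<delta> n * norm f + \<bar>(LINT j|J n. bp_int (h n j) f) - bp_int \<tau> f\<bar> < e"
      by (rule order_tendstoD) (use \<open>e > 0\<close> in simp)
    then show "\<forall>\<^sub>F n in sequentially. \<bar>(LINT i|M. bp_int (g n i) f) - bp_int \<tau> f\<bar> < e"
    proof eventually_elim
      case (elim n)
      then show ?case using marginal[of n f] by linarith
    qed
  qed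
  ultimately have "\<forall>\<^sub>F n in sequentially. (LINT i|M. bp_int (g n i) (w i)) < e \<and>
      (\<forall>f\<in>T. \<bar>(LINT i|M. bp_int (g n i) f) - bp_int \<tau> f\<bar> < e)"
    by eventually_elim (use cost in \<open>auto intro: le_less_trans\<close>)
  then obtain n where "(LINT i|M. bp_int (g n i) (w i)) < e"
      "\<forall>f\<in>T. \<bar>(LINT i|M. bp_int (g n i) f) - bp_int \<tau> f\<bar> < e"
    by (auto simp: eventually_sequentially)
  then show ?thesis using g_meas by blast
qed

text \<open>Approximate solutions form nested sets closed under midpoints, so a sequence of
  increasingly exact ones converges for almost every player. Dominated convergence carries both
  linear conditions to the limit, and a nonnegative regret with integral 0 vanishes almost
  everywhere.\<close>

theorem limit_kernel:
  fixes w :: "'i \<Rightarrow> 'a \<Rightarrow>\<^sub>C real" and v :: "nat \<Rightarrow> 'j \<Rightarrow> 'a \<Rightarrow>\<^sub>C real" and h :: "nat \<Rightarrow> 'j \<Rightarrow> 'a borel_prob"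
  assumes "prob_space M" and w_meas [measurable]: "w \<in> borel_measurable M"
    and w: "\<And>i k. 0 \<le> w i k" "\<And>i k. w i k \<le> 1"
    and "\<And>n. prob_space (J n)" "\<And>n. v n \<in> borel_measurable (J n)"
      "\<And>n j k. 0 \<le> v n j k" "\<And>n j k. v n j k \<le> 1" "\<And>n. h n \<in> borel_measurable (J n)"
    and "\<And>\<Phi> :: ('a \<Rightarrow>\<^sub>C real) \<Rightarrow> real. continuous_on UNIV \<Phi> \<Longrightarrow> (\<And>x. 0 \<le> \<Phi> x) \<Longrightarrow> (\<And>x. \<Phi> x \<le> 1) \<Longrightarrow>
      (\<lambda>n. LINT j|J n. \<Phi> (v n j)) \<longlonglongrightarrow> (LINT i|M. \<Phi> (w i))"
    and "\<And>f. (\<lambda>n. LINT j|J n. bp_int (h n j) f) \<longlonglongrightarrow> bp_int \<tau> f"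
    and "(\<lambda>n. LINT j|J n. bp_int (h n j) (v n j)) \<longlonglongrightarrow> 0"
  shows "\<exists>g\<in>borel_measurable M. societal_summary M g = \<tau> \<and> (AE i in M. bp_int (g i) (w i) = 0)"
proof -
  interpret M: prob_space M by fact
  have [measurable]: "(\<lambda>i. w i k) \<in> borel_measurable M" for k
    using measurable_compose[OF w_meas borel_measurable_continuous_onI[OF continuous_on_bcontfun_eval]] .
  have norm_w: "norm (w i) \<le> 1" for i using w by (intro norm_bound) (simp add: abs_of_nonneg)
  have meas_gw: "(\<lambda>i. bp_int (g i) (w i)) \<in> borel_measurable M" if "g \<in> borel_measurable M" for g
    by (rule measurable_bp_int_param[OF compact_UNIV that]) auto
  have int_gw: "integrable M (\<lambda>i. bp_int (g i) (w i))" if "g \<in> borel_measurable M" for g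
    using order_trans[OF abs_bp_int_le norm_w] meas_gw[OF that] by (intro M.integrable_const_bound[where B=1]) auto
  have int_gf: "integrable M (\<lambda>i. bp_int (g i) f)" if "g \<in> borel_measurable M" for g f
    using integrable_bp_int[OF M.finite_measure_axioms that] .
  \<comment> \<open>Only the first \<open>n\<close> test functions are constrained, up to 1/(n+1):
    finitely many conditions with positive tolerance are within reach of
    \<open>approximate_transfer\<close>. More functions and smaller tolerances make the sets
    shrink.\<close>
  define K where "K n = {g \<in> borel_measurable M. (\<forall>j<n. \<bar>(LINT i|M. bp_int (g i) (test j)) - bp_int \<tau> (test j)\<bar> \<le> 1 / real (Suc n)) \<and>
    (LINT i|M. bp_int (g i) (w i)) \<le> 1 / real (Suc n)}" for n
  have "\<exists>g g\<^sub>0. (\<forall>k. g k \<in> K k) \<and> g\<^sub>0 \<in> borel_measurable M \<and>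
    (AE i in M. \<forall>f. (\<lambda>k. bp_int (g k i) f) \<longlonglongrightarrow> bp_int (g\<^sub>0 i) f)"
  proof (rule convergent_kernels[OF compact_UNIV \<open>prob_space M\<close>])
    show "K n \<subseteq> borel_measurable M" for n by (auto simp: K_def)
    show "K n \<noteq> {}" for n
    proof -
      have "\<exists>g\<in>borel_measurable M. (\<forall>f\<in>test ` {..<n}. \<bar>(LINT i|M. bp_int (g i) f) - bp_int \<tau> f\<bar> < 1 / real (Suc n)) \<and>
        (LINT i|M. bp_int (g i) (w i)) < 1 / real (Suc n)"
        by (rule approximate_transfer[OF assms]) auto
      then obtain g where g: "g \<in> borel_measurable M"
        "\<forall>f\<in>test ` {..<n}. \<bar>(LINT i|M. bp_int (g i) f) - bp_int \<tau> f\<bar> < 1 / real (Suc n)"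
        "(LINT i|M. bp_int (g i) (w i)) < 1 / real (Suc n)" by blast
      then have "g \<in> K n" unfolding K_def by (auto intro: less_imp_le)
      then show ?thesis by blast
    qed
    show "K n \<subseteq> K m" if "m \<le> n" for m n
    proof -
      have "1 / real (Suc n) \<le> 1 / real (Suc m)" using that by (simp add: frac_le)
      then have le: "x \<le> 1 / real (Suc m)" if "x \<le> 1 / real (Suc n)" for x using that by linarith
      show ?thesis unfolding K_def using \<open>m \<le> n\<close> le by (auto simp del: of_nat_Suc)
    qed
    fix n g h m
    assume gh: "g \<in> K n" "h \<in> K n" and m: "m \<in> borel_measurable M"
      "\<And>i f. bp_int (m i) f = (bp_int (g i) f + bp_int (h i) f) / 2"
    have gh': "g \<in> borel_measurable M" "h \<in> borel_measurable M" using gh by (auto simp: K_def)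
    have mean: "(LINT i|M. bp_int (m i) f) = ((LINT i|M. bp_int (g i) f) + (LINT i|M. bp_int (h i) f)) / 2" for f
      unfolding m(2) by (simp add: int_gf gh')
    have "\<bar>(a + b) / 2 - t\<bar> \<le> e" if "\<bar>a - t\<bar> \<le> e" "\<bar>b - t\<bar> \<le> e" for a b t e :: real
      using that by (simp add: abs_le_iff field_simps)
    then have "\<bar>(LINT i|M. bp_int (m i) (test j)) - bp_int \<tau> (test j)\<bar> \<le> 1 / real (Suc n)" if "j < n" for j
      unfolding mean using gh that by (simp add: K_def)
    moreover have "(LINT i|M. bp_int (m i) (w i)) = ((LINT i|M. bp_int (g i) (w i)) + (LINT i|M. bp_int (h i) (w i))) / 2"
      unfolding m(2) by (simp add: int_gw gh')
    then have "(LINT i|M. bp_int (m i) (w i)) \<le> 1 / real (Suc n)"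
      using gh unfolding K_def by auto
    ultimately show "m \<in> K n" using m(1) unfolding K_def by simp
  qed
  then obtain g g0 where g: "\<And>k. g k \<in> K k" and g0: "g0 \<in> borel_measurable M"
    and lim: "AE i in M. \<forall>f. (\<lambda>k. bp_int (g k i) f) \<longlonglongrightarrow> bp_int (g0 i) f" by blast
  have g': "g k \<in> borel_measurable M" for k using g[of k] by (simp add: K_def)
  have lim_f: "(\<lambda>k. LINT i|M. bp_int (g k i) f) \<longlonglongrightarrow> (LINT i|M. bp_int (g0 i) f)" for f
    using lim by (intro integral_dominated_convergence[where w="\<lambda>_. norm f"] measurable_bp_int g0 g')
      (auto simp: abs_bp_int_le elim: eventually_mono)
  have lim_w: "(\<lambda>k. LINT i|M. bp_int (g k i) (w i)) \<longlonglongrightarrow> (LINT i|M. bp_int (g0 i) (w i))"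
    using lim order_trans[OF abs_bp_int_le norm_w]
    by (intro integral_dominated_convergence[where w="\<lambda>_. 1"] meas_gw g0 g')
      (auto elim: eventually_mono)
  have inv0: "(\<lambda>k. 1 / real (Suc k)) \<longlonglongrightarrow> 0" using LIMSEQ_inverse_real_of_nat by (simp only: inverse_eq_divide)
  have "(\<lambda>k. LINT i|M. bp_int (g k i) f) \<longlonglongrightarrow> bp_int \<tau> f" for f
  proof (rule bp_int_tendstoI[OF compact_UNIV])
    fix m and k :: 'a assume "k \<in> net m"
    then obtain j where j: "test j = pu m k" using ex_test[OF compact_UNIV] by blast
    show "(\<lambda>n. LINT i|M. bp_int (g n i) (pu m k)) \<longlonglongrightarrow> bp_int \<tau> (pu m k)"
      unfolding j[symmetric]
    proof (rule LIM_zero_cancel, rule Lim_null_comparison[OF _ inv0])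
      show "\<forall>\<^sub>F n in sequentially. norm ((LINT i|M. bp_int (g n i) (test j)) - bp_int \<tau> (test j)) \<le> 1 / real (Suc n)"
        using eventually_gt_at_top[of j] by eventually_elim (use g in \<open>auto simp: K_def\<close>)
    qed
  next
    fix n and f :: "'a \<Rightarrow>\<^sub>C real"
    have "\<bar>LINT i|M. bp_int (g n i) f\<bar> \<le> (LINT i|M. \<bar>bp_int (g n i) f\<bar>)" by (rule integral_abs_bound)
    also have "\<dots> \<le> norm f"
      by (intro M.integral_le_const integrable_abs int_gf g') (simp add: abs_bp_int_le)
    finally show "\<bar>LINT i|M. bp_int (g n i) f\<bar> \<le> norm f" .
  qed (simp_all add: bp_int_add bp_int_scaleR int_gf g')
  then have "(LINT i|M. bp_int (g0 i) f) = bp_int \<tau> f" for f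
    using lim_f LIMSEQ_unique by blast
  then have "societal_summary M g0 = \<tau>"
    by (intro bp_eqI) (simp add: bp_int_societal_summary[OF \<open>prob_space M\<close> g0])
  moreover have "(LINT i|M. bp_int (g0 i) (w i)) \<le> 0"
    by (rule LIMSEQ_le[OF lim_w inv0]) (use g in \<open>auto simp: K_def\<close>)
  moreover have nonneg: "0 \<le> bp_int (g0 i) (w i)" for i by (rule bp_int_nonneg) (rule w)
  ultimately have "AE i in M. bp_int (g0 i) (w i) = 0"
    using integral_nonneg_eq_0_iff_AE[OF int_gw[OF g0]] integral_nonneg_AE[OF AE_I2[of M "\<lambda>i. 0 \<le> bp_int (g0 i) (w i)", OF nonneg]]
    by (auto intro: antisym)
  with \<open>societal_summary M g0 = \<tau>\<close> g0 show ?thesis by blast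
qed

end

section \<open>Integrals of vanishing equi-Lipschitz functions\<close>

text \<open>Exchanging the two points gives the other side of the estimate; \<bar>L\<bar> + 1 serves
  as a positive constant for every real \<open>L\<close>.\<close>

lemma continuous_on_one_sided_Lipschitz:
  fixes f :: "'b::metric_space \<Rightarrow> real"
  assumes f: "\<And>a b. f a \<le> f b + L * dist a b"
  shows "continuous_on UNIV f"
  unfolding continuous_on_iff
proof safe
  fix a :: 'b and e :: real assume "e > 0"
  have "dist (f b) (f a) < e" if "dist b a < e / (\<bar>L\<bar> + 1)" for b
  proof -
    have "dist b a * (\<bar>L\<bar> + 1) < e" using that by (simp add: pos_less_divide_eq)
    moreover have "L * dist b a \<le> dist b a * (\<bar>L\<bar> + 1)"
      using mult_right_mono[of L "\<bar>L\<bar> + 1" "dist b a"] by (simp add: mult.commute)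
    ultimately show ?thesis using f[of a b] f[of b a] by (simp add: dist_real_def dist_commute abs_less_iff)
  qed
  then show "\<exists>d>0. \<forall>b\<in>UNIV. dist b a < d \<longrightarrow> dist (f b) (f a) < e"
    using \<open>e > 0\<close> by (intro exI[of _ "e / (\<bar>L\<bar> + 1)"]) auto
qed

text \<open>The decreasing envelopes \<open>SUP n\<ge>m. min 1 (F n x)\<close> are continuous, which replaces tightness of
  the laws.\<close>

lemma integral_equi_Lipschitz_tendsto_0:
  fixes x :: "'i \<Rightarrow> 'b::metric_space" and y :: "nat \<Rightarrow> 'j \<Rightarrow> 'b" and F :: "nat \<Rightarrow> 'b \<Rightarrow> real"
  assumes "prob_space M" and x_meas: "x \<in> borel_measurable M"
    and "\<And>n. prob_space (J n)" and y_meas: "\<And>n. y n \<in> borel_measurable (J n)"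
    and conv: "\<And>\<Phi> :: 'b \<Rightarrow> real. continuous_on UNIV \<Phi> \<Longrightarrow> (\<And>x. 0 \<le> \<Phi> x) \<Longrightarrow> (\<And>x. \<Phi> x \<le> 1) \<Longrightarrow>
      (\<lambda>n. LINT j|J n. \<Phi> (y n j)) \<longlonglongrightarrow> (LINT i|M. \<Phi> (x i))"
    and F: "\<And>n a. 0 \<le> F n a" "\<And>n a b. F n a \<le> F n b + L * dist a b" "\<And>a. (\<lambda>n. F n a) \<longlonglongrightarrow> 0"
  shows "(\<lambda>n. LINT j|J n. min 1 (F n (y n j))) \<longlonglongrightarrow> 0"
proof -
  interpret M: prob_space M by fact
  interpret J: prob_space "J n" for n by fact
  \<comment> \<open>Going from \<open>a\<close> to \<open>b\<close> and back bounds
    \<open>F 0 a\<close> by itself plus twice this term, whatever the sign of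
    \<open>L\<close>.\<close>
  have L: "0 \<le> L * dist a b" for a b :: 'b
  proof -
    have "F 0 a \<le> (F 0 a + L * dist b a) + L * dist a b" using F(2)[of 0 a b] F(2)[of 0 b a] by linarith
    then show ?thesis by (simp add: dist_commute)
  qed
  have min_lip: "min 1 (F n a) \<le> min 1 (F n b) + L * dist a b" for n a b
    using F(2)[of n a b] L[of a b] by linarith
  \<comment> \<open>A supremum of functions with a common Lipschitz bound keeps that bound, which is
    the source of continuity. The truncation keeps the values in [0,1], as \<open>conv\<close>
    demands.\<close>
  define \<Psi> where "\<Psi> m a = (SUP n\<in>{m..}. min 1 (F n a))" for m a
  have bdd: "bdd_above ((\<lambda>n. min 1 (F n a)) ` {m..})" for m a by (rule bdd_aboveI[of _ 1]) auto
  have upper: "min 1 (F n a) \<le> \<Psi> m a" if "m \<le> n" for m n a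
    unfolding \<Psi>_def by (rule cSUP_upper[OF _ bdd]) (use that in simp)
  have least: "\<Psi> m a \<le> z" if "\<And>n. m \<le> n \<Longrightarrow> min 1 (F n a) \<le> z" for m a z
    unfolding \<Psi>_def by (rule cSUP_least) (use that in auto)
  have \<Psi>01: "0 \<le> \<Psi> m a" "\<Psi> m a \<le> 1" for m a
    using upper[of m m a] F(1)[of m a] by (auto intro: least)
  have "\<Psi> m a \<le> \<Psi> m b + L * dist a b" for m a b
    using min_lip upper by (intro least) (smt (verit))
  then have cont: "continuous_on UNIV (\<Psi> m)" for m by (rule continuous_on_one_sided_Lipschitz)
  have "(\<lambda>m. \<Psi> m a) \<longlonglongrightarrow> 0" for a
  proof (rule LIMSEQ_I)
    fix e :: real assume "e > 0"
    then obtain N where N: "\<And>n. n \<ge> N \<Longrightarrow> F n a < e / 2"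
      using order_tendstoD(2)[OF F(3)[of a], of "e / 2"] by (auto simp: eventually_sequentially)
    have "\<Psi> m a \<le> e / 2" if "m \<ge> N" for m
    proof (rule least)
      fix n assume "m \<le> n"
      then show "min 1 (F n a) \<le> e / 2" using N[of n] that by simp
    qed
    then have "norm (\<Psi> m a - 0) < e" if "m \<ge> N" for m
      using that \<open>e > 0\<close> \<Psi>01(1)[of m a] by fastforce
    then show "\<exists>N. \<forall>m\<ge>N. norm (\<Psi> m a - 0) < e" by blast
  qed
  moreover have [measurable]: "(\<lambda>i. \<Psi> m (x i)) \<in> borel_measurable M" for m
    by (rule measurable_compose[OF x_meas borel_measurable_continuous_onI[OF cont]])
  ultimately have lim: "(\<lambda>m. LINT i|M. \<Psi> m (x i)) \<longlonglongrightarrow> (LINT i|M. 0)"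
    by (intro integral_dominated_convergence[where w="\<lambda>_. 1"]) (auto simp: \<Psi>01)
  have [measurable]: "(\<lambda>j. \<Psi> m (y n j)) \<in> borel_measurable (J n)" for m n
    by (rule measurable_compose[OF y_meas borel_measurable_continuous_onI[OF cont]])
  have [measurable]: "(\<lambda>j. min 1 (F n (y n j))) \<in> borel_measurable (J n)" for n
    by (rule measurable_compose[OF y_meas borel_measurable_continuous_onI[OF continuous_on_one_sided_Lipschitz[OF min_lip]]])
  have [simp]: "integrable (J n) (\<lambda>j. min 1 (F n (y n j)))" for n
    using F(1) by (intro J.integrable_const_bound[where B=1]) auto
  have [simp]: "integrable (J n) (\<lambda>j. \<Psi> m (y n j))" for m n
    using \<Psi>01 by (intro J.integrable_const_bound[where B=1]) auto
  show ?thesis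
  proof (rule LIMSEQ_I)
    fix e :: real assume "e > 0"
    \<comment> \<open>A single envelope with small limit integral is fixed first; convergence for
      this one function then bounds the integrals of all later \<open>F n\<close>.\<close>
    then obtain m where m: "(LINT i|M. \<Psi> m (x i)) < e"
      using order_tendstoD(2)[OF lim, of e] by (auto simp: eventually_sequentially)
    have "\<forall>\<^sub>F n in sequentially. (LINT j|J n. \<Psi> m (y n j)) < e"
      by (rule order_tendstoD(2)[OF conv[OF cont \<Psi>01] m])
    then have "\<forall>\<^sub>F n in sequentially. norm ((LINT j|J n. min 1 (F n (y n j))) - 0) < e"
      using eventually_ge_at_top[of m]
    proof eventually_elim
      case (elim n)
      have "(LINT j|J n. min 1 (F n (y n j))) \<le> (LINT j|J n. \<Psi> m (y n j))"
        by (intro integral_mono upper elim) auto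
      moreover have "0 \<le> (LINT j|J n. min 1 (F n (y n j)))"
        by (intro integral_nonneg_AE) (simp add: F(1))
      ultimately show ?case using elim by simp
    qed
    then show "\<exists>N. \<forall>n\<ge>N. norm ((LINT j|J n. min 1 (F n (y n j))) - 0) < e"
      by (simp add: eventually_sequentially)
  qed
qed

section \<open>Regret\<close>

definition slice :: "(('a::topological_space \<times> 'b::topological_space) \<Rightarrow>\<^sub>C real) \<Rightarrow> 'b \<Rightarrow> 'a \<Rightarrow>\<^sub>C real" where
  "slice u \<tau> = Bcontfun (\<lambda>a. u (a, \<tau>))"

lemma slice_apply [simp]: "slice u \<tau> a = u (a, \<tau>)"
proof -
  have "(\<lambda>a. u (a, \<tau>)) \<in> bcontfun"
  proof (rule bcontfun_normI)
    show "continuous_on UNIV (\<lambda>a. u (a, \<tau>))"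
      by (rule continuous_on_compose2[OF continuous_on_apply_bcontfun[of UNIV]]) (auto intro!: continuous_intros)
    show "norm (u (a, \<tau>)) \<le> norm u" for a by (rule norm_bounded)
  qed
  then show ?thesis by (simp add: slice_def Bcontfun_inverse)
qed

lemma slice_diff: "slice (u - v) \<tau> = slice u \<tau> - slice v \<tau>"
  by (rule bcontfun_eqI) simp

lemma norm_slice_le: "norm (slice u \<tau>) \<le> norm u"
  by (rule norm_bound) (simp add: abs_bcontfun_le)

lemma continuous_on_slice:
  fixes S :: "(('a::topological_space \<times> 'b::topological_space) \<Rightarrow>\<^sub>C real) set"
  shows "continuous_on S (\<lambda>u. slice u \<tau>)"
  unfolding continuous_on_iff
proof (intro ballI allI impI)
  fix u :: "('a \<times> 'b) \<Rightarrow>\<^sub>C real" and e :: real assume "e > 0"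
  have "dist (slice v \<tau>) (slice u \<tau>) \<le> dist v u" for v :: "('a \<times> 'b) \<Rightarrow>\<^sub>C real"
    unfolding dist_norm slice_diff[symmetric] by (rule norm_slice_le)
  then show "\<exists>d>0. \<forall>v\<in>S. dist v u < d \<longrightarrow> dist (slice v \<tau>) (slice u \<tau>) < e"
    using \<open>e > 0\<close> by (intro exI[of _ e]) (auto intro: le_less_trans)
qed

definition best :: "'a::metric_space compact_ne \<Rightarrow> ('a \<Rightarrow>\<^sub>C real) \<Rightarrow> real" where
  "best K v = (SUP b\<in>cset K. v b)"

text \<open>It vanishes exactly at the maximizers of \<open>v\<close> over \<open>K\<close>. The
  distance term penalizes infeasible actions, which may well beat the best feasible value; hence
  also the positive part.\<close>

definition regret :: "'a::metric_space compact_ne \<Rightarrow> ('a \<Rightarrow>\<^sub>C real) \<Rightarrow> 'a \<Rightarrow>\<^sub>C real" where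
  "regret K v = Bcontfun (\<lambda>a. min 1 (infdist a (cset K) + max 0 (best K v - v a)))"

lemma regret_apply: "regret K v a = min 1 (infdist a (cset K) + max 0 (best K v - v a))"
proof -
  have "(\<lambda>a. min 1 (infdist a (cset K) + max 0 (best K v - v a))) \<in> bcontfun"
  proof (rule bcontfun_normI[where b=1])
    show "continuous_on UNIV (\<lambda>a. min 1 (infdist a (cset K) + max 0 (best K v - v a)))"
      by (intro continuous_intros) simp
    show "norm (min 1 (infdist a (cset K) + max 0 (best K v - v a))) \<le> 1" for a
      using infdist_nonneg[of a "cset K"] by auto
  qed
  then show ?thesis by (simp add: regret_def Bcontfun_inverse)
qed

lemma regret_bounds: "0 \<le> regret K v a" "regret K v a \<le> 1"
  using infdist_nonneg[of a "cset K"] by (auto simp: regret_apply)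

lemma le_best: "b \<in> cset K \<Longrightarrow> apply_bcontfun v b \<le> best K v"
  unfolding best_def
  by (rule cSUP_upper) (auto intro!: bdd_aboveI[of _ "norm v"] abs_le_D1[OF abs_bcontfun_le])

lemma best_attained: "\<exists>b\<in>cset K. apply_bcontfun v b = best K v"
proof -
  obtain b where b: "b \<in> cset K" "\<And>c. c \<in> cset K \<Longrightarrow> v c \<le> v b"
    using continuous_attains_sup[of "cset K" "apply_bcontfun v"] by auto
  then have "best K v \<le> v b" unfolding best_def by (intro cSUP_least) auto
  then show ?thesis using le_best[OF b(1), of v] b(1) by force
qed

lemma infdist_le_dist_compact_ne: "x \<in> cset K \<Longrightarrow> infdist x (cset L) \<le> dist K L"
  unfolding dist_compact_ne_def by (rule max.coboundedI1, rule cSUP_upper[OF _ bdd_above_infdist_cset])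

lemma infdist_cset_le: "infdist a (cset K) \<le> infdist a (cset L) + dist K L"
proof -
  have "infdist a (cset K) - dist K L \<le> dist a y" if "y \<in> cset L" for y
    using infdist_triangle[of a "cset K" y] infdist_le_dist_compact_ne[OF that, of K] by (simp add: dist_commute)
  then have "infdist a (cset K) - dist K L \<le> infdist a (cset L)"
    unfolding infdist_notempty[OF cset_nonempty[of L]] by (intro cINF_greatest) auto
  then show ?thesis by simp
qed

lemma best_mono_norm: "best K v \<le> best K w + norm (v - w)"
proof -
  obtain b where "b \<in> cset K" "v b = best K v" using best_attained by metis
  then show ?thesis using le_best[of b K w] abs_bcontfun_le[of "v - w" b] by auto
qed

context
  assumes compact_UNIV: "compact (UNIV :: 'a::metric_space set)"
begin

text \<open>Uniform continuity of \<open>v\<close> supplies \<open>d\<close>: a maximizer over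
  \<open>K\<close> has a point of \<open>L\<close> within \<open>d\<close>, where \<open>v\<close>
  is almost as large.\<close>

lemma best_le_best:
  fixes v :: "'a \<Rightarrow>\<^sub>C real"
  assumes "e > 0"
  shows "\<exists>d>0. \<forall>K L. dist K L < d \<longrightarrow> best K v \<le> best L v + e"
proof -
  have "uniformly_continuous_on UNIV (apply_bcontfun v)"
    by (rule compact_uniformly_continuous[OF _ compact_UNIV]) simp
  then obtain d where d: "d > 0" "\<And>x y. dist x y < d \<Longrightarrow> dist (v x) (v y) < e"
    unfolding uniformly_continuous_on_def using \<open>e > 0\<close> by (metis UNIV_I)
  have "best K v \<le> best L v + e" if "dist K L < d" for K L
  proof -
    obtain b where b: "b \<in> cset K" "v b = best K v" using best_attained by metis
    have "infdist b (cset L) < d" using infdist_le_dist_compact_ne[OF b(1), of L] that by simp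
    then have "\<exists>c\<in>cset L. dist b c < d"
      unfolding infdist_notempty[OF cset_nonempty[of L]] by (subst (asm) cINF_less_iff) auto
    then obtain c where c: "c \<in> cset L" "dist b c < d" by blast
    have "v b < v c + e" using d(2)[OF c(2)] by (simp add: dist_real_def abs_less_iff)
    then show ?thesis using le_best[OF c(1), of v] b(2) by linarith
  qed
  then show ?thesis using d(1) by blast
qed

lemma continuous_on_best: "continuous_on UNIV (\<lambda>p. best (fst p) (snd p :: 'a \<Rightarrow>\<^sub>C real))"
  unfolding continuous_on_iff
proof safe
  fix K :: "'a compact_ne" and v :: "'a \<Rightarrow>\<^sub>C real" and e :: real assume "e > 0"
  then obtain d where d: "d > 0" "\<And>K L. dist K L < d \<Longrightarrow> best K v \<le> best L v + e / 4"
    using best_le_best[of "e / 4" v] by auto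
  have "dist (best L w) (best K v) < e" if "dist (L, w) (K, v) < min d (e / 4)" for L w
  proof -
    have "dist L K < d" "norm (w - v) < e / 4"
      using that dist_fst_le[of "(L, w)" "(K, v)"] dist_snd_le[of "(L, w)" "(K, v)"] by (auto simp: dist_norm)
    then show ?thesis
      using d(2)[of L K] d(2)[of K L] best_mono_norm[of L w v] best_mono_norm[of L v w]
      by (simp add: dist_commute norm_minus_commute dist_real_def abs_less_iff)
  qed
  then show "\<exists>d>0. \<forall>p\<in>UNIV. dist p (K, v) < d \<longrightarrow>
      dist (best (fst p) (snd p)) (best (fst (K, v)) (snd (K, v))) < e"
    using d(1) \<open>e > 0\<close> by (intro exI[of _ "min d (e / 4)"]) auto
qed

lemma continuous_on_regret: "continuous_on UNIV (\<lambda>p. regret (fst p) (snd p :: 'a \<Rightarrow>\<^sub>C real))"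
  unfolding continuous_on_def
proof
  fix q :: "'a compact_ne \<times> ('a \<Rightarrow>\<^sub>C real)"
  have "((\<lambda>p. best (fst p) (snd p)) \<longlongrightarrow> best (fst q) (snd q)) (at q within UNIV)"
    using continuous_on_best unfolding continuous_on_def by blast
  then have lim: "((\<lambda>p. dist (fst p) (fst q) + dist (best (fst p) (snd p)) (best (fst q) (snd q)) + dist (snd p) (snd q))
      \<longlongrightarrow> 0 + 0 + 0) (at q within UNIV)"
    by (intro tendsto_add tendsto_dist_iff[THEN iffD1] tendsto_fst tendsto_snd tendsto_ident_at)
  show "((\<lambda>p. regret (fst p) (snd p)) \<longlongrightarrow> regret (fst q) (snd q)) (at q within UNIV)"
  proof (rule tendsto_dist_iff[THEN iffD2], rule Lim_null_comparison)
    show "((\<lambda>p. dist (fst p) (fst q) + dist (best (fst p) (snd p)) (best (fst q) (snd q)) + dist (snd p) (snd q))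
      \<longlongrightarrow> 0) (at q within UNIV)" using lim by simp
    \<comment> \<open>Truncation and positive part do not increase distances, so the three distances
      on the right bound the difference at every action simultaneously.\<close>
    have "dist (regret (fst p) (snd p)) (regret (fst q) (snd q)) \<le>
      dist (fst p) (fst q) + dist (best (fst p) (snd p)) (best (fst q) (snd q)) + dist (snd p) (snd q)" for p
    proof (rule dist_bound)
      fix a
      have "\<bar>infdist a (cset (fst p)) - infdist a (cset (fst q))\<bar> \<le> dist (fst p) (fst q)"
        using infdist_cset_le[of a "fst p" "fst q"] infdist_cset_le[of a "fst q" "fst p"] by (simp add: dist_commute)
      moreover have "\<bar>snd p a - snd q a\<bar> \<le> dist (snd p) (snd q)"
        using dist_bounded[of "snd p" a "snd q"] by (simp add: dist_real_def)
      ultimately show "dist (regret (fst p) (snd p) a) (regret (fst q) (snd q) a) \<le>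
        dist (fst p) (fst q) + dist (best (fst p) (snd p)) (best (fst q) (snd q)) + dist (snd p) (snd q)"
        unfolding regret_apply dist_real_def by linarith
    qed
    then show "\<forall>\<^sub>F p in at q within UNIV. norm (dist (regret (fst p) (snd p)) (regret (fst q) (snd q))) \<le>
      dist (fst p) (fst q) + dist (best (fst p) (snd p)) (best (fst q) (snd q)) + dist (snd p) (snd q)"
      by simp
  qed
qed

text \<open>This continuity carries weak convergence of the laws of the characteristics over to the
  laws of the regret functions at the fixed summary.\<close>

lemma continuous_on_regret_slice:
  "continuous_on UNIV (\<lambda>c :: 'a characteristics. regret (fst c) (slice (snd c) \<tau>))"
proof -
  have "continuous_on UNIV (\<lambda>c :: 'a characteristics. (fst c, slice (snd c) \<tau>))"
    by (intro continuous_on_Pair continuous_on_fst continuous_on_id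
        continuous_on_compose2[OF continuous_on_slice[of UNIV] continuous_on_snd[OF continuous_on_id]]) auto
  from continuous_on_compose2[OF continuous_on_regret this] show ?thesis by simp
qed

end

lemma AE_in_of_measure_1:
  assumes "measure (bp_measure \<mu>) C = 1" "C \<in> sets borel"
  shows "AE a in bp_measure \<mu>. a \<in> C"
proof -
  interpret prob_space "bp_measure \<mu>" by simp
  show ?thesis using prob_eq_1[of C] assms by simp
qed

lemma cset_borel [measurable]: "cset K \<in> sets borel"
  by (simp add: compact_imp_closed)

lemma set_integral_full:
  fixes f :: "'a::metric_space \<Rightarrow>\<^sub>C real"
  assumes "measure (bp_measure \<mu>) (cset K) = 1"
  shows "(LINT a:cset K|bp_measure \<mu>. f a) = bp_int \<mu> f"
  unfolding set_lebesgue_integral_def bp_int_def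
proof (rule integral_cong_AE)
  show "AE a in bp_measure \<mu>. indicat_real (cset K) a *\<^sub>R f a = f a"
    using AE_in_of_measure_1[OF assms cset_borel] by eventually_elim simp
qed measurable

lemma bp_int_mono_on:
  fixes f g :: "'a::metric_space \<Rightarrow>\<^sub>C real"
  assumes "measure (bp_measure \<mu>) (cset K) = 1" "\<And>a. a \<in> cset K \<Longrightarrow> f a \<le> g a"
  shows "bp_int \<mu> f \<le> bp_int \<mu> g"
  unfolding bp_int_def
  by (rule integral_mono_AE) (use AE_in_of_measure_1[OF assms(1) cset_borel] assms(2) in \<open>auto elim: eventually_mono\<close>)

lemma bp_int_le_best:
  assumes "measure (bp_measure \<mu>) (cset K) = 1"
  shows "bp_int \<mu> v \<le> best K v"
  using bp_int_mono_on[OF assms, of v "const_bcontfun (best K v)"] by (simp add: le_best)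

text \<open>A nonnegative function with integral 0 vanishes almost surely, and a zero of the regret
  lies in the closed set \<open>K\<close> and attains the best value.\<close>

lemma regret_eq_0D:
  assumes "bp_int \<nu> (regret K v) = 0"
  shows "measure (bp_measure \<nu>) (cset K) = 1" "bp_int \<nu> v = best K v"
proof -
  interpret prob_space "bp_measure \<nu>" by simp
  have "AE a in bp_measure \<nu>. regret K v a = 0"
    using assms regret_bounds by (subst (asm) bp_int_def, subst (asm) integral_nonneg_eq_0_iff_AE) auto
  then have opt: "AE a in bp_measure \<nu>. a \<in> cset K \<and> v a \<ge> best K v"
  proof eventually_elim
    case (elim a)
    then have "infdist a (cset K) = 0" "best K v \<le> v a"
      using infdist_nonneg[of a "cset K"] by (auto simp: regret_apply min_def max_def split: if_splits)
    then show ?case by (simp add: in_closed_iff_infdist_zero compact_imp_closed)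
  qed
  have K: "AE a in bp_measure \<nu>. a \<in> cset K"
    using opt by eventually_elim simp
  have v: "AE a in bp_measure \<nu>. v a = best K v"
    using opt by eventually_elim (meson antisym le_best)
  show "measure (bp_measure \<nu>) (cset K) = 1" using K prob_eq_1[of "cset K"] by simp
  have "bp_int \<nu> v = (LINT a|bp_measure \<nu>. best K v)"
    unfolding bp_int_def by (rule integral_cong_AE) (use v in auto)
  then show "bp_int \<nu> v = best K v" using prob_space by simp
qed

text \<open>On \<open>K\<close> the regret is at most \<open>best K v - v\<close>, whose integral is
  the gain from a best pure deviation. Pure deviations are therefore the only ones that have to be
  tested.\<close>

lemma regret_le:
  fixes v :: "'a::metric_space \<Rightarrow>\<^sub>C real"
  assumes K: "measure (bp_measure \<nu>) (cset K) = 1" and e: "\<And>b. b \<in> cset K \<Longrightarrow> v b - bp_int \<nu> v \<le> e"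
  shows "bp_int \<nu> (regret K v) \<le> min 1 e"
proof -
  obtain b where b: "b \<in> cset K" "v b = best K v" using best_attained by metis
  have "bp_int \<nu> (regret K v) \<le> bp_int \<nu> (const_bcontfun (best K v) - v)"
    by (rule bp_int_mono_on[OF K]) (auto simp: regret_apply le_best)
  also have "\<dots> \<le> e"
    using e[OF b(1)] b(2) by (simp add: bp_int_diff)
  finally have "bp_int \<nu> (regret K v) \<le> e" .
  moreover have "bp_int \<nu> (regret K v) \<le> bp_int \<nu> (const_bcontfun 1)"
    by (rule bp_int_mono) (simp add: regret_bounds)
  ultimately show ?thesis by simp
qed

section \<open>Uniform continuity in the societal summary\<close>

text \<open>Concentration estimates concern one test function at a time; this form reduces a weak
  neighbourhood to finitely many of them.\<close>

lemma borel_prob_nbhd: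
  fixes S :: "'a::topological_space borel_prob set"
  assumes "open S" "\<tau> \<in> S"
  shows "\<exists>T d. finite T \<and> d > 0 \<and> (\<forall>\<sigma>. (\<forall>f\<in>T. \<bar>bp_int \<sigma> f - bp_int \<tau> f\<bar> < d) \<longrightarrow> \<sigma> \<in> S)"
  using assms unfolding open_borel_prob_def
proof (induction rule: generate_topology.induct)
  case UNIV
  show ?case by (intro exI[of _ "{}"] exI[of _ 1]) auto
next
  case (Int a b)
  then have \<tau>: "\<tau> \<in> a" "\<tau> \<in> b" by auto
  obtain T d where "finite T" "d > 0" "\<forall>\<sigma>. (\<forall>f\<in>T. \<bar>bp_int \<sigma> f - bp_int \<tau> f\<bar> < d) \<longrightarrow> \<sigma> \<in> a"
    using Int.IH(1)[OF \<tau>(1)] by blast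
  moreover obtain T' d' where "finite T'" "d' > 0" "\<forall>\<sigma>. (\<forall>f\<in>T'. \<bar>bp_int \<sigma> f - bp_int \<tau> f\<bar> < d') \<longrightarrow> \<sigma> \<in> b"
    using Int.IH(2)[OF \<tau>(2)] by blast
  ultimately show ?case by (intro exI[of _ "T \<union> T'"] exI[of _ "min d d'"]) auto
next
  case (UN K)
  then obtain k where "k \<in> K" "\<tau> \<in> k" by blast
  with UN(2)[OF this] show ?case by (meson UnionI)
next
  case (Basis s)
  then obtain f U where s: "s = {\<mu>. bp_int \<mu> f \<in> U}" and "open U" unfolding bp_int_def by auto
  then obtain d where "d > 0" "ball (bp_int \<tau> f) d \<subseteq> U" using Basis openE by blast
  then show ?case
    by (intro exI[of _ "{f}"] exI[of _ d]) (auto simp: s dist_real_def abs_minus_commute)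
qed

text \<open>A tube argument: finitely many product neighbourhoods cover the compact action space at
  \<tau>. In each of them both \<open>u (x, \<sigma>)\<close> and \<open>u (x, \<tau>)\<close> lie
  within e/2 of the value at the centre.\<close>

lemma slice_nbhd:
  fixes u :: "('a::metric_space \<times> 'a borel_prob) \<Rightarrow>\<^sub>C real"
  assumes "compact (UNIV :: 'a set)" "e > 0"
  shows "\<exists>T d. finite T \<and> d > 0 \<and> (\<forall>\<sigma>. (\<forall>f\<in>T. \<bar>bp_int \<sigma> f - bp_int \<tau> f\<bar> < d) \<longrightarrow>
    norm (slice u \<sigma> - slice u \<tau>) \<le> e)"
proof -
  have "\<exists>V S. open V \<and> open S \<and> c \<in> V \<and> \<tau> \<in> S \<and> (\<forall>x\<in>V. \<forall>\<sigma>\<in>S. \<bar>u (x, \<sigma>) - u (c, \<tau>)\<bar> < e / 2)" for c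
  proof -
    have "open (apply_bcontfun u -` ball (u (c, \<tau>)) (e / 2))"
      by (intro open_vimage) auto
    moreover have "(c, \<tau>) \<in> apply_bcontfun u -` ball (u (c, \<tau>)) (e / 2)" using \<open>e > 0\<close> by simp
    ultimately obtain V S where "open V" "open S" "(c, \<tau>) \<in> V \<times> S" "V \<times> S \<subseteq> apply_bcontfun u -` ball (u (c, \<tau>)) (e / 2)"
      by (rule open_prod_elim)
    then show ?thesis
      by (intro exI[of _ V] exI[of _ S]) (auto simp: dist_real_def abs_minus_commute)
  qed
  then obtain V S where VS: "\<And>c. open (V c)" "\<And>c. open (S c)" "\<And>c. c \<in> V c" "\<And>c. \<tau> \<in> S c"
    "\<And>c x \<sigma>. x \<in> V c \<Longrightarrow> \<sigma> \<in> S c \<Longrightarrow> \<bar>u (x, \<sigma>) - u (c, \<tau>)\<bar> < e / 2"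
    by metis
  obtain C where C: "finite C" "UNIV \<subseteq> (\<Union>c\<in>C. V c)"
    using compactE_image[OF assms(1), of UNIV V] VS(1,3) by (metis UNIV_I UN_I subsetI)
  have "open (\<Inter>c\<in>C. S c)" "\<tau> \<in> (\<Inter>c\<in>C. S c)" using C(1) VS by auto
  then obtain T d where T: "finite T" "d > 0" "\<And>\<sigma>. (\<forall>f\<in>T. \<bar>bp_int \<sigma> f - bp_int \<tau> f\<bar> < d) \<Longrightarrow> \<sigma> \<in> (\<Inter>c\<in>C. S c)"
    using borel_prob_nbhd by metis
  have "norm (slice u \<sigma> - slice u \<tau>) \<le> e" if "\<forall>f\<in>T. \<bar>bp_int \<sigma> f - bp_int \<tau> f\<bar> < d" for \<sigma>
  proof (rule norm_bound)
    fix x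
    obtain c where c: "c \<in> C" "x \<in> V c" using C(2) by blast
    then have "\<sigma> \<in> S c" using T(3)[OF that] by blast
    then show "norm (apply_bcontfun (slice u \<sigma> - slice u \<tau>) x) \<le> e"
      using VS(5)[OF c(2), of \<sigma>] VS(5)[OF c(2) VS(4)] unfolding minus_bcontfun.rep_eq slice_apply real_norm_def by linarith
  qed
  with T show ?thesis by blast
qed

section \<open>Finite-player games\<close>

lemma integral_finite_player_space:
  fixes f :: "'i \<Rightarrow> real"
  assumes "finite_player_space n M"
  shows "(LINT j|M. f j) = (\<Sum>j\<in>space M. measure M {j} * f j)"
proof -
  have M: "prob_space M" "finite (space M)" "sets M = Pow (space M)"
    using assms by (auto simp: finite_player_space_def)
  interpret prob_space M by fact
  have "(LINT j|M. f j) = (LINT i|M. (\<Sum>j\<in>space M. f j * indicator {j} i))"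
    by (intro Bochner_Integration.integral_cong)
      (auto simp: indicator_def sum.delta' M(2) if_distrib cong: if_cong)
  also have "\<dots> = (\<Sum>j\<in>space M. f j * measure M {j})"
    by (subst Bochner_Integration.integral_sum) (auto simp: M(3) integrable_indicator_iff emeasure_eq_measure
        intro!: sum.cong integrable_mult_right)
  finally show ?thesis by (simp add: mult.commute)
qed

text \<open>Interpolation in the action variable leaves finite sums of functions of the action times
  functions of the summary, so only separate measurability of the two arguments enters.\<close>

lemma measurable_bcontfun_Pair:
  fixes u :: "('a::metric_space \<times> 'a borel_prob) \<Rightarrow>\<^sub>C real"
  assumes "compact (UNIV :: 'a set)" and [measurable]: "x \<in> borel_measurable M" and \<sigma>: "\<sigma> \<in> borel_measurable M"
  shows "(\<lambda>\<omega>. u (x \<omega>, \<sigma> \<omega>)) \<in> borel_measurable M"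
proof (rule borel_measurable_LIMSEQ_real)
  show "(\<lambda>m. interp m (slice u (\<sigma> \<omega>)) (x \<omega>)) \<longlonglongrightarrow> u (x \<omega>, \<sigma> \<omega>)" for \<omega>
  proof -
    have "((\<lambda>m. apply_bcontfun (interp m (slice u (\<sigma> \<omega>))) (x \<omega>)) \<longlonglongrightarrow> apply_bcontfun (slice u (\<sigma> \<omega>)) (x \<omega>))"
      by (rule continuous_on_tendsto_compose[OF continuous_on_bcontfun_eval[of UNIV] interp_tendsto[OF assms(1)]]) auto
    then show ?thesis by simp
  qed
  have [measurable]: "(\<lambda>\<omega>. u (k, \<sigma> \<omega>)) \<in> borel_measurable M" for k
  proof (rule measurable_compose[OF \<sigma> borel_measurable_continuous_onI])
    show "continuous_on UNIV (\<lambda>\<tau>. u (k, \<tau>))"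
      by (rule continuous_on_compose2[OF continuous_on_apply_bcontfun[of UNIV]]) (auto intro!: continuous_intros)
  qed
  have [measurable]: "(\<lambda>\<omega>. pu m k (x \<omega>)) \<in> borel_measurable M" for m k
    by (rule measurable_compose[OF assms(2) borel_measurable_bcontfun])
  show "(\<lambda>\<omega>. interp m (slice u (\<sigma> \<omega>)) (x \<omega>)) \<in> borel_measurable M" for m
    unfolding interp_apply slice_apply by measurable
qed

section \<open>Independent play and concentration of the realized action distribution\<close>

definition plays :: "'i measure \<Rightarrow> ('i \<Rightarrow> 'a::topological_space borel_prob) \<Rightarrow> ('i \<Rightarrow> 'a) measure" where
  "plays M g = (\<Pi>\<^sub>M j\<in>space M. bp_measure (g j))"

definition realized :: "'i measure \<Rightarrow> ('i \<Rightarrow> 'a::metric_space) \<Rightarrow> 'a borel_prob" where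
  "realized M a = societal_summary M (\<lambda>j. dirac (a j))"

definition deviation :: "'i measure \<Rightarrow> ('i \<Rightarrow> 'a::metric_space borel_prob) \<Rightarrow> 'a borel_prob \<Rightarrow> 'i \<Rightarrow>
    (('a \<times> 'a borel_prob) \<Rightarrow>\<^sub>C real) \<Rightarrow> real" where
  "deviation M g \<tau> i u = (LINT a|plays M g. \<bar>u (a i, realized M a) - u (a i, \<tau>)\<bar>)"

text \<open>The supremum over players leaves a function of the payoff alone, which can be integrated
  against the laws of payoffs. Pure deviations are included because the equilibrium inequality
  compares expected payoffs before and after one.\<close>

definition finite_error :: "'i measure \<Rightarrow> ('i \<Rightarrow> 'a::metric_space borel_prob) \<Rightarrow> 'a borel_prob \<Rightarrow>
    (('a \<times> 'a borel_prob) \<Rightarrow>\<^sub>C real) \<Rightarrow> real" where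
  "finite_error M g \<tau> u =
     (SUP (i, g') \<in> {(i, g'). i \<in> space M \<and> (g' = g \<or> (\<exists>b. g' = g(i := dirac b)))}. deviation M g' \<tau> i u)"

context
  fixes n :: nat and M :: "'i measure"
  assumes M: "finite_player_space n M"
begin

lemma finite_space: "finite (space M)" and sets_M: "sets M = Pow (space M)" and prob_M: "prob_space M"
  using M by (auto simp: finite_player_space_def)

lemma measurable_from_M: "(f :: 'i \<Rightarrow> 'b::topological_space) \<in> borel_measurable M"
  by (auto simp: measurable_def sets_M)

lemma space_M_nonempty: "space M \<noteq> {}"
  using prob_space.not_empty[OF prob_M] .

lemma sum_weights: "(\<Sum>j\<in>space M. measure M {j}) = 1"
  using integral_finite_player_space[OF M, of "\<lambda>_. 1"] prob_space.prob_space[OF prob_M] by simp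

lemma bp_int_summary: "bp_int (societal_summary M g) f = (\<Sum>j\<in>space M. measure M {j} * bp_int (g j) f)"
  unfolding bp_int_societal_summary[OF prob_M measurable_from_M] by (rule integral_finite_player_space[OF M])

lemma bp_int_realized: "bp_int (realized M a) f = (\<Sum>j\<in>space M. measure M {j} * f (a j))"
  unfolding realized_def bp_int_summary by simp

lemma prob_plays: "prob_space (plays M g)"
  unfolding plays_def by (rule prob_space_PiM) simp

lemma space_plays: "space (plays M g) = (\<Pi>\<^sub>E j\<in>space M. UNIV)"
  by (simp add: plays_def space_PiM)

lemma measurable_coordinate: "i \<in> space M \<Longrightarrow> (\<lambda>a. a i) \<in> borel_measurable (plays M g)"
  unfolding plays_def using measurable_component_singleton[of i "space M" "\<lambda>j. bp_measure (g j)"]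
  by (simp cong: measurable_cong_sets)

lemma distr_coordinate: "i \<in> space M \<Longrightarrow> distr (plays M g) borel (\<lambda>a. a i) = bp_measure (g i)"
  unfolding plays_def using distr_PiM_component[of "space M" "\<lambda>j. bp_measure (g j)" i]
  by (simp cong: distr_cong)

lemma integral_coordinate:
  "i \<in> space M \<Longrightarrow> (LINT a|plays M g. apply_bcontfun f (a i)) = bp_int (g i) f"
  unfolding bp_int_def using integral_distr[OF measurable_coordinate, of i "apply_bcontfun f" g]
  by (simp add: distr_coordinate)

lemma indep_coordinates:
  "prob_space.indep_vars (plays M g) (\<lambda>j. bp_measure (g j)) (\<lambda>j a. a j) (space M)"
proof -
  interpret prob_space "plays M g" by (rule prob_plays)
  have "distr (plays M g) (\<Pi>\<^sub>M j\<in>space M. bp_measure (g j)) (\<lambda>a. \<lambda>j\<in>space M. a j) =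
      distr (plays M g) (plays M g) (\<lambda>a. a)"
    by (intro distr_cong) (auto simp: plays_def space_PiM PiE_def extensional_restrict)
  also have "\<dots> = plays M g" by simp
  also have "\<dots> = (\<Pi>\<^sub>M j\<in>space M. distr (plays M g) (bp_measure (g j)) (\<lambda>a. a j))"
    unfolding plays_def by (intro PiM_cong refl distr_PiM_component[symmetric]) auto
  finally show ?thesis
    by (subst indep_vars_iff_distr_eq_PiM') (auto simp: space_M_nonempty plays_def)
qed

text \<open>The summands have ranges of length 2 F times the player's weight. The weights sum to 1
  and are at most \<open>L\<close>, so the sum of squared ranges is at most 4 F^2 L and vanishes
  with \<open>L\<close>.\<close>

lemma law_of_large_numbers:
  assumes L: "\<And>j. j \<in> space M \<Longrightarrow> measure M {j} \<le> L" and "t > 0"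
  shows "measure (plays M g) {a\<in>space (plays M g). t \<le> \<bar>(\<Sum>j\<in>space M. measure M {j} * apply_bcontfun f (a j)) -
    (\<Sum>j\<in>space M. measure M {j} * bp_int (g j) f)\<bar>} \<le> 4 * (norm f + 1)\<^sup>2 * L / t\<^sup>2"
proof -
  interpret P: prob_space "plays M g" by (rule prob_plays)
  \<comment> \<open>Adding 1 keeps the ranges from all degenerating when \<open>f\<close> is zero;
    Hoeffding's bound divides by the sum of their squares.\<close>
  define F where "F = norm f + 1"
  have F: "F > 0" unfolding F_def by (simp add: add_nonneg_pos)
  let ?X = "\<lambda>j a. measure M {j} * apply_bcontfun f (a j)"
  define \<mu> where "\<mu> = (\<Sum>j\<in>space M. P.expectation (?X j))"
  have indep: "P.indep_vars (\<lambda>_. borel) ?X (space M)"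
    by (rule P.indep_vars_compose2[OF indep_coordinates]) measurable
  interpret H: Hoeffding_ineq "plays M g" "space M" ?X "\<lambda>j. - (measure M {j} * F)" "\<lambda>j. measure M {j} * F" \<mu>
  proof unfold_locales
    fix j
    have "\<bar>apply_bcontfun f x\<bar> \<le> F" for x using abs_bcontfun_le[of f x] by (simp add: F_def)
    then have "\<bar>measure M {j} * apply_bcontfun f x\<bar> \<le> measure M {j} * F" for x
      by (simp add: abs_mult mult_left_mono)
    then show "AE a in plays M g. ?X j a \<in> {- (measure M {j} * F)..measure M {j} * F}"
      by (simp add: abs_le_iff minus_le_iff)
  qed (auto simp: finite_space indep \<mu>_def)
  have \<mu>: "\<mu> = (\<Sum>j\<in>space M. measure M {j} * bp_int (g j) f)"
    unfolding \<mu>_def by (intro sum.cong refl) (simp add: integral_coordinate)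
  define S where "S = (\<Sum>j\<in>space M. (measure M {j} * F - - (measure M {j} * F))\<^sup>2)"
  have "\<exists>j\<in>space M. measure M {j} > 0"
  proof (rule ccontr)
    assume "\<not> ?thesis"
    then have "(\<Sum>j\<in>space M. measure M {j}) \<le> 0" by (intro sum_nonpos) force
    then show False using sum_weights by simp
  qed
  then obtain j where j: "j \<in> space M" "measure M {j} > 0" by blast
  have "S > 0"
    unfolding S_def using j F finite_space by (intro sum_pos2[of _ j]) auto
  have "S = (\<Sum>j\<in>space M. 4 * F\<^sup>2 * (measure M {j} * measure M {j}))"
    unfolding S_def by (intro sum.cong) (auto simp: power2_eq_square)
  also have "\<dots> \<le> (\<Sum>j\<in>space M. 4 * F\<^sup>2 * (L * measure M {j}))"
    by (intro sum_mono mult_left_mono mult_right_mono L) auto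
  also have "\<dots> = 4 * F\<^sup>2 * L"
    by (simp add: sum_distrib_left[symmetric] sum_weights)
  finally have S: "S \<le> 4 * F\<^sup>2 * L" .
  have "P.prob {a\<in>space (plays M g). t \<le> \<bar>(\<Sum>j\<in>space M. ?X j a) - \<mu>\<bar>} \<le> 2 * exp (-2 * t\<^sup>2 / S)"
    unfolding S_def by (rule H.Hoeffding_ineq_abs_ge) (use \<open>t > 0\<close> \<open>S > 0\<close> in \<open>auto simp: S_def\<close>)
  also have "\<dots> \<le> 2 * (S / (2 * t\<^sup>2))"
  \<comment> \<open>The exponential bound is weakened by exp(-z) \<le> 1/z to one that is linear in
    \<open>S\<close>, and hence in \<open>L\<close>.\<close>
  proof -
    define z where "z = 2 * t\<^sup>2 / S"
    have z: "z > 0" using \<open>t > 0\<close> \<open>S > 0\<close> by (simp add: z_def)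
    have "exp (- z) \<le> 1 / z"
      using le_imp_inverse_le[of z "exp z"] exp_ge_add_one_self[of z] z by (simp add: exp_minus inverse_eq_divide)
    then show ?thesis by (simp add: z_def)
  qed
  also have "\<dots> = S / t\<^sup>2" by simp
  also have "\<dots> \<le> 4 * F\<^sup>2 * L / t\<^sup>2"
    by (intro divide_right_mono S) simp
  finally show ?thesis by (simp add: \<mu> F_def)
qed

lemma deviation_nonneg: "0 \<le> deviation M g \<tau> i u"
  unfolding deviation_def by (intro integral_nonneg_AE) simp

lemma summary_update_close:
  assumes "i \<in> space M" "measure M {i} \<le> L"
  shows "\<bar>(\<Sum>j\<in>space M. measure M {j} * bp_int ((g(i := \<nu>)) j) f) - (\<Sum>j\<in>space M. measure M {j} * bp_int (g j) f)\<bar>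
    \<le> 2 * L * norm f"
proof -
  have "(\<Sum>j\<in>space M. measure M {j} * bp_int ((g(i := \<nu>)) j) f) - (\<Sum>j\<in>space M. measure M {j} * bp_int (g j) f)
      = (\<Sum>j\<in>space M. if j = i then measure M {i} * (bp_int \<nu> f - bp_int (g i) f) else 0)"
    unfolding sum_subtractf[symmetric] by (intro sum.cong) (auto simp: right_diff_distrib)
  also have "\<dots> = measure M {i} * (bp_int \<nu> f - bp_int (g i) f)"
    using assms(1) finite_space by simp
  also have "\<bar>\<dots>\<bar> \<le> L * (2 * norm f)"
    unfolding abs_mult using abs_bp_int_le[of \<nu> f] abs_bp_int_le[of "g i" f] assms(2)
      order_trans[OF measure_nonneg assms(2)]
    by (intro mult_mono) auto
  finally show ?thesis by simp
qed

context
  assumes compact_UNIV: "compact (UNIV :: 'a::metric_space set)"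
begin

lemma measurable_realized: "(realized M :: ('i \<Rightarrow> 'a) \<Rightarrow> _) \<in> borel_measurable (plays M g)"
proof (rule measurable_borel_probI[OF compact_UNIV])
  fix f :: "'a \<Rightarrow>\<^sub>C real"
  show "(\<lambda>a. bp_int (realized M a) f) \<in> borel_measurable (plays M g)"
    unfolding bp_int_realized
    by (intro borel_measurable_sum borel_measurable_times borel_measurable_const
        measurable_compose[OF measurable_coordinate borel_measurable_bcontfun])
qed

lemma measurable_payoff:
  fixes u :: "('a \<times> 'a borel_prob) \<Rightarrow>\<^sub>C real"
  assumes "i \<in> space M"
  shows "(\<lambda>a. u (a i, realized M a)) \<in> borel_measurable (plays M g)"
    "(\<lambda>a. u (a i, \<tau>)) \<in> borel_measurable (plays M g)"
  by (intro measurable_bcontfun_Pair compact_UNIV measurable_coordinate assms measurable_realized measurable_const; simp)+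

lemma integrable_payoff [simp]:
  fixes u :: "('a \<times> 'a borel_prob) \<Rightarrow>\<^sub>C real"
  assumes "i \<in> space M"
  shows "integrable (plays M g) (\<lambda>a. u (a i, realized M a))"
    "integrable (plays M g) (\<lambda>a. u (a i, \<tau>))"
proof -
  interpret prob_space "plays M g" by (rule prob_plays)
  show "integrable (plays M g) (\<lambda>a. u (a i, realized M a))" "integrable (plays M g) (\<lambda>a. u (a i, \<tau>))"
    by (intro integrable_const_bound[where B="norm u"] measurable_payoff assms; simp add: abs_bcontfun_le)+
qed

text \<open>The factor 2 arises because the payoff enters both at the realized distribution and at
  \<tau>.\<close>

lemma deviation_Lipschitz:
  fixes u v :: "('a \<times> 'a borel_prob) \<Rightarrow>\<^sub>C real"
  assumes "i \<in> space M"
  shows "deviation M g \<tau> i u \<le> deviation M g \<tau> i v + 2 * dist u v"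
proof -
  interpret P: prob_space "plays M g" by (rule prob_plays)
  have "deviation M g \<tau> i u \<le> (LINT a|plays M g. \<bar>v (a i, realized M a) - v (a i, \<tau>)\<bar> + 2 * dist u v)"
    unfolding deviation_def
  proof (intro integral_mono)
    fix a
    have "\<bar>u x - v x\<bar> \<le> dist u v" for x using dist_bounded[of u x v] by (simp add: dist_real_def)
    from this[of "(a i, realized M a)"] this[of "(a i, \<tau>)"]
    show "\<bar>u (a i, realized M a) - u (a i, \<tau>)\<bar> \<le> \<bar>v (a i, realized M a) - v (a i, \<tau>)\<bar> + 2 * dist u v"
      by linarith
  qed (use assms in simp_all)
  also have "\<dots> = deviation M g \<tau> i v + 2 * dist u v"
    unfolding deviation_def using assms P.prob_space by simp
  finally show ?thesis .
qed

text \<open>If no test average strays d/2 from its mean, the realized distribution lies in the given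
  neighbourhood of \<tau> and the payoff error is at most \<open>e\<close>. Otherwise the trivial
  bound \<open>2 * norm u\<close> is used, with the probability of this event estimated by summing
  over \<open>T\<close>.\<close>

lemma deviation_le:
  fixes u :: "('a \<times> 'a borel_prob) \<Rightarrow>\<^sub>C real"
  assumes i: "i \<in> space M" and "finite T" "d > 0"
    and nbhd: "\<And>\<sigma>. \<forall>f\<in>T. \<bar>bp_int \<sigma> f - bp_int \<tau> f\<bar> < d \<Longrightarrow> norm (slice u \<sigma> - slice u \<tau>) \<le> e"
    and L: "\<And>j. j \<in> space M \<Longrightarrow> measure M {j} \<le> L"
    and close: "\<And>f. f \<in> T \<Longrightarrow> \<bar>(\<Sum>j\<in>space M. measure M {j} * bp_int (g j) f) - bp_int \<tau> f\<bar> < d / 2"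
  shows "deviation M g \<tau> i u \<le> e + 2 * norm u * (\<Sum>f\<in>T. 4 * (norm f + 1)\<^sup>2 * L / (d / 2)\<^sup>2)"
proof -
  interpret P: prob_space "plays M g" by (rule prob_plays)
  define B where "B f = {a\<in>space (plays M g). d / 2 \<le> \<bar>(\<Sum>j\<in>space M. measure M {j} * apply_bcontfun f (a j)) -
    (\<Sum>j\<in>space M. measure M {j} * bp_int (g j) f)\<bar>}" for f
  have [measurable]: "(\<lambda>a. \<Sum>j\<in>space M. measure M {j} * apply_bcontfun f (a j)) \<in> borel_measurable (plays M g)" for f :: "'a \<Rightarrow>\<^sub>C real"
    by (intro borel_measurable_sum borel_measurable_times borel_measurable_const
        measurable_compose[OF measurable_coordinate borel_measurable_bcontfun])
  have [measurable]: "B f \<in> sets (plays M g)" for f unfolding B_def by measurable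
  have [simp]: "integrable (plays M g) (indicat_real (B f))" for f
    by (intro integrable_real_indicator) (auto simp: P.emeasure_eq_measure)
  have "e \<ge> 0" using nbhd[of \<tau>] \<open>d > 0\<close> by simp
  have "\<bar>u (a i, realized M a) - u (a i, \<tau>)\<bar> \<le> e + 2 * norm u * (\<Sum>f\<in>T. indicator (B f) a)"
    if "a \<in> space (plays M g)" for a
  proof (cases "\<exists>f\<in>T. a \<in> B f")
    case True
    then obtain f where f: "f \<in> T" "a \<in> B f" by blast
    have "1 \<le> (\<Sum>f\<in>T. indicat_real (B f) a)"
      using member_le_sum[of f T "\<lambda>f. indicat_real (B f) a"] f \<open>finite T\<close> by simp
    then have "2 * norm u * 1 \<le> 2 * norm u * (\<Sum>f\<in>T. indicator (B f) a)"
      by (intro mult_left_mono) auto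
    then show ?thesis
      using abs_bcontfun_le[of u "(a i, realized M a)"] abs_bcontfun_le[of u "(a i, \<tau>)"] \<open>e \<ge> 0\<close> by linarith
  next
    case False
    have "\<bar>bp_int (realized M a) f - bp_int \<tau> f\<bar> < d" if "f \<in> T" for f
    proof -
      have "\<bar>bp_int (realized M a) f - (\<Sum>j\<in>space M. measure M {j} * bp_int (g j) f)\<bar> < d / 2"
        using False that \<open>a \<in> space (plays M g)\<close> unfolding B_def bp_int_realized by auto
      then show ?thesis using close[OF that] by linarith
    qed
    then have "norm (slice u (realized M a) - slice u \<tau>) \<le> e" using nbhd by blast
    moreover have "(\<Sum>f\<in>T. indicat_real (B f) a) = 0" using False by (intro sum.neutral) auto
    ultimately show ?thesis
      using abs_bcontfun_le[of "slice u (realized M a) - slice u \<tau>" "a i"] by simp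
  qed
  then have "deviation M g \<tau> i u \<le> (LINT a|plays M g. e + 2 * norm u * (\<Sum>f\<in>T. indicator (B f) a))"
    unfolding deviation_def using i
    by (intro integral_mono) (auto intro!: Bochner_Integration.integrable_add integrable_mult_right Bochner_Integration.integrable_sum)
  also have "\<dots> = e + 2 * norm u * (\<Sum>f\<in>T. P.prob (B f))"
    by (subst Bochner_Integration.integral_add; auto simp: P.prob_space Bochner_Integration.integral_sum
        intro!: integrable_mult_right Bochner_Integration.integrable_sum)
  also have "\<dots> \<le> e + 2 * norm u * (\<Sum>f\<in>T. 4 * (norm f + 1)\<^sup>2 * L / (d / 2)\<^sup>2)"
    unfolding B_def using \<open>d > 0\<close>
    by (intro add_left_mono mult_left_mono sum_mono law_of_large_numbers L) auto
  finally show ?thesis .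
qed

lemma bdd_above_deviation:
  fixes u :: "('a \<times> 'a borel_prob) \<Rightarrow>\<^sub>C real"
  shows "bdd_above ((\<lambda>(i, g'). deviation M g' \<tau> i u) ` {(i, g'). i \<in> space M \<and> (g' = g \<or> (\<exists>b. g' = g(i := dirac b)))})"
proof (rule bdd_aboveI[of _ "2 * norm u"], clarify)
  fix i g' assume i: "i \<in> space M"
  have "deviation M g' \<tau> i 0 = 0" by (simp add: deviation_def)
  then show "deviation M g' \<tau> i u \<le> 2 * norm u" using deviation_Lipschitz[OF i, of g' \<tau> u 0] by simp
qed

lemma deviation_le_finite_error:
  fixes u :: "('a \<times> 'a borel_prob) \<Rightarrow>\<^sub>C real"
  assumes "i \<in> space M" "g' = g \<or> (\<exists>b. g' = g(i := dirac b))"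
  shows "deviation M g' \<tau> i u \<le> finite_error M g \<tau> u"
  unfolding finite_error_def
  using cSUP_upper[OF _ bdd_above_deviation, of "(i, g')" g \<tau> u] assms by simp

lemma finite_error_least:
  assumes "\<And>i g'. i \<in> space M \<Longrightarrow> g' = g \<or> (\<exists>b. g' = g(i := dirac b)) \<Longrightarrow> deviation M g' \<tau> i u \<le> z"
  shows "finite_error M g \<tau> u \<le> z"
  unfolding finite_error_def by (rule cSUP_least) (use space_M_nonempty assms in auto)

lemma finite_error_nonneg: "0 \<le> finite_error M g \<tau> (u :: ('a \<times> 'a borel_prob) \<Rightarrow>\<^sub>C real)"
proof -
  obtain i where "i \<in> space M" using space_M_nonempty by blast
  then show ?thesis using deviation_le_finite_error[of i g g \<tau> u] deviation_nonneg[of g \<tau> i u] by simp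
qed

lemma finite_error_Lipschitz:
  "finite_error M g \<tau> (u :: ('a \<times> 'a borel_prob) \<Rightarrow>\<^sub>C real) \<le> finite_error M g \<tau> v + 2 * dist u v"
proof (rule finite_error_least)
  fix i g' assume *: "i \<in> space M" "g' = g \<or> (\<exists>b. g' = g(i := dirac b))"
  show "deviation M g' \<tau> i u \<le> finite_error M g \<tau> v + 2 * dist u v"
    using deviation_Lipschitz[OF *(1), of g' \<tau> u v] deviation_le_finite_error[OF *, of \<tau> v] by linarith
qed

text \<open>Half of the admissible d/2 is granted to the distance of the summary from \<tau>, the
  other half to its displacement by one deviating player of weight at most \<open>L\<close>.\<close>

lemma finite_error_le:
  fixes u :: "('a \<times> 'a borel_prob) \<Rightarrow>\<^sub>C real"
  assumes "finite T" "d > 0"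
    and nbhd: "\<And>\<sigma>. \<forall>f\<in>T. \<bar>bp_int \<sigma> f - bp_int \<tau> f\<bar> < d \<Longrightarrow> norm (slice u \<sigma> - slice u \<tau>) \<le> e"
    and L: "\<And>j. j \<in> space M \<Longrightarrow> measure M {j} \<le> L"
    and close: "\<And>f. f \<in> T \<Longrightarrow> \<bar>bp_int (societal_summary M g) f - bp_int \<tau> f\<bar> < d / 4"
    and small: "\<And>f. f \<in> T \<Longrightarrow> 2 * L * norm f < d / 4"
  shows "finite_error M g \<tau> u \<le> e + 2 * norm u * (\<Sum>f\<in>T. 4 * (norm f + 1)\<^sup>2 * L / (d / 2)\<^sup>2)"
proof (rule finite_error_least, rule deviation_le[OF _ assms(1,2) nbhd L])
  fix i g' f assume i: "i \<in> space M" and g': "g' = g \<or> (\<exists>b. g' = g(i := dirac b))" and f: "f \<in> T"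
  have "\<bar>(\<Sum>j\<in>space M. measure M {j} * bp_int (g' j) f) - bp_int (societal_summary M g) f\<bar> \<le> 2 * L * norm f"
    unfolding bp_int_summary
  proof (cases "g' = g")
    case True
    have "0 \<le> L" using order_trans[OF measure_nonneg L[OF i]] .
    with True show "\<bar>(\<Sum>j\<in>space M. measure M {j} * bp_int (g' j) f) - (\<Sum>j\<in>space M. measure M {j} * bp_int (g j) f)\<bar> \<le> 2 * L * norm f"
      by simp
  next
    case False
    then obtain b where "g' = g(i := dirac b)" using g' by blast
    then show "\<bar>(\<Sum>j\<in>space M. measure M {j} * bp_int (g' j) f) - (\<Sum>j\<in>space M. measure M {j} * bp_int (g j) f)\<bar> \<le> 2 * L * norm f"
      using summary_update_close[OF i L[OF i]] by simp
  qed
  then show "\<bar>(\<Sum>j\<in>space M. measure M {j} * bp_int (g' j) f) - bp_int \<tau> f\<bar> < d / 2"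
    using close[OF f] small[OF f] by linarith
qed auto

section \<open>Equilibria have small regret at the limit summary\<close>

lemma expected_payoff_eq:
  fixes G :: "'i \<Rightarrow> 'a characteristics"
  assumes i: "i \<in> space M" and "finite_profile M G g"
  shows "expected_payoff M G g i = (LINT a|plays M g. apply_bcontfun (snd (G i)) (a i, realized M a))"
proof -
  \<comment> \<open>Each action is feasible almost surely and there are finitely many players, so
    restricting the integral to the product of the feasible sets changes nothing.\<close>
  have AE: "AE a in plays M g. a \<in> (\<Pi>\<^sub>E j\<in>space M. feasible G j)"
  proof -
    have "AE a in plays M g. a j \<in> feasible G j" if "j \<in> space M" for j
      unfolding plays_def
    proof (rule AE_PiM_component[OF _ that])
      show "AE x in bp_measure (g j). x \<in> feasible G j"
        using assms(2) that unfolding finite_profile_def feasible_def by (intro AE_in_of_measure_1 cset_borel) auto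
    qed simp
    then have "AE a in plays M g. \<forall>j\<in>space M. a j \<in> feasible G j"
      using finite_space by (intro AE_finite_allI)
    then show ?thesis using AE_space by eventually_elim (auto simp: space_plays PiE_iff)
  qed
  have m: "(\<lambda>a. apply_bcontfun (snd (G i)) (a i, realized M a)) \<in> borel_measurable (plays M g)"
    by (rule measurable_payoff[OF i])
  have "(\<Pi>\<^sub>E j\<in>space M. feasible G j) \<in> sets (plays M g)"
    unfolding plays_def using finite_space by (intro sets_PiM_I_finite) (auto simp: feasible_def)
  then have "(\<lambda>a. indicator (\<Pi>\<^sub>E j\<in>space M. feasible G j) a *\<^sub>R apply_bcontfun (snd (G i)) (a i, realized M a)) \<in> borel_measurable (plays M g)"
    using m by (intro borel_measurable_scaleR borel_measurable_indicator)
  then show ?thesis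
    unfolding expected_payoff_def set_lebesgue_integral_def payoff_def plays_def[symmetric] realized_def[symmetric]
    using AE m by (intro integral_cong_AE) (auto elim: eventually_mono)
qed

text \<open>For a pure deviation the equilibrium inequality compares two expected payoffs.
  Evaluating both at \<tau> instead costs one \<open>finite_error\<close> each, which explains the
  factor 2.\<close>

lemma finite_nash_regret:
  fixes G :: "'i \<Rightarrow> 'a characteristics"
  assumes nash: "finite_nash M G g" and i: "i \<in> space M"
  shows "bp_int (g i) (regret (fst (G i)) (slice (snd (G i)) \<tau>)) \<le> min 1 (2 * finite_error M g \<tau> (snd (G i)))"
proof (rule regret_le)
  have prof: "finite_profile M G g" using nash by (simp add: finite_nash_def)
  then show "measure (bp_measure (g i)) (cset (fst (G i))) = 1"
    using i by (simp add: finite_profile_def feasible_def)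
  fix b assume b: "b \<in> cset (fst (G i))"
  define g' where "g' = g(i := dirac b)"
  have dirac1: "measure (bp_measure (dirac b)) (feasible G i) = 1"
    using b by (simp add: feasible_def measure_return)
  have upd: "g' = g \<or> (\<exists>b. g' = g(i := dirac b))" unfolding g'_def by blast
  from dirac1 have prof': "finite_profile M G g'" using prof by (auto simp: g'_def finite_profile_def)
  have "expected_payoff M G g' i \<le> expected_payoff M G g i"
    using nash i dirac1 unfolding g'_def finite_nash_def by blast
  moreover have "\<bar>(LINT a|plays M k. apply_bcontfun (snd (G i)) (a i, realized M a)) - bp_int (k i) (slice (snd (G i)) \<tau>)\<bar>
      \<le> deviation M k \<tau> i (snd (G i))" for k
  proof -
    have "bp_int (k i) (slice (snd (G i)) \<tau>) = (LINT a|plays M k. apply_bcontfun (snd (G i)) (a i, \<tau>))"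
      using integral_coordinate[OF i, of k "slice (snd (G i)) \<tau>"] by simp
    then have "(LINT a|plays M k. apply_bcontfun (snd (G i)) (a i, realized M a)) - bp_int (k i) (slice (snd (G i)) \<tau>)
      = (LINT a|plays M k. apply_bcontfun (snd (G i)) (a i, realized M a) - apply_bcontfun (snd (G i)) (a i, \<tau>))"
      using i by simp
    then show ?thesis unfolding deviation_def by (simp add: integral_abs_bound)
  qed
  from this[of g] this[of g'] have
    "\<bar>expected_payoff M G g i - bp_int (g i) (slice (snd (G i)) \<tau>)\<bar> \<le> finite_error M g \<tau> (snd (G i))"
    "\<bar>expected_payoff M G g' i - slice (snd (G i)) \<tau> b\<bar> \<le> finite_error M g \<tau> (snd (G i))"
    using deviation_le_finite_error[OF i, of g g \<tau> "snd (G i)"] deviation_le_finite_error[OF i upd, of \<tau> "snd (G i)"]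
      fun_upd_same[of g i "dirac b", folded g'_def]
    unfolding expected_payoff_eq[OF i prof] expected_payoff_eq[OF i prof'] by simp_all
  ultimately show "slice (snd (G i)) \<tau> b - bp_int (g i) (slice (snd (G i)) \<tau>) \<le> 2 * finite_error M g \<tau> (snd (G i))"
    by linarith
qed

end

end

text \<open>The equilibrium inequality evaluates both sides at the same summary. Replacing it by
  \<tau> costs the norm of the difference of the slices once on each side.\<close>

lemma large_nash_regret:
  fixes G :: "'i \<Rightarrow> 'a::metric_space characteristics"
  assumes "large_nash M G g"
  shows "AE i in M. bp_int (g i) (regret (fst (G i)) (slice (snd (G i)) \<tau>)) \<le>
    min 1 (2 * norm (slice (snd (G i)) (societal_summary M g) - slice (snd (G i)) \<tau>))"
proof -
  let ?s = "societal_summary M g"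
  have "AE i in M. measure (bp_measure (g i)) (feasible G i) = 1"
    and "AE i in M. \<forall>\<mu>. measure (bp_measure \<mu>) (feasible G i) = 1 \<longrightarrow>
        (LINT a:feasible G i|bp_measure (g i). payoff G i a ?s) \<ge>
        (LINT a:feasible G i|bp_measure \<mu>. payoff G i a ?s)"
    using assms by (auto simp: large_nash_def large_profile_def)
  then show ?thesis
  proof eventually_elim
    case (elim i)
    define v w where "v = slice (snd (G i)) ?s" and "w = slice (snd (G i)) \<tau>"
    have K: "measure (bp_measure (g i)) (cset (fst (G i))) = 1" using elim(1) by (simp add: feasible_def)
    show ?case unfolding v_def[symmetric] w_def[symmetric]
    proof (rule regret_le[OF K])
      fix b assume b: "b \<in> cset (fst (G i))"
      then have d: "measure (bp_measure (dirac b)) (cset (fst (G i))) = 1" by (simp add: measure_return)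
      have pay: "payoff G i a ?s = v a" for a by (simp add: payoff_def v_def)
      have "bp_int (dirac b) v \<le> bp_int (g i) v"
        using elim(2)[rule_format, of "dirac b"] d
        unfolding pay feasible_def set_integral_full[OF K] by (simp only: set_integral_full[OF d])
      then show "w b - bp_int (g i) w \<le> 2 * norm (v - w)"
        using abs_bcontfun_le[of "v - w" b] abs_bp_int_diff_le[of "g i" v w] by (simp add: abs_le_iff)
    qed
  qed
qed

text \<open>The payoff \<open>u\<close> is fixed, so one neighbourhood of \<tau> given by finitely
  many test functions serves all n. In finite-player games the concentration bound vanishes with the
  largest weight; in large games closeness of the summaries suffices.\<close>

lemma nash_error_tendsto_0:
  fixes J :: "nat \<Rightarrow> 'j measure" and h :: "nat \<Rightarrow> 'j \<Rightarrow> 'a::metric_space borel_prob"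
    and u :: "('a \<times> 'a borel_prob) \<Rightarrow>\<^sub>C real"
  assumes comp: "compact (UNIV :: 'a set)"
    and negligible: "((\<lambda>n. SUP i\<in>space (J n). measure (J n) {i}) \<longlongrightarrow> 0)
      (inf sequentially (principal {n. finite_player_space n (J n)}))"
    and summaries: "(\<lambda>n. societal_summary (J n) (h n)) \<longlonglongrightarrow> \<tau>"
  shows "(\<lambda>n. if finite_player_space n (J n) then 2 * finite_error (J n) (h n) \<tau> u
    else 2 * norm (slice u (societal_summary (J n) (h n)) - slice u \<tau>)) \<longlonglongrightarrow> 0"
    (is "?err \<longlonglongrightarrow> 0")
proof (rule LIMSEQ_I)
  fix e :: real assume "e > 0"
  then obtain T d where T: "finite T" "d > 0"
    and nbhd: "\<And>\<sigma>. \<forall>f\<in>T. \<bar>bp_int \<sigma> f - bp_int \<tau> f\<bar> < d \<Longrightarrow> norm (slice u \<sigma> - slice u \<tau>) \<le> e / 8"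
    using slice_nbhd[OF comp, of "e / 8" \<tau> u] by auto
  define L where "L n = (SUP i\<in>space (J n). measure (J n) {i})" for n
  \<comment> \<open>If only finitely many games are finite-player games this filter is trivial, and
    the statements derived from it hold vacuously for large n.\<close>
  let ?F = "inf sequentially (principal {n. finite_player_space n (J n)})"
  let ?B = "\<lambda>n. e / 8 + 2 * norm u * (\<Sum>f\<in>T. 4 * (norm f + 1)\<^sup>2 * L n / (d / 2)\<^sup>2)"
  have L: "(L \<longlongrightarrow> 0) ?F" using negligible unfolding L_def .
  have "\<forall>\<^sub>F n in sequentially. \<forall>f\<in>T. \<bar>bp_int (societal_summary (J n) (h n)) f - bp_int \<tau> f\<bar> < d / 4"
  proof (intro eventually_ball_finite T ballI)
    fix f
    have "(\<lambda>n. bp_int (societal_summary (J n) (h n)) f) \<longlonglongrightarrow> bp_int \<tau> f"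
      using summaries unfolding tendsto_borel_prob by blast
    from tendstoD[OF this, of "d / 4"] T(2)
    show "\<forall>\<^sub>F n in sequentially. \<bar>bp_int (societal_summary (J n) (h n)) f - bp_int \<tau> f\<bar> < d / 4"
      by (simp add: dist_real_def)
  qed
  moreover have "\<forall>\<^sub>F n in sequentially. finite_player_space n (J n) \<longrightarrow> ?B n < e / 4"
  proof -
    have "(?B \<longlongrightarrow> e / 8 + 2 * norm u * (\<Sum>f\<in>T. 4 * (norm f + 1)\<^sup>2 * 0 / (d / 2)\<^sup>2)) ?F"
      using T(2) by (intro tendsto_intros L) simp
    then have "(?B \<longlongrightarrow> e / 8) ?F" by simp
    then have "\<forall>\<^sub>F n in ?F. ?B n < e / 4"
      by (rule order_tendstoD) (use \<open>e > 0\<close> in simp)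
    then show ?thesis by (simp add: eventually_inf_principal)
  qed
  moreover have "\<forall>\<^sub>F n in sequentially. finite_player_space n (J n) \<longrightarrow> (\<forall>f\<in>T. 2 * L n * norm f < d / 4)"
  proof -
    have "\<forall>\<^sub>F n in ?F. \<forall>f\<in>T. 2 * L n * norm f < d / 4"
    proof (intro eventually_ball_finite T ballI)
      fix f
      have "((\<lambda>n. 2 * L n * norm f) \<longlongrightarrow> 2 * 0 * norm f) ?F" by (intro tendsto_intros L)
      then show "\<forall>\<^sub>F n in ?F. 2 * L n * norm f < d / 4"
        by (rule order_tendstoD) (use T(2) in simp)
    qed
    then show ?thesis by (simp add: eventually_inf_principal)
  qed
  ultimately have "\<forall>\<^sub>F n in sequentially. norm (?err n - 0) < e"
  proof eventually_elim
    case (elim n)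
    show ?case
    proof (cases "finite_player_space n (J n)")
      case True
      have "measure (J n) {j} \<le> L n" if "j \<in> space (J n)" for j
        unfolding L_def using that True
        by (intro cSUP_upper) (auto simp: finite_player_space_def intro!: bdd_above_finite)
      then have "finite_error (J n) (h n) \<tau> u \<le> ?B n"
        using elim True by (intro finite_error_le[OF True comp T nbhd]) auto
      then show ?thesis
        using elim True \<open>e > 0\<close> finite_error_nonneg[OF True comp, of "h n" \<tau> u] by simp
    next
      case False
      have "norm (slice u (societal_summary (J n) (h n)) - slice u \<tau>) \<le> e / 8"
        using elim(1) T(2) by (intro nbhd) force
      then show ?thesis using False \<open>e > 0\<close> by simp
    qed
  qed
  then show "\<exists>N. \<forall>n\<ge>N. norm (?err n - 0) < e" by (simp add: eventually_sequentially)
qed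

lemma nash_of_zero_regret:
  fixes G :: "'i \<Rightarrow> 'a::metric_space characteristics"
  assumes "g \<in> borel_measurable M" and s: "societal_summary M g = \<tau>"
    and "AE i in M. bp_int (g i) (regret (fst (G i)) (slice (snd (G i)) \<tau>)) = 0"
  shows "large_nash M G g"
proof -
  have "AE i in M. measure (bp_measure (g i)) (feasible G i) = 1"
    using assms(3) by eventually_elim (simp add: feasible_def regret_eq_0D(1))
  moreover have "AE i in M. \<forall>\<mu>. measure (bp_measure \<mu>) (feasible G i) = 1 \<longrightarrow>
        (LINT a:feasible G i|bp_measure (g i). payoff G i a \<tau>) \<ge>
        (LINT a:feasible G i|bp_measure \<mu>. payoff G i a \<tau>)"
    using assms(3)
  proof (eventually_elim, intro allI impI)
    fix i and \<mu> :: "'a borel_prob"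
    assume z: "bp_int (g i) (regret (fst (G i)) (slice (snd (G i)) \<tau>)) = 0"
      and \<mu>: "measure (bp_measure \<mu>) (feasible G i) = 1"
    have pay: "payoff G i a \<tau> = slice (snd (G i)) \<tau> a" for a by (simp add: payoff_def)
    have \<mu>': "measure (bp_measure \<mu>) (cset (fst (G i))) = 1" using \<mu> by (simp add: feasible_def)
    show "(LINT a:feasible G i|bp_measure (g i). payoff G i a \<tau>) \<ge>
        (LINT a:feasible G i|bp_measure \<mu>. payoff G i a \<tau>)"
      unfolding pay feasible_def set_integral_full[OF \<mu>'] set_integral_full[OF regret_eq_0D(1)[OF z]]
        regret_eq_0D(2)[OF z]
      by (rule bp_int_le_best[OF \<mu>'])
  qed
  ultimately show ?thesis
    using assms(1) by (simp add: large_nash_def large_profile_def s)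
qed

section \<open>The strong closed graph property\<close>

theorem proposition1:
  fixes I :: "'i measure" and G :: "'i \<Rightarrow> 'a::metric_space characteristics"
    and J :: "nat \<Rightarrow> 'j measure" and H :: "nat \<Rightarrow> 'j \<Rightarrow> 'a characteristics"
    and h :: "nat \<Rightarrow> 'j \<Rightarrow> 'a borel_prob" and \<tau> :: "'a borel_prob"
  assumes "compact (UNIV :: 'a set)"
    and "large_game I G"
    and games: "\<forall>n\<ge>1. finite_player_space n (J n) \<or> large_game (J n) (H n)"
    and negligible: "((\<lambda>n. SUP i\<in>space (J n). measure (J n) {i}) \<longlongrightarrow> 0)
      (inf sequentially (principal {n. finite_player_space n (J n)}))"
    and convergence: "(\<lambda>n. law (J n) (H n)) \<longlonglongrightarrow> law I G"
    and equilibria: "\<forall>n\<ge>1. (finite_player_space n (J n) \<longrightarrow> finite_nash (J n) (H n) (h n)) \<and>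
      (large_game (J n) (H n) \<longrightarrow> large_nash (J n) (H n) (h n))"
    and summaries: "(\<lambda>n. societal_summary (J n) (h n)) \<longlonglongrightarrow> \<tau>"
  shows "\<exists>g. large_nash I G g \<and> societal_summary I g = \<tau>"
proof -
  note comp = assms(1)
  have I: "prob_space I" and G_meas: "G \<in> borel_measurable I"
    using assms(2) by (auto simp: large_game_def)
  \<comment> \<open>The hypotheses on the games concern only indices at least 1; from here on every
    sequence is shifted by \<open>Suc\<close>.\<close>
  have J: "prob_space (J (Suc n))" for n
    using games[rule_format, of "Suc n"] by (auto simp: large_game_def finite_player_space_def)
  have H_meas: "H (Suc n) \<in> borel_measurable (J (Suc n))" for n
    using games[rule_format, of "Suc n"] by (auto simp: large_game_def intro: measurable_from_M)
  have h_meas: "h (Suc n) \<in> borel_measurable (J (Suc n))" for n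
    using games[rule_format, of "Suc n"] equilibria[rule_format, of "Suc n"]
    by (auto simp: large_nash_def large_profile_def intro: measurable_from_M)
  have conv: "(\<lambda>n. LINT j|J (Suc n). \<Phi> (H (Suc n) j)) \<longlonglongrightarrow> (LINT i|I. \<Phi> (G i))"
    if \<Phi>: "continuous_on UNIV \<Phi>" "\<And>c. 0 \<le> \<Phi> c" "\<And>c. \<Phi> c \<le> 1" for \<Phi> :: "'a characteristics \<Rightarrow> real"
  proof -
    have b: "\<Phi> \<in> bcontfun" using \<Phi> by (intro bcontfun_normI[where b=1]) auto
    have [measurable]: "\<Phi> \<in> borel_measurable borel" by (rule borel_measurable_continuous_onI[OF \<Phi>(1)])
    have law_J: "bp_int (law (J (Suc n)) (H (Suc n))) (Bcontfun \<Phi>) = (LINT j|J (Suc n). \<Phi> (H (Suc n) j))" for n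
      by (simp add: bp_int_def bp_measure_law[OF J H_meas] Bcontfun_inverse[OF b] integral_distr[OF H_meas])
    have law_I: "bp_int (law I G) (Bcontfun \<Phi>) = (LINT i|I. \<Phi> (G i))"
      by (simp add: bp_int_def bp_measure_law[OF I G_meas] Bcontfun_inverse[OF b] integral_distr[OF G_meas])
    have "(\<lambda>n. bp_int (law (J n) (H n)) (Bcontfun \<Phi>)) \<longlonglongrightarrow> bp_int (law I G) (Bcontfun \<Phi>)"
      using convergence unfolding tendsto_borel_prob by blast
    from LIMSEQ_Suc[OF this] show ?thesis unfolding law_J law_I .
  qed
  \<comment> \<open>One function of the payoff bounds the regret in both kinds of games, so mixed
    sequences need no passage to subsequences.\<close>
  define err where "err n u = (if finite_player_space n (J n) then 2 * finite_error (J n) (h n) \<tau> u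
    else 2 * norm (slice u (societal_summary (J n) (h n)) - slice u \<tau>))" for n u
  define w where "w c = regret (fst c) (slice (snd c) \<tau>)" for c :: "'a characteristics"
  have cont_w: "continuous_on UNIV w" unfolding w_def by (rule continuous_on_regret_slice[OF comp])
  have meas_w: "w \<in> borel_measurable borel" by (rule borel_measurable_continuous_onI[OF cont_w])
  have w01: "0 \<le> w c a" "w c a \<le> 1" for c a by (simp_all add: w_def regret_bounds)
  have err_nonneg: "0 \<le> err n u" for n u
    by (auto simp: err_def intro: finite_error_nonneg[OF _ comp])
  \<comment> \<open>In both cases the constant is 2 times 2: the error carries a factor 2, and the
    payoff enters at two summaries.\<close>
  have err_Lipschitz: "err n u \<le> err n v + 4 * dist u v" for n u v
  proof (cases "finite_player_space n (J n)")
    case True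
    then show ?thesis using finite_error_Lipschitz[OF True comp, of "h n" \<tau> u v] by (simp add: err_def)
  next
    case False
    let ?s = "societal_summary (J n) (h n)"
    let ?x = "slice v ?s - slice v \<tau>" and ?y = "slice (u - v) ?s" and ?z = "slice (u - v) \<tau>"
    have "slice u ?s - slice u \<tau> = ?x + ?y - ?z"
      by (simp add: slice_diff)
    then have "norm (slice u ?s - slice u \<tau>) \<le> norm ?x + norm ?y + norm ?z"
      using norm_triangle_ineq4[of "?x + ?y" ?z] norm_triangle_ineq[of ?x ?y] by simp
    then show ?thesis using False norm_slice_le[of "u - v" ?s] norm_slice_le[of "u - v" \<tau>]
      by (simp add: err_def dist_norm)
  qed
  have err_cont: "continuous_on UNIV (\<lambda>u. min 1 (err n u))" for n
    by (intro continuous_on_min continuous_on_const continuous_on_one_sided_Lipschitz[OF err_Lipschitz])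
  have meas_snd: "(\<lambda>x. snd (X x)) \<in> borel_measurable M" if "X \<in> borel_measurable M" for X :: "'k \<Rightarrow> 'a characteristics" and M
    by (rule measurable_compose[OF that borel_measurable_continuous_onI]) (intro continuous_intros)
  have regret_err: "AE j in J (Suc n). bp_int (h (Suc n) j) (w (H (Suc n) j)) \<le> min 1 (err (Suc n) (snd (H (Suc n) j)))" for n
  proof (cases "finite_player_space (Suc n) (J (Suc n))")
    case True
    then have "finite_nash (J (Suc n)) (H (Suc n)) (h (Suc n))" using equilibria by simp
    then show ?thesis
      using finite_nash_regret[OF True comp] by (intro AE_I2) (simp add: err_def w_def True)
  next
    case False
    then have "large_nash (J (Suc n)) (H (Suc n)) (h (Suc n))"
      using games[rule_format, of "Suc n"] equilibria by simp
    then show ?thesis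
      using large_nash_regret[of "J (Suc n)" "H (Suc n)" "h (Suc n)" \<tau>] by (simp add: err_def w_def False)
  qed
  \<comment> \<open>For a fixed payoff the error tends to 0; the common Lipschitz constant allows
    the payoffs to vary with the player and the game.\<close>
  have lim_err: "(\<lambda>n. LINT j|J (Suc n). min 1 (err (Suc n) (snd (H (Suc n) j)))) \<longlonglongrightarrow> 0"
  proof (rule integral_equi_Lipschitz_tendsto_0[OF I meas_snd[OF G_meas] J meas_snd[OF H_meas]])
    fix \<Phi> :: "(('a \<times> 'a borel_prob) \<Rightarrow>\<^sub>C real) \<Rightarrow> real"
    assume \<Phi>: "continuous_on UNIV \<Phi>" "\<And>x. 0 \<le> \<Phi> x" "\<And>x. \<Phi> x \<le> 1"
    show "(\<lambda>n. LINT j|J (Suc n). \<Phi> (snd (H (Suc n) j))) \<longlonglongrightarrow> (LINT i|I. \<Phi> (snd (G i)))"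
      by (intro conv \<Phi> continuous_on_compose2[OF \<Phi>(1)] continuous_intros) auto
  next
    show "(\<lambda>n. err (Suc n) u) \<longlonglongrightarrow> 0" for u
      using LIMSEQ_Suc[OF nash_error_tendsto_0[OF comp negligible summaries, of u]] by (simp only: err_def)
  qed (rule err_nonneg err_Lipschitz)+
  have norm_w: "norm (w c) \<le> 1" for c using w01 by (intro norm_bound) (simp add: abs_of_nonneg)
  \<comment> \<open>The laws of the regret functions converge by continuity of \<open>w\<close>, and
    the average regrets vanish because \<open>regret_err\<close> bounds them by the integrals in
    \<open>lim_err\<close>.\<close>
  have "\<exists>g\<in>borel_measurable I. societal_summary I g = \<tau> \<and> (AE i in I. bp_int (g i) (w (G i)) = 0)"
  proof (rule limit_kernel[OF comp I measurable_compose[OF G_meas meas_w] w01 J measurable_compose[OF H_meas meas_w] w01 h_meas])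
    fix \<Phi> :: "('a \<Rightarrow>\<^sub>C real) \<Rightarrow> real"
    assume \<Phi>: "continuous_on UNIV \<Phi>" "\<And>x. 0 \<le> \<Phi> x" "\<And>x. \<Phi> x \<le> 1"
    show "(\<lambda>n. LINT j|J (Suc n). \<Phi> (w (H (Suc n) j))) \<longlonglongrightarrow> (LINT i|I. \<Phi> (w (G i)))"
      by (intro conv \<Phi> continuous_on_compose2[OF \<Phi>(1) cont_w]) auto
  next
    fix f
    have "(\<lambda>n. bp_int (societal_summary (J n) (h n)) f) \<longlonglongrightarrow> bp_int \<tau> f"
      using summaries unfolding tendsto_borel_prob by blast
    from LIMSEQ_Suc[OF this]
    show "(\<lambda>n. LINT j|J (Suc n). bp_int (h (Suc n) j) f) \<longlonglongrightarrow> bp_int \<tau> f"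
      by (simp add: bp_int_societal_summary[OF J h_meas])
  next
    show "(\<lambda>n. LINT j|J (Suc n). bp_int (h (Suc n) j) (w (H (Suc n) j))) \<longlonglongrightarrow> 0"
    proof (rule Lim_null_comparison[OF _ lim_err], rule always_eventually, rule allI)
      fix n
      interpret prob_space "J (Suc n)" by (rule J)
      have [measurable]: "(\<lambda>j. w (H (Suc n) j) k) \<in> borel_measurable (J (Suc n))" for k
        by (rule measurable_compose[OF measurable_compose[OF H_meas meas_w]
              borel_measurable_continuous_onI[OF continuous_on_bcontfun_eval]])
      have m1: "(\<lambda>j. bp_int (h (Suc n) j) (w (H (Suc n) j))) \<in> borel_measurable (J (Suc n))"
        by (rule measurable_bp_int_param[OF comp h_meas]) measurable
      have m2: "(\<lambda>j. min 1 (err (Suc n) (snd (H (Suc n) j)))) \<in> borel_measurable (J (Suc n))"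
        by (rule measurable_compose[OF meas_snd[OF H_meas] borel_measurable_continuous_onI[OF err_cont]])
      have nonneg: "0 \<le> bp_int (h (Suc n) j) (w (H (Suc n) j))" for j by (rule bp_int_nonneg) (rule w01)
      have "(LINT j|J (Suc n). bp_int (h (Suc n) j) (w (H (Suc n) j))) \<le>
          (LINT j|J (Suc n). min 1 (err (Suc n) (snd (H (Suc n) j))))"
      proof (rule integral_mono_AE[OF _ _ regret_err])
        show "integrable (J (Suc n)) (\<lambda>j. bp_int (h (Suc n) j) (w (H (Suc n) j)))"
          using order_trans[OF abs_bp_int_le norm_w] by (intro integrable_const_bound[where B=1] m1) auto
        show "integrable (J (Suc n)) (\<lambda>j. min 1 (err (Suc n) (snd (H (Suc n) j))))"
          using err_nonneg by (intro integrable_const_bound[where B=1] m2) auto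
      qed
      then show "norm (LINT j|J (Suc n). bp_int (h (Suc n) j) (w (H (Suc n) j))) \<le>
          (LINT j|J (Suc n). min 1 (err (Suc n) (snd (H (Suc n) j))))"
        using integral_nonneg_AE[OF AE_I2[of "J (Suc n)" "\<lambda>j. 0 \<le> bp_int (h (Suc n) j) (w (H (Suc n) j))", OF nonneg]]
        by simp
    qed
  qed
  then obtain g where "g \<in> borel_measurable I" "societal_summary I g = \<tau>" "AE i in I. bp_int (g i) (w (G i)) = 0"
    by blast
  then show ?thesis using nash_of_zero_regret[of g I \<tau> G] unfolding w_def by blast
qed

end
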